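(* Let $C=C^\infty[0,1]$, $I=(0,1)$, $\Phi=\{f\in C: f(0)=f(1)=0,\ f'(0)=2f'(1)\}$, and let $S:\Phi\to C$, $Sf=(-i)^3f'''$, be the spatial differential operator associated with Problem 1 (described in the context). Let $\Delta$, $F_\lambda$ and, for each zero $\sigma\in\mathbb C$ of $\Delta$, the circle $\Gamma_\sigma$ be as defined in the context, and let $$f^\Sigma_x(F)=\sum_{\sigma\in\mathbb C:\,\Delta(\sigma)=0}\int_{\Gamma_\sigma}e^{i\lambda x}F(\lambda)\,d\lambda .$$ Then the transform pair $(F_\lambda,f^\Sigma_x)$ provides a spectral representation of $S$ by type I augmented eigenfunctions with eigenvalues $\lambda^3$, in the sense defined in the context, with $L=S$, $n=3$, $\gamma=\bigcup_{\sigma:\Delta(\sigma)=0}\Gamma_\sigma$ and $E=\{F_\lambda:\lambda\in\gamma\}$.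
   Context: **Problem 1.** $q_t+q_{xxx}=0$ on $(0,1)\times(0,T)$, $q(x,0)=f(x)$, $q(0,t)=q(1,t)=0$, $q_x(1,t)=q_x(0,t)/2$. **Contours and functionals.** $\mathbb C^{\pm}$ are the open upper/lower half-planes, $\alpha=e^{2\pi i/3}$, and $$\Delta(\lambda)=e^{i\lambda}+\alpha e^{i\alpha\lambda}+\alpha^2e^{i\alpha^2\lambda}+2(e^{-i\lambda}+\alpha e^{-i\alpha\lambda}+\alpha^2e^{-i\alpha^2\lambda}).$$ For each zero $\sigma$ of $\Delta$, $\Gamma_\sigma$ is the positively oriented circle of radius $\tfrac12$ centred at $\sigma$. Define $F_\lambda(f)=\int_0^1\phi^+(x,\lambda)f(x)\,dx$ for $\lambda\in\Gamma_\sigma$ with $\sigma\in\overline{\mathbb C^+}$, and $F_\lambda(f)=\int_0^1\phi^-(x,\lambda)f(x)\,dx$ for $\lambda\in\Gamma_\sigma$ with $\sigma\in\mathbb C^-$, where $$\phi^+(x,\lambda)=\tfrac{1}{2\pi\Delta(\lambda)}\big[e^{-i\lambda x}(e^{i\lambda}+2\alpha e^{-i\alpha\lambda}+2\alpha^2e^{-i\alpha^2\lambda})+e^{-i\alpha\lambda x}(\alpha e^{i\alpha\lambda}-2\alpha e^{-i\lambda})+e^{-i\alpha^2\lambda x}(\alpha^2e^{i\alpha^2\lambda}-2\alpha^2e^{-i\lambda})\big],$$ $$\phi^-(x,\lambda)=\tfrac{-e^{-i\lambda}}{2\pi\Delta(\lambda)}\big[e^{-i\lambda x}(2+\alpha^2e^{-i\alpha\lambda}+\alpha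 e^{-i\alpha^2\lambda})+\alpha e^{-i\alpha\lambda x}(2-e^{-i\alpha^2\lambda})+\alpha^2e^{-i\alpha^2\lambda x}(2-e^{-i\alpha\lambda})\big].$$ The integral over $\gamma=\bigcup_\sigma\Gamma_\sigma$ means the (possibly only conditionally convergent) series over the zeros $\sigma$ of the integrals over $\Gamma_\sigma$, the zeros being taken in order of increasing modulus. **Type I augmented eigenfunctions.** Let $I$ be an open real interval, $C$ a linear topological space of functions on $\overline I$, $\Phi\subseteq C$, $L:\Phi\to C$ linear, $\gamma$ an oriented contour in $\mathbb C$, and $E=\{E_\lambda:\lambda\in\gamma\}$ a family of functionals $E_\lambda\in C'$. Suppose there are remainder functionals $R_\lambda\in\Phi'$ and eigenvalues $\lambda^n$ with $E_\lambda(L\phi)=\lambda^nE_\lambda(\phi)+R_\lambda(\phi)$ for all $\phi\in\Phi$, $\lambda\in\gamma$. $E$ is a family of type I augmented eigenfunctions of $L$ up to integration along $\gamma$ if $\int_\gamma e^{i\lambda x}R_\lambda(\phi)\,d\lambda=0$ for all $\phi\in\Phi$, $x\in I$. $E$ is complete if [$\phi\in\Phi$ and $E_\lambda\phi=0$ for all $\lambda\in\gamma$] implies $\phi=0$. **Spectral representation by type I augmented eigenfunctions.** Suppose $E$ is a family of type I augmented eigenfunctions of $L$ up to integration along $\gamma$, that $\int_\gamma e^{i\lambda x}E_\lambda L\phi\,d\lambda$ converges for all $\phi\in\Phi$, $x\in I$, and that $E$ is complete. Then $E$ is said to provide a spectral representation of $L$, in the sense that $$\int_\gamma e^{i\lambda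 x}E_\lambda L\phi\,d\lambda=\int_\gamma e^{i\lambda x}\lambda^nE_\lambda\phi\,d\lambda\qquad\text{for all }\phi\in\Phi,\ x\in I.$$ *)

theory Defs
  imports "HOL-Complex_Analysis.Complex_Analysis"
begin

text \<open>
  A function on a closed interval is represented by a function on the whole real line that
  vanishes off that interval, so that equality of functions on the interval is equality in HOL.
  A linear topological space of such functions is given by a topology whose
  \<^const>\<open>topspace\<close> is the set of its elements.
\<close>

definition lin_subspace :: "(real \<Rightarrow> complex) set \<Rightarrow> bool" where
  "lin_subspace V \<longleftrightarrow>
     (\<lambda>x. 0) \<in> V \<and>
     (\<forall>f\<in>V. \<forall>g\<in>V. (\<lambda>x. f x + g x) \<in> V) \<and>
     (\<forall>c. \<forall>f\<in>V. (\<lambda>x. c * f x) \<in> V)"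

definition linear_topological_space_on :: "real set \<Rightarrow> (real \<Rightarrow> complex) topology \<Rightarrow> bool" where
  "linear_topological_space_on J T \<longleftrightarrow>
     (\<forall>f\<in>topspace T. \<forall>x. x \<notin> J \<longrightarrow> f x = 0) \<and>
     lin_subspace (topspace T) \<and>
     continuous_map (prod_topology T T) T (\<lambda>(f, g). \<lambda>x. f x + g x) \<and>
     continuous_map (prod_topology euclidean T) T (\<lambda>(c, f). \<lambda>x. c * f x)"

definition linear_operator :: "(real \<Rightarrow> complex) set \<Rightarrow> (real \<Rightarrow> complex) set \<Rightarrow>
    ((real \<Rightarrow> complex) \<Rightarrow> (real \<Rightarrow> complex)) \<Rightarrow> bool" where
  "linear_operator V W L \<longleftrightarrow>
     (\<forall>f\<in>V. L f \<in> W) \<and>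
     (\<forall>f\<in>V. \<forall>g\<in>V. L (\<lambda>x. f x + g x) = (\<lambda>x. L f x + L g x)) \<and>
     (\<forall>c. \<forall>f\<in>V. L (\<lambda>x. c * f x) = (\<lambda>x. c * L f x))"

definition topological_dual :: "(real \<Rightarrow> complex) topology \<Rightarrow> ((real \<Rightarrow> complex) \<Rightarrow> complex) set" where
  "topological_dual T = {l.
     (\<forall>f\<in>topspace T. \<forall>g\<in>topspace T. l (\<lambda>x. f x + g x) = l f + l g) \<and>
     (\<forall>c. \<forall>f\<in>topspace T. l (\<lambda>x. c * f x) = c * l f) \<and>
     continuous_map T euclidean l}"

text \<open>
  An oriented contour enters through its set of points \<open>\<gamma>\<close> and through the integration along it:
  \<open>has_int g v\<close> means that the integral of \<open>g\<close> along \<open>\<gamma>\<close> converges and has the value \<open>v\<close>.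
\<close>

definition typeI_augmented_eigenfunctions ::
  "real set \<Rightarrow> (real \<Rightarrow> complex) topology \<Rightarrow> (real \<Rightarrow> complex) set \<Rightarrow>
   ((real \<Rightarrow> complex) \<Rightarrow> (real \<Rightarrow> complex)) \<Rightarrow> nat \<Rightarrow>
   complex set \<Rightarrow> ((complex \<Rightarrow> complex) \<Rightarrow> complex \<Rightarrow> bool) \<Rightarrow>
   (complex \<Rightarrow> (real \<Rightarrow> complex) \<Rightarrow> complex) \<Rightarrow> bool" where
  "typeI_augmented_eigenfunctions I C \<Phi> L n \<gamma> has_int E \<longleftrightarrow>
     open I \<and> is_interval I \<and> I \<noteq> {} \<and>
     linear_topological_space_on (closure I) C \<and>
     \<Phi> \<subseteq> topspace C \<and> lin_subspace \<Phi> \<and>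
     linear_operator \<Phi> (topspace C) L \<and>
     (\<forall>z\<in>\<gamma>. E z \<in> topological_dual C) \<and>
     (\<exists>R. (\<forall>z\<in>\<gamma>. R z \<in> topological_dual (subtopology C \<Phi>)) \<and>
          (\<forall>\<phi>\<in>\<Phi>. \<forall>z\<in>\<gamma>. E z (L \<phi>) = z ^ n * E z \<phi> + R z \<phi>) \<and>
          (\<forall>\<phi>\<in>\<Phi>. \<forall>x\<in>I. has_int (\<lambda>z. exp (\<i> * z * of_real x) * R z \<phi>) 0))"

definition complete_family ::
  "(real \<Rightarrow> complex) set \<Rightarrow> complex set \<Rightarrow> (complex \<Rightarrow> (real \<Rightarrow> complex) \<Rightarrow> complex) \<Rightarrow> bool" where
  "complete_family \<Phi> \<gamma> E \<longleftrightarrow> (\<forall>\<phi>\<in>\<Phi>. (\<forall>z\<in>\<gamma>. E z \<phi> = 0) \<longrightarrow> \<phi> = (\<lambda>x. 0))"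

definition spectral_representation_typeI ::
  "real set \<Rightarrow> (real \<Rightarrow> complex) topology \<Rightarrow> (real \<Rightarrow> complex) set \<Rightarrow>
   ((real \<Rightarrow> complex) \<Rightarrow> (real \<Rightarrow> complex)) \<Rightarrow> nat \<Rightarrow>
   complex set \<Rightarrow> ((complex \<Rightarrow> complex) \<Rightarrow> complex \<Rightarrow> bool) \<Rightarrow>
   (complex \<Rightarrow> (real \<Rightarrow> complex) \<Rightarrow> complex) \<Rightarrow> bool" where
  "spectral_representation_typeI I C \<Phi> L n \<gamma> has_int E \<longleftrightarrow>
     typeI_augmented_eigenfunctions I C \<Phi> L n \<gamma> has_int E \<and>
     complete_family \<Phi> \<gamma> E \<and>
     (\<forall>\<phi>\<in>\<Phi>. \<forall>x\<in>I. \<exists>v.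
        has_int (\<lambda>z. exp (\<i> * z * of_real x) * E z (L \<phi>)) v \<and>
        has_int (\<lambda>z. exp (\<i> * z * of_real x) * (z ^ n * E z \<phi>)) v)"


text \<open>The space of smooth functions on \<open>[0,1]\<close> (one-sided derivatives at the end points).\<close>

definition deriv01 :: "(real \<Rightarrow> complex) \<Rightarrow> (real \<Rightarrow> complex)" where
  "deriv01 f = (\<lambda>x. if x \<in> {0..1} then vector_derivative f (at x within {0..1}) else 0)"

definition smooth01 :: "(real \<Rightarrow> complex) set" where
  "smooth01 = {f. (\<forall>x. x \<notin> {0..1} \<longrightarrow> f x = 0) \<and>
     (\<forall>k. \<forall>x\<in>{0..1}. ((deriv01 ^^ k) f) differentiable (at x within {0..1}))}"

definition seminorm01 :: "nat \<Rightarrow> (real \<Rightarrow> complex) \<Rightarrow> real" where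
  "seminorm01 k f = (SUP x\<in>{0..1}. cmod ((deriv01 ^^ k) f x))"

text \<open>The usual Frechet topology: uniform convergence of the derivatives of each order.\<close>

definition smooth01_topology :: "(real \<Rightarrow> complex) topology" where
  "smooth01_topology = topology_generated_by
     {{g \<in> smooth01. seminorm01 k (\<lambda>x. g x - f x) < \<epsilon>} | f k \<epsilon>. f \<in> smooth01 \<and> 0 < \<epsilon>}"

definition Phi_space :: "(real \<Rightarrow> complex) set" where
  "Phi_space = {f \<in> smooth01. f 0 = 0 \<and> f 1 = 0 \<and> deriv01 f 0 = 2 * deriv01 f 1}"

definition S_op :: "(real \<Rightarrow> complex) \<Rightarrow> (real \<Rightarrow> complex)" where
  "S_op f = (\<lambda>x. (- \<i>) ^ 3 * (deriv01 ^^ 3) f x)"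


definition \<alpha> :: complex where
  "\<alpha> = exp (2 * of_real pi * \<i> / 3)"

definition Delta :: "complex \<Rightarrow> complex" where
  "Delta z = exp (\<i> * z) + \<alpha> * exp (\<i> * \<alpha> * z) + \<alpha>\<^sup>2 * exp (\<i> * \<alpha>\<^sup>2 * z)
     + 2 * (exp (- \<i> * z) + \<alpha> * exp (- \<i> * \<alpha> * z) + \<alpha>\<^sup>2 * exp (- \<i> * \<alpha>\<^sup>2 * z))"

definition Delta_zeros :: "complex set" where
  "Delta_zeros = {\<sigma>. Delta \<sigma> = 0}"

definition Gam :: "complex \<Rightarrow> real \<Rightarrow> complex" where
  "Gam \<sigma> = circlepath \<sigma> (1/2)"

definition phi_plus :: "real \<Rightarrow> complex \<Rightarrow> complex" where
  "phi_plus x z = 1 / (2 * of_real pi * Delta z) *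
     (exp (- \<i> * z * of_real x) *
        (exp (\<i> * z) + 2 * \<alpha> * exp (- \<i> * \<alpha> * z) + 2 * \<alpha>\<^sup>2 * exp (- \<i> * \<alpha>\<^sup>2 * z))
      + exp (- \<i> * \<alpha> * z * of_real x) *
        (\<alpha> * exp (\<i> * \<alpha> * z) - 2 * \<alpha> * exp (- \<i> * z))
      + exp (- \<i> * \<alpha>\<^sup>2 * z * of_real x) *
        (\<alpha>\<^sup>2 * exp (\<i> * \<alpha>\<^sup>2 * z) - 2 * \<alpha>\<^sup>2 * exp (- \<i> * z)))"

definition phi_minus :: "real \<Rightarrow> complex \<Rightarrow> complex" where
  "phi_minus x z = - exp (- \<i> * z) / (2 * of_real pi * Delta z) *
     (exp (- \<i> * z * of_real x) *
        (2 + \<alpha>\<^sup>2 * exp (- \<i> * \<alpha> * z) + \<alpha> * exp (- \<i> * \<alpha>\<^sup>2 * z))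
      + \<alpha> * exp (- \<i> * \<alpha> * z * of_real x) * (2 - exp (- \<i> * \<alpha>\<^sup>2 * z))
      + \<alpha>\<^sup>2 * exp (- \<i> * \<alpha>\<^sup>2 * z * of_real x) * (2 - exp (- \<i> * \<alpha> * z)))"

definition gamma_contour :: "complex set" where
  "gamma_contour = (\<Union>\<sigma>\<in>Delta_zeros. path_image (Gam \<sigma>))"

text \<open>
  The circles \<open>Gam \<sigma>\<close> are pairwise disjoint, and no zero of \<open>Delta\<close> lies on any of them; hence on
  \<open>gamma_contour\<close> the second branch is taken exactly on the circles whose centre is in the open
  lower half-plane. Off \<open>gamma_contour\<close> the value is irrelevant.
\<close>

definition F :: "complex \<Rightarrow> (real \<Rightarrow> complex) \<Rightarrow> complex" where
  "F z f =
     (if \<exists>\<sigma>\<in>Delta_zeros. 0 \<le> Im \<sigma> \<and> z \<in> path_image (Gam \<sigma>)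
      then integral {0..1} (\<lambda>x. phi_plus x z * f x)
      else integral {0..1} (\<lambda>x. phi_minus x z * f x))"

text \<open>
  The zeros of \<open>Delta\<close> are invariant under multiplication by \<open>\<alpha>\<close>, so moduli coincide. The order of
  increasing modulus is therefore an enumeration with nondecreasing moduli, and the value of the
  series must not depend on the order chosen among zeros of equal modulus. A multiple zero is
  enumerated once.
\<close>

definition modulus_enumeration :: "(nat \<Rightarrow> complex) \<Rightarrow> bool" where
  "modulus_enumeration s \<longleftrightarrow> bij_betw s UNIV Delta_zeros \<and> mono (\<lambda>k. cmod (s k))"

definition has_integral_gamma :: "(complex \<Rightarrow> complex) \<Rightarrow> complex \<Rightarrow> bool" where
  "has_integral_gamma g v \<longleftrightarrow>
     (\<forall>\<sigma>\<in>Delta_zeros. g contour_integrable_on Gam \<sigma>) \<and>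
     (\<exists>s. modulus_enumeration s) \<and>
     (\<forall>s. modulus_enumeration s \<longrightarrow> (\<lambda>k. contour_integral (Gam (s k)) g) sums v)"

end

(*
  Multiplying the kernels of F by Delta, integration by parts shows that the remainder
  F_z (S f) - z^3 F_z f extends from each circle to an entire function of z, so all its
  contour integrals vanish.

  For completeness, 0 is a zero of Delta and F_z f = 0 on the circle around it, so the entire
  numerator of F vanishes identically.  Elimination then shows that H(z) = e^(iz) int_0^1
  e^(-izx) f(x) dx is invariant under z -> alpha z.  As H is bounded on the upper half-plane, it
  is bounded, hence constant, and f = 0 by the Weierstrass theorem applied to its moments.

  For convergence, outside 0 the zeros of Delta are the images, under the symmetries z -> alpha z
  and z -> - conj z, of simple zeros s_k exponentially close to 5 pi / 3 + 2 pi k + i ln 2, k >= 0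
  (Banach's fixed point theorem; the power series of Delta excludes the disc of radius 4).
  The residues at the four families away from the real axis decay exponentially for 0 < x < 1.
  Those at s_k and - conj s_k are c e^(2 pi i k x) / (k + 1) + O(1 / k^2), a conditionally
  convergent series.  As the six families have equal moduli, every enumeration by increasing
  modulus runs through the zeros in blocks of six.
*)

theory Submission imports Defs
begin

section \<open>The space of smooth functions\<close>

text \<open>Absolute convergence cannot be expected: S f need not satisfy the boundary conditions,
  so its transform decays only like 1/z along the zeros near the real axis. What helps there is the
  oscillation e^(2 pi i k x), whose base differs from 1 because 0 < x < 1; each factor of a residue
  is therefore tracked up to an error O(1/k). The two kernels differ by e^(-izx) / (2 pi), so they
  have the same residues. In the lower half-plane, however, only \<open>phi_minus\<close> survives
  an estimate term by term: its prefactor e^(-iz) cancels a dominant exponential. The radius 4 comes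
  from the sector argument. Among z, \<alpha> z and \<alpha>^2 z the one with least |Im| satisfies
  sqrt 3 |Im| <= |Re|; there a modulus above 4 forces |Re| > 2 sqrt 3, where the neglected
  exponentials are small enough for taking logarithms. The zero 0 is double. It contributes one term
  to the series, which is never evaluated.\<close>

lemma deriv01_eqI:
  assumes "x \<in> {0..1}" "(f has_vector_derivative d) (at x within {0..1})"
  shows "deriv01 f x = d"
  using assms vector_derivative_within_closed_interval[of 0 1 x f d] by (simp add: deriv01_def)

lemma smooth01_has_deriv:
  assumes "f \<in> smooth01" "x \<in> {0..1}"
  shows "((deriv01 ^^ k) f has_vector_derivative (deriv01 ^^ Suc k) f x) (at x within {0..1})"
proof -
  have "(deriv01 ^^ k) f differentiable (at x within {0..1})"
    using assms by (auto simp: smooth01_def)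
  then show ?thesis using assms(2) by (simp add: vector_derivative_works deriv01_def)
qed

lemma smooth01_cont:
  assumes "f \<in> smooth01"
  shows "continuous_on {0..1} ((deriv01 ^^ k) f)"
  using smooth01_has_deriv[OF assms] has_vector_derivative_continuous
  by (meson continuous_on_eq_continuous_within)

lemma deriv01_funpow_outside:
  assumes "f \<in> smooth01" "x \<notin> {0..1}"
  shows "(deriv01 ^^ k) f x = 0"
  using assms by (cases k) (auto simp: smooth01_def deriv01_def)

text \<open>One induction for general combinations; sums, differences and multiples are instances.
  Outside [0,1] both sides vanish because \<open>deriv01\<close> is 0 there.\<close>

lemma smooth01_lincomb:
  assumes f: "f \<in> smooth01" and g: "g \<in> smooth01"
  shows "(deriv01 ^^ k) (\<lambda>x. a * f x + b * g x) = (\<lambda>x. a * (deriv01 ^^ k) f x + b * (deriv01 ^^ k) g x)"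
    and "(\<lambda>x. a * f x + b * g x) \<in> smooth01"
proof -
  have *: "((\<lambda>x. a * (deriv01 ^^ k) f x + b * (deriv01 ^^ k) g x) has_vector_derivative
      a * (deriv01 ^^ Suc k) f x + b * (deriv01 ^^ Suc k) g x) (at x within {0..1})"
    if "x \<in> {0..1}" for x k
    by (intro has_vector_derivative_add has_vector_derivative_mult_right smooth01_has_deriv f g that)
  show eq: "(deriv01 ^^ k) (\<lambda>x. a * f x + b * g x) = (\<lambda>x. a * (deriv01 ^^ k) f x + b * (deriv01 ^^ k) g x)" for k
  proof (induction k)
    case (Suc k)
    have "deriv01 (\<lambda>x. a * (deriv01 ^^ k) f x + b * (deriv01 ^^ k) g x) x =
       a * (deriv01 ^^ Suc k) f x + b * (deriv01 ^^ Suc k) g x" for x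
      using deriv01_eqI[OF _ *] by (cases "x \<in> {0..1}") (auto simp: deriv01_def)
    then show ?case by (simp only: funpow.simps o_def Suc.IH)
  qed simp
  show "(\<lambda>x. a * f x + b * g x) \<in> smooth01"
  proof -
    have "(deriv01 ^^ k) (\<lambda>x. a * f x + b * g x) differentiable (at x within {0..1})" if "x \<in> {0..1}" for k x
      unfolding eq by (rule differentiableI_vector[OF *[OF that]])
    then show ?thesis using f g by (auto simp: smooth01_def)
  qed
qed

lemmas smooth01_add = smooth01_lincomb[where a=1 and b=1, simplified]
lemmas smooth01_diff = smooth01_lincomb[where a=1 and b="-1", simplified]
lemmas smooth01_cmult = smooth01_lincomb[where b=0, simplified]

lemma deriv01_funpow_zero [simp]: "(deriv01 ^^ k) (\<lambda>x. 0) = (\<lambda>x. 0)"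
proof (induction k)
  case (Suc k)
  have "deriv01 (\<lambda>x. 0) x = 0" for x
    using deriv01_eqI[of x "\<lambda>x. 0" 0] by (cases "x \<in> {0..1}") (auto simp: deriv01_def)
  then have "deriv01 (\<lambda>x. 0) = (\<lambda>x. 0)" by blast
  with Suc show ?case by simp
qed simp

lemma smooth01_zero: "(\<lambda>x. 0) \<in> smooth01"
  by (auto simp: smooth01_def)

lemma smooth01_deriv: 
  assumes "f \<in> smooth01" shows "(deriv01 ^^ j) f \<in> smooth01"
proof -
  have "(deriv01 ^^ k) ((deriv01 ^^ j) f) = (deriv01 ^^ (k + j)) f" for k
    by (simp add: funpow_add)
  then show ?thesis
    using assms deriv01_funpow_outside[OF assms, of _ j] unfolding smooth01_def by simp
qed

lemma bdd_above_seminorm01: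
  assumes "f \<in> smooth01"
  shows "bdd_above ((\<lambda>x. cmod ((deriv01 ^^ k) f x)) ` {0..1})"
  by (intro bounded_imp_bdd_above compact_imp_bounded compact_continuous_image
      continuous_on_norm smooth01_cont assms compact_Icc)

lemma seminorm01_upper:
  assumes "f \<in> smooth01" "x \<in> {0..1}"
  shows "cmod ((deriv01 ^^ k) f x) \<le> seminorm01 k f"
  unfolding seminorm01_def by (rule cSUP_upper[OF assms(2) bdd_above_seminorm01[OF assms(1)]])

lemma seminorm01_le:
  assumes "\<And>x. x \<in> {0..1} \<Longrightarrow> cmod ((deriv01 ^^ k) f x) \<le> c"
  shows "seminorm01 k f \<le> c"
  unfolding seminorm01_def by (rule cSUP_least) (use assms in auto)

lemma seminorm01_nonneg: "f \<in> smooth01 \<Longrightarrow> 0 \<le> seminorm01 k f"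
  using seminorm01_upper[of f 0 k] by (meson atLeastAtMost_iff norm_ge_zero order_refl order_trans zero_le_one)

lemma seminorm01_add:
  assumes "f \<in> smooth01" "g \<in> smooth01"
  shows "seminorm01 k (\<lambda>x. f x + g x) \<le> seminorm01 k f + seminorm01 k g"
  by (rule seminorm01_le)
    (auto simp: smooth01_add[OF assms] intro!: norm_triangle_mono seminorm01_upper assms)

lemma seminorm01_cmult:
  assumes "f \<in> smooth01"
  shows "seminorm01 k (\<lambda>x. c * f x) \<le> cmod c * seminorm01 k f"
  by (rule seminorm01_le)
    (auto simp: smooth01_cmult[OF assms assms] norm_mult intro!: mult_left_mono seminorm01_upper assms)

lemma topspace_smooth01 [simp]: "topspace smooth01_topology = smooth01"
proof -
  have "f \<in> \<Union>{{g \<in> smooth01. seminorm01 k (\<lambda>x. g x - f x) < \<epsilon>} | f k \<epsilon>. f \<in> smooth01 \<and> 0 < \<epsilon>}"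
    if "f \<in> smooth01" for f
  proof -
    have "seminorm01 0 (\<lambda>x. f x - f x) < 1"
      by (rule le_less_trans[OF seminorm01_le[of _ _ 0]]) simp_all
    then have "f \<in> {g \<in> smooth01. seminorm01 0 (\<lambda>x. g x - f x) < 1}" using that by simp
    then show ?thesis
      by (rule UnionI[rotated]) (use that in \<open>intro CollectI exI conjI refl, auto\<close>)
  qed
  then show ?thesis unfolding smooth01_topology_def topology_generated_by_topspace by auto
qed

lemma openin_smooth01_ball:
  "f \<in> smooth01 \<Longrightarrow> 0 < e \<Longrightarrow> openin smooth01_topology {g \<in> smooth01. seminorm01 k (\<lambda>x. g x - f x) < e}"
  unfolding smooth01_topology_def by (rule topology_generated_by_Basis) blast

lemma smooth01_self_ball: "f \<in> smooth01 \<Longrightarrow> 0 < e \<Longrightarrow> f \<in> {g \<in> smooth01. seminorm01 k (\<lambda>x. g x - f x) < e}"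
  using seminorm01_le[of k "\<lambda>x. 0" 0] by auto

text \<open>A generating ball that contains \<open>h x\<close> need not be centred there; the
  triangle inequality supplies a smaller ball around \<open>h x\<close>. So it is enough to test
  balls centred at \<open>h x\<close>, one order k at a time.\<close>

lemma continuous_map_into_smooth01:
  assumes "\<And>x. x \<in> topspace T \<Longrightarrow> h x \<in> smooth01"
    and "\<And>x k e. x \<in> topspace T \<Longrightarrow> 0 < e \<Longrightarrow>
      \<exists>U. openin T U \<and> x \<in> U \<and> (\<forall>y\<in>U. seminorm01 k (\<lambda>t. h y t - h x t) < e)"
  shows "continuous_map T smooth01_topology h"
  unfolding smooth01_topology_def
proof (rule continuous_on_generated_topo)
  fix U assume "U \<in> {{g \<in> smooth01. seminorm01 k (\<lambda>x. g x - f x) < \<epsilon>} | f k \<epsilon>. f \<in> smooth01 \<and> 0 < \<epsilon>}"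
  then obtain f k e where U: "U = {g \<in> smooth01. seminorm01 k (\<lambda>x. g x - f x) < e}" "f \<in> smooth01" "0 < e"
    by blast
  show "openin T (h -` U \<inter> topspace T)"
  proof (subst openin_subopen, safe)
    fix x assume x: "h x \<in> U" "x \<in> topspace T"
    define d where "d = e - seminorm01 k (\<lambda>t. h x t - f t)"
    have d: "0 < d" using x U by (simp add: d_def)
    obtain V where V: "openin T V" "x \<in> V" "\<And>y. y \<in> V \<Longrightarrow> seminorm01 k (\<lambda>t. h y t - h x t) < d"
      using assms(2)[OF x(2) d, of k] by metis
    have "V \<subseteq> h -` U \<inter> topspace T"
    proof
      fix y assume y: "y \<in> V"
      then have yT: "y \<in> topspace T" using V(1) openin_subset by blast
      have hs: "h y \<in> smooth01" "h x \<in> smooth01" using assms(1) yT x by auto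
      have "seminorm01 k (\<lambda>t. h y t - f t) = seminorm01 k (\<lambda>t. (h y t - h x t) + (h x t - f t))"
        by simp
      also have "\<dots> \<le> seminorm01 k (\<lambda>t. h y t - h x t) + seminorm01 k (\<lambda>t. h x t - f t)"
        by (intro seminorm01_add smooth01_diff hs U(2))
      also have "\<dots> < e" using V(3)[OF y] by (simp add: d_def)
      finally show "y \<in> h -` U \<inter> topspace T" using yT hs U by auto
    qed
    then show "\<exists>V. openin T V \<and> x \<in> V \<and> V \<subseteq> h -` U \<inter> topspace T"
      using V(1,2) by blast
  qed
next
  show "h ` topspace T \<subseteq> \<Union> {{g \<in> smooth01. seminorm01 k (\<lambda>x. g x - f x) < \<epsilon>} | f k \<epsilon>. f \<in> smooth01 \<and> 0 < \<epsilon>}"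
  proof (rule image_subsetI)
    fix x assume "x \<in> topspace T"
    then have "h x \<in> topspace smooth01_topology" using assms(1) by simp
    then show "h x \<in> \<Union> {{g \<in> smooth01. seminorm01 k (\<lambda>x. g x - f x) < \<epsilon>} | f k \<epsilon>. f \<in> smooth01 \<and> 0 < \<epsilon>}"
      unfolding smooth01_topology_def topology_generated_by_topspace .
  qed
qed

lemma linear_topological_space_smooth01:
  "linear_topological_space_on {0..1} smooth01_topology"
  unfolding linear_topological_space_on_def topspace_smooth01
proof (intro conjI)
  show "\<forall>f\<in>smooth01. \<forall>x. x \<notin> {0..1} \<longrightarrow> f x = 0" by (auto simp: smooth01_def)
  show "lin_subspace smooth01"
    by (auto simp: lin_subspace_def smooth01_zero smooth01_add smooth01_cmult)
  show "continuous_map (prod_topology smooth01_topology smooth01_topology) smooth01_topology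
     (\<lambda>(f, g). \<lambda>x. f x + g x)"
  proof (rule continuous_map_into_smooth01, goal_cases)
    case (1 x) then show ?case by (auto simp: smooth01_add)
  next
    case (2 x k e)
    obtain f g where x: "x = (f, g)" "f \<in> smooth01" "g \<in> smooth01" using 2(1) by auto
    let ?B = "\<lambda>f. {g \<in> smooth01. seminorm01 k (\<lambda>x. g x - f x) < e/2}"
    have "seminorm01 k (\<lambda>t. (f' t + g' t) - (f t + g t)) < e" if "f' \<in> ?B f" "g' \<in> ?B g" for f' g'
    proof -
      have "seminorm01 k (\<lambda>t. (f' t + g' t) - (f t + g t)) = seminorm01 k (\<lambda>t. (f' t - f t) + (g' t - g t))"
        by (simp add: algebra_simps)
      also have "\<dots> \<le> seminorm01 k (\<lambda>t. f' t - f t) + seminorm01 k (\<lambda>t. g' t - g t)"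
        using that x by (intro seminorm01_add smooth01_diff) auto
      also have "\<dots> < e" using that by simp
      finally show ?thesis .
    qed
    moreover have "openin (prod_topology smooth01_topology smooth01_topology) (?B f \<times> ?B g)"
      unfolding openin_prod_Times_iff using x 2 by (intro disjI2 conjI openin_smooth01_ball) auto
    moreover have "x \<in> ?B f \<times> ?B g"
      using smooth01_self_ball[of _ "e/2" k] x 2 by auto
    ultimately show ?case unfolding x by (intro exI[of _ "?B f \<times> ?B g"]) auto
  qed
  show "continuous_map (prod_topology euclidean smooth01_topology) smooth01_topology
     (\<lambda>(c, f). \<lambda>x. c * f x)"
  proof (rule continuous_map_into_smooth01, goal_cases)
    case (1 x) then show ?case by (auto simp: smooth01_cmult)
  next
    case (2 x k e)
    obtain c f where x: "x = (c, f)" "f \<in> smooth01" using 2(1) by auto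
    let ?p = "seminorm01 k f"
    have p: "?p \<ge> 0" by (simp add: seminorm01_nonneg x)
    \<comment> \<open>From c' f' - c f = c' (f' - f) + (c' - c) f: as |c'| <= |c| + 1, the first
      part is at most (|c| + 1) r = e/2, and d keeps the second below e/2. The added 1 in both
      denominators avoids division by zero.\<close>
    define d where "d = min 1 (e / (2 * (?p + 1)))"
    define r where "r = e / (2 * (cmod c + 1))"
    have d: "0 < d" "d \<le> 1" "d * ?p < e / 2"
    proof -
      show "0 < d" "d \<le> 1" using 2 p by (auto simp: d_def)
      have "d * ?p \<le> e / (2 * (?p + 1)) * ?p" by (intro mult_right_mono p) (simp add: d_def)
      also have "\<dots> < e / 2" using 2 p by (auto simp: field_simps)
      finally show "d * ?p < e / 2" .
    qed
    have r: "0 < r" "(cmod c + 1) * r = e / 2" 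
    proof -
      have "0 < cmod c + 1" by (rule add_nonneg_pos) auto
      then show "0 < r" "(cmod c + 1) * r = e / 2" using 2 by (auto simp: r_def field_simps)
    qed
    let ?B = "{g \<in> smooth01. seminorm01 k (\<lambda>x. g x - f x) < r}"
    have "seminorm01 k (\<lambda>t. c' * f' t - c * f t) < e" if "c' \<in> ball c d" "f' \<in> ?B" for c' f'
    proof -
      have f': "f' \<in> smooth01" using that by auto
      have c': "cmod (c' - c) \<le> d" "cmod c' \<le> cmod c + 1"
        using that d norm_triangle_ineq2[of c' c] by (auto simp: dist_norm norm_minus_commute)
      have "seminorm01 k (\<lambda>t. c' * f' t - c * f t) = seminorm01 k (\<lambda>t. c' * (f' t - f t) + (c' - c) * f t)"
        by (simp add: algebra_simps)
      also have "\<dots> \<le> seminorm01 k (\<lambda>t. c' * (f' t - f t)) + seminorm01 k (\<lambda>t. (c' - c) * f t)"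
        using f' x by (intro seminorm01_add smooth01_cmult smooth01_diff) auto
      also have "\<dots> \<le> cmod c' * seminorm01 k (\<lambda>t. f' t - f t) + cmod (c' - c) * ?p"
        using f' x by (intro add_mono seminorm01_cmult smooth01_diff) auto
      also have "\<dots> \<le> (cmod c + 1) * r + d * ?p"
        using c' that(2) d p x f' by (intro add_mono mult_mono) (auto intro!: seminorm01_nonneg smooth01_diff)
      also have "\<dots> < e" using d r by simp
      finally show ?thesis .
    qed
    moreover have "openin (prod_topology euclidean smooth01_topology) (ball c d \<times> ?B)"
      using x r by (auto simp: openin_prod_Times_iff intro!: openin_smooth01_ball)
    moreover have "x \<in> ball c d \<times> ?B"
      using smooth01_self_ball[of _ r k] x r d by auto
    ultimately show ?case unfolding x by (intro exI[of _ "ball c d \<times> ?B"]) auto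
  qed
qed

text \<open>For a linear functional, domination by a single seminorm of the family gives continuity.
  In the proof |B| + 1 replaces B, so that the radius is positive whatever B is.\<close>

lemma topological_dual_smooth01I:
  assumes add: "\<And>f g. f \<in> smooth01 \<Longrightarrow> g \<in> smooth01 \<Longrightarrow> l (\<lambda>x. f x + g x) = l f + l g"
    and cmult: "\<And>c f. f \<in> smooth01 \<Longrightarrow> l (\<lambda>x. c * f x) = c * l f"
    and bound: "\<And>f. f \<in> smooth01 \<Longrightarrow> cmod (l f) \<le> B * seminorm01 k f"
  shows "l \<in> topological_dual smooth01_topology"
proof -
  have diff: "l (\<lambda>x. g x - f x) = l g - l f" if "f \<in> smooth01" "g \<in> smooth01" for f g
    using add[OF that(2) smooth01_cmult(2)[OF that(1) that(1), of "-1"]] cmult[OF that(1), of "-1"] by simp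
  have "continuous_map smooth01_topology euclidean l"
    unfolding continuous_map_alt
  proof safe
    fix U :: "complex set" assume "openin euclidean U"
    then have U: "open U" by simp
    show "openin smooth01_topology (l -` U \<inter> topspace smooth01_topology)"
    proof (subst openin_subopen, safe)
      fix f assume f: "l f \<in> U" "f \<in> topspace smooth01_topology"
      obtain e where e: "e > 0" "ball (l f) e \<subseteq> U" using U f open_contains_ball by blast
      define r where "r = e / (\<bar>B\<bar> + 1)"
      have r: "r > 0" using e by (simp add: r_def add_nonneg_pos)
      let ?V = "{g \<in> smooth01. seminorm01 k (\<lambda>x. g x - f x) < r}"
      have "g \<in> l -` U \<inter> topspace smooth01_topology" if g: "g \<in> ?V" for g
      proof -
        have fg: "f \<in> smooth01" "g \<in> smooth01" using f g by auto
        have s0: "0 \<le> seminorm01 k (\<lambda>x. g x - f x)" by (intro seminorm01_nonneg smooth01_diff fg)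
        have "cmod (l g - l f) \<le> B * seminorm01 k (\<lambda>x. g x - f x)"
          using bound[OF smooth01_diff(2)[OF fg(2,1)]] diff[OF fg] by simp
        also have "\<dots> \<le> (\<bar>B\<bar> + 1) * seminorm01 k (\<lambda>x. g x - f x)" using s0 by (intro mult_right_mono) auto
        also have "\<dots> < (\<bar>B\<bar> + 1) * r" using g by (intro mult_strict_left_mono) auto
        also have "\<dots> = e" by (simp add: r_def add_nonneg_eq_0_iff)
        finally have "l g \<in> ball (l f) e" by (simp add: dist_norm norm_minus_commute)
        then show ?thesis using e fg by auto
      qed
      then show "\<exists>V. openin smooth01_topology V \<and> f \<in> V \<and> V \<subseteq> l -` U \<inter> topspace smooth01_topology"
        using openin_smooth01_ball[of f r k] smooth01_self_ball[of f r k] r f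
        by (intro exI[of _ ?V]) auto
    qed
  qed auto
  then show ?thesis
    unfolding topological_dual_def mem_Collect_eq topspace_smooth01
    by (intro conjI ballI allI add cmult)
qed

lemma topological_dual_lincomb:
  assumes "l \<in> topological_dual T" "m \<in> topological_dual T"
  shows "(\<lambda>f. l f + c * m f) \<in> topological_dual T"
proof -
  have "continuous_map T euclidean (\<lambda>f. c * m f)"
    using assms(2) unfolding topological_dual_def
    by (simp add: continuous_map_atin tendsto_mult)
  then have "continuous_map T euclidean (\<lambda>f. l f + c * m f)"
    using assms(1) by (intro continuous_map_add) (auto simp: topological_dual_def)
  moreover have "l (\<lambda>x. f x + g x) + c * m (\<lambda>x. f x + g x) = l f + c * m f + (l g + c * m g)"
    if "f \<in> topspace T" "g \<in> topspace T" for f g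
  proof -
    have "l (\<lambda>x. f x + g x) = l f + l g" "m (\<lambda>x. f x + g x) = m f + m g"
      using assms that unfolding topological_dual_def by blast+
    then show ?thesis by (simp add: algebra_simps)
  qed
  moreover have "l (\<lambda>x. a * f x) + c * m (\<lambda>x. a * f x) = a * (l f + c * m f)"
    if "f \<in> topspace T" for f a
  proof -
    have "l (\<lambda>x. a * f x) = a * l f" "m (\<lambda>x. a * f x) = a * m f"
      using assms that unfolding topological_dual_def by blast+
    then show ?thesis by (simp add: algebra_simps)
  qed
  ultimately show ?thesis unfolding topological_dual_def by blast
qed

lemma topological_dual_subtopology:
  assumes "l \<in> topological_dual T"
  shows "l \<in> topological_dual (subtopology T S)"
  using assms unfolding topological_dual_def
  by (simp add: continuous_map_from_subtopology)

section \<open>The characteristic function\<close>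

lemma alpha_eq: "\<alpha> = Complex (-1/2) (sqrt 3 / 2)"
proof -
  have "\<alpha> = cis (2 * pi / 3)" by (simp add: \<alpha>_def cis_conv_exp mult_ac)
  then show ?thesis by (simp add: complex_eq_iff cos_120 sin_120)
qed

lemma alpha_sq_eq: "\<alpha>\<^sup>2 = Complex (-1/2) (- sqrt 3 / 2)"
  by (simp add: alpha_eq complex_eq_iff power2_eq_square)

lemma Re_alpha [simp]: "Re \<alpha> = -1/2" and Im_alpha [simp]: "Im \<alpha> = sqrt 3 / 2"
  and Re_alpha_sq: "Re (\<alpha>\<^sup>2) = -1/2" and Im_alpha_sq: "Im (\<alpha>\<^sup>2) = - sqrt 3 / 2"
  unfolding alpha_sq_eq by (simp_all add: alpha_eq)

lemma alpha_cube: "\<alpha> ^ 3 = 1"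
  by (simp add: power3_eq_cube complex_eq_iff alpha_eq algebra_simps)

lemma alpha_sq_sum: "\<alpha>\<^sup>2 = - 1 - \<alpha>"
  by (simp add: complex_eq_iff Re_alpha_sq Im_alpha_sq)

lemma norm_alpha [simp]: "cmod \<alpha> = 1"
  by (simp add: \<alpha>_def)

lemma alpha_neq_0 [simp]: "\<alpha> \<noteq> 0"
  using norm_alpha by fastforce

lemma cnj_alpha: "cnj \<alpha> = \<alpha>\<^sup>2"
  by (simp add: complex_eq_iff Re_alpha_sq Im_alpha_sq)

definition eP :: "complex \<Rightarrow> complex" where "eP z = exp (\<i> * z)"

lemma eP_neq_0 [simp]: "eP z \<noteq> 0" by (simp add: eP_def)
lemma eP_minus: "exp (- \<i> * z) = inverse (eP z)" by (simp add: eP_def exp_minus)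
lemma norm_eP: "cmod (eP z) = exp (- Im z)" by (simp add: eP_def)

lemma eP_prod: "eP z * eP (\<alpha> * z) * eP (\<alpha>\<^sup>2 * z) = 1"
proof -
  have "\<i> * z + \<i> * (\<alpha> * z) + \<i> * (\<alpha>\<^sup>2 * z) = 0"
    by (simp add: alpha_sq_sum algebra_simps)
  then show ?thesis by (simp add: eP_def flip: exp_add)
qed

lemma Delta_eP: "Delta z = eP z + \<alpha> * eP (\<alpha> * z) + \<alpha>\<^sup>2 * eP (\<alpha>\<^sup>2 * z)
   + 2 * (inverse (eP z) + \<alpha> * inverse (eP (\<alpha> * z)) + \<alpha>\<^sup>2 * inverse (eP (\<alpha>\<^sup>2 * z)))"
  by (simp add: Delta_def eP_def exp_minus mult.assoc)

lemma alpha_mult: "\<alpha> * (\<alpha> * z) = \<alpha>\<^sup>2 * z" "\<alpha> * (\<alpha>\<^sup>2 * z) = z"  "\<alpha>\<^sup>2 * (\<alpha> * z) = z" "\<alpha>\<^sup>2 * (\<alpha>\<^sup>2 * z) = \<alpha> * z"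
  using alpha_cube by (simp_all add: power2_eq_square power3_eq_cube flip: mult.assoc)

lemma Delta_alpha: "Delta (\<alpha> * z) = \<alpha>\<^sup>2 * Delta z"
proof -
  have *: "\<alpha>\<^sup>2 * \<alpha> = 1" "\<alpha>\<^sup>2 * \<alpha>\<^sup>2 = \<alpha>"
    using alpha_cube by (simp_all add: power2_eq_square power3_eq_cube flip: mult.assoc)
  show ?thesis
    unfolding Delta_eP alpha_mult distrib_left mult.left_commute[of "\<alpha>\<^sup>2" 2]
    by (simp add: * flip: mult.assoc)
qed

lemma cnj_alpha_mult: "cnj (\<alpha> * z) = \<alpha>\<^sup>2 * cnj z" "cnj (\<alpha>\<^sup>2 * z) = \<alpha> * cnj z"
proof -
  have "cnj (\<alpha>\<^sup>2) = \<alpha>" by (simp only: complex_eq_iff cnj.sel Re_alpha_sq Im_alpha_sq) simp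
  then show "cnj (\<alpha> * z) = \<alpha>\<^sup>2 * cnj z" "cnj (\<alpha>\<^sup>2 * z) = \<alpha> * cnj z"
    by (simp_all only: complex_cnj_mult cnj_alpha)
qed

lemma eP_mcnj: "eP (- cnj z) = cnj (eP z)"
  by (simp add: eP_def exp_cnj)

lemma eP_alpha_mcnj:
  "eP (\<alpha> * - cnj z) = cnj (eP (\<alpha>\<^sup>2 * z))" "eP (\<alpha>\<^sup>2 * - cnj z) = cnj (eP (\<alpha> * z))"
  unfolding eP_mcnj[symmetric] cnj_alpha_mult by simp_all

lemma Delta_mcnj: "Delta (- cnj z) = cnj (Delta z)"
  unfolding Delta_eP eP_mcnj eP_alpha_mcnj complex_cnj_add cnj_alpha_mult complex_cnj_mult[of 2] complex_cnj_inverse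
  by simp

lemma Delta_0: "Delta 0 = 0"
  by (simp add: Delta_def alpha_sq_sum)

section \<open>The punctured disc of radius 4 contains no zero\<close>

lemma exp_taylor8:
  fixes z :: complex
  assumes "cmod z \<le> 4"
  shows "cmod (exp z - (\<Sum>k<8. z ^ k / fact k)) \<le> cmod z ^ 8 / 40320 * (9/5)"
proof -
  have s: "(\<lambda>k. z ^ k / fact k) sums exp z"
    using exp_converges[of z] by (simp add: scaleR_conv_of_real field_simps)
  have "(\<lambda>k. z ^ (k + 8) / fact (k + 8)) sums (exp z - (\<Sum>k<8. z ^ k / fact k))"
    by (rule sums_split_initial_segment[OF s])
  \<comment> \<open>40320 = 8!, and consecutive terms have ratio |z| / (k + 9) <= 4/9, whence the
    geometric sum 9/5.\<close>
  moreover have "(\<lambda>k. cmod z ^ 8 / 40320 * (4/9) ^ k) sums (cmod z ^ 8 / 40320 * (9/5))"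
    using sums_mult[OF geometric_sums[of "4/9::real"], of "cmod z ^ 8 / 40320"] by simp
  moreover have "cmod (z ^ (k + 8) / fact (k + 8)) \<le> cmod z ^ 8 / 40320 * (4/9) ^ k" for k
  proof (induction k)
    case 0 then show ?case by (simp add: norm_divide norm_power fact_numeral)
  next
    case (Suc k)
    have norm: "cmod (z ^ n / fact n) = cmod z ^ n / fact n" for n
      by (simp add: norm_divide norm_power)
    have "cmod (z ^ Suc n / fact (Suc n)) = cmod (z ^ n / fact n) * (cmod z / Suc n)" for n
      unfolding norm by (simp add: mult_ac)
    from this[of "k + 8"] have "cmod (z ^ (Suc k + 8) / fact (Suc k + 8)) = cmod (z ^ (k + 8) / fact (k + 8)) * (cmod z / (k + 9))"
      by (simp only: add_Suc) (simp add: algebra_simps)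
    also have "\<dots> \<le> (cmod z ^ 8 / 40320 * (4/9) ^ k) * (4 / 9)"
      by (intro mult_mono Suc frac_le assms) auto
    finally show ?case by (simp only: power_Suc mult_ac)
  qed
  ultimately show ?thesis by (rule norm_sums_le)
qed

text \<open>Only the powers \<open>z ^ n\<close> with \<open>n mod 3 = 2\<close> survive in the Taylor series of \<^const>\<open>Delta\<close>.\<close>

lemma Delta_zero_small:
  assumes "Delta z = 0" "cmod z \<le> 4"
  shows "z = 0"
proof (rule ccontr)
  assume "z \<noteq> 0"
  let ?T = "\<lambda>w::complex. \<Sum>k<8. w ^ k / fact k"
  define r where "r w = exp w - ?T w" for w :: complex
  have e: "exp w = r w + ?T w" for w by (simp add: r_def)
  have r: "cmod (r w) \<le> cmod z ^ 8 / 40320 * (9/5)" if "cmod w = cmod z" for w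
    using exp_taylor8[of w] that assms by (simp add: r_def)
  define c where "c k = (\<i> ^ k + 2 * (- \<i>) ^ k) * (1 + \<alpha> ^ (k + 1) + \<alpha> ^ (2 * k + 2))" for k
  have "?T (\<i> * z) + \<alpha> * ?T (\<i> * \<alpha> * z) + \<alpha>\<^sup>2 * ?T (\<i> * \<alpha>\<^sup>2 * z)
     + 2 * (?T (- \<i> * z) + \<alpha> * ?T (- \<i> * \<alpha> * z) + \<alpha>\<^sup>2 * ?T (- \<i> * \<alpha>\<^sup>2 * z))
     = (\<Sum>k<8. c k * z ^ k / fact k)"
    unfolding sum_distrib_left sum.distrib[symmetric]
  proof (rule sum.cong[OF refl], goal_cases)
    case (1 k)
    have p: "(\<alpha>\<^sup>2) ^ k = \<alpha> ^ (2 * k)" by (simp add: power_mult)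
    show ?case
      unfolding c_def power_mult_distrib p power_add power_one_right
      by (simp add: field_simps)
  qed
  also have "\<dots> = - z\<^sup>2 * (9/2 + \<i> * z ^ 3 / 40)"
  proof -
    have a3: "\<alpha> * (\<alpha> * (\<alpha> * w)) = w" "\<alpha> * (\<alpha> * \<alpha>) = 1" for w
      using alpha_cube by (simp_all add: power3_eq_cube flip: mult.assoc)
    have a2: "\<alpha> * \<alpha> = - 1 - \<alpha>" using alpha_sq_sum by (simp add: power2_eq_square)
    have a4: "\<alpha> * (- 1 - \<alpha>) = 1" by (simp add: right_diff_distrib a2)
    have "c 0 = 0" "c 1 = 0" "c 2 = -9" "c 3 = 0" "c 4 = 0" "c 5 = - 3 * \<i>" "c 6 = 0" "c 7 = 0"
      by (simp_all add: c_def eval_nat_numeral a3 a2 a4)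
    then show ?thesis
      by (simp add: lessThan_nat_numeral fact_numeral field_simps eval_nat_numeral)
  qed
  finally have T: "?T (\<i> * z) + \<alpha> * ?T (\<i> * \<alpha> * z) + \<alpha>\<^sup>2 * ?T (\<i> * \<alpha>\<^sup>2 * z)
     + 2 * (?T (- \<i> * z) + \<alpha> * ?T (- \<i> * \<alpha> * z) + \<alpha>\<^sup>2 * ?T (- \<i> * \<alpha>\<^sup>2 * z))
     = - z\<^sup>2 * (9/2 + \<i> * z ^ 3 / 40)" .
  have "Delta z = - z\<^sup>2 * (9/2 + \<i> * z ^ 3 / 40) + (r (\<i> * z) + \<alpha> * r (\<i> * \<alpha> * z) + \<alpha>\<^sup>2 * r (\<i> * \<alpha>\<^sup>2 * z)
     + 2 * (r (- \<i> * z) + \<alpha> * r (- \<i> * \<alpha> * z) + \<alpha>\<^sup>2 * r (- \<i> * \<alpha>\<^sup>2 * z)))" (is "_ = _ + ?R")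
    unfolding T[symmetric] Delta_def e by (simp add: algebra_simps)
  then have "z\<^sup>2 * (9/2 + \<i> * z ^ 3 / 40) = ?R" using assms by (simp add: algebra_simps)
  moreover have "cmod ?R \<le> 9 * (cmod z ^ 8 / 40320 * (9/5))"
  proof -
    let ?b = "cmod z ^ 8 / 40320 * (9/5)"
    have "cmod ?R \<le> (?b + ?b + ?b) + 2 * (?b + ?b + ?b)"
      by (intro norm_triangle_mono; (simp only: norm_mult norm_numeral)?; (intro mult_left_mono norm_triangle_mono)?)
        (simp_all only: norm_power norm_alpha power_one mult_1 norm_ii norm_minus_cancel, auto intro!: r simp del: times_divide_eq_right times_divide_eq_left simp: norm_mult norm_power)
    then show ?thesis by simp
  qed
  ultimately have "cmod (z\<^sup>2 * (9/2 + \<i> * z ^ 3 / 40)) \<le> 9 * (cmod z ^ 8 / 40320 * (9/5))"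
    by (simp only:)
  moreover have "9 * (cmod z ^ 8 / 40320 * (9/5)) = cmod z ^ 2 * (9 * (cmod z ^ 6 / 40320 * (9/5)))"
    using power_add[of "cmod z" 2 6] by simp
  ultimately have "cmod z ^ 2 * cmod (9/2 + \<i> * z ^ 3 / 40) \<le> cmod z ^ 2 * (9 * (cmod z ^ 6 / 40320 * (9/5)))"
    by (simp only: norm_mult norm_power)
  then have "cmod (9/2 + \<i> * z ^ 3 / 40) \<le> 9 * (cmod z ^ 6 / 40320 * (9/5))"
    using \<open>z \<noteq> 0\<close> by simp
  \<comment> \<open>At |z| = 4 this is about 1.65, while |9/2 + i z^3 / 40| >= 9/2 - 64/40 = 2.9.
    The factor 9 is the sum of the moduli of the six coefficients of \<open>Delta\<close>.\<close>
  also have "\<dots> \<le> 9 * (4 ^ 6 / 40320 * (9/5))"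
    using assms by (intro mult_left_mono mult_right_mono divide_right_mono power_mono) auto
  finally have "cmod (9/2 + \<i> * z ^ 3 / 40) < 2" by simp
  moreover have "9/2 \<le> cmod (9/2 + \<i> * z ^ 3 / 40) + cmod (\<i> * z ^ 3 / 40)"
    using norm_triangle_ineq4[of "9/2 + \<i> * z ^ 3 / 40" "\<i> * z ^ 3 / 40"] by simp
  moreover have "cmod (\<i> * z ^ 3 / 40) \<le> 4 ^ 3 / 40"
    using assms by (simp add: norm_mult norm_divide norm_power) (use power_mono[of "cmod z" 4 3] in simp)
  ultimately show False by simp
qed

text \<open>The zeros are studied where \<open>eP (\<alpha>\<^sup>2 * z)\<close> and \<open>inverse (eP (\<alpha> * z))\<close> are the dominant exponentials;
  dividing by the former leaves the periodic function \<open>1 + 2 * \<alpha>\<^sup>2 * eP z\<close> and an exponentially small rest.\<close>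

definition eps :: "complex \<Rightarrow> complex" where
  "eps z = \<alpha> * (eP z + 2 * inverse (eP z)) * inverse (eP (\<alpha>\<^sup>2 * z))
     + (\<alpha>\<^sup>2 * inverse (eP z) + 2) * (inverse (eP (\<alpha>\<^sup>2 * z)))\<^sup>2"

lemma Delta_eps: "Delta z = \<alpha>\<^sup>2 * eP (\<alpha>\<^sup>2 * z) * (1 + 2 * \<alpha>\<^sup>2 * eP z + eps z)"
proof -
  define P S where "P = eP z" and "S = eP (\<alpha>\<^sup>2 * z)"
  have nz: "P \<noteq> 0" "S \<noteq> 0" by (auto simp: P_def S_def)
  have Q: "eP (\<alpha> * z) = 1 / (P * S)"
    using eP_prod[of z] nz unfolding P_def[symmetric] S_def[symmetric] by (simp add: field_simps)
  have a3: "\<alpha> * (\<alpha> * (\<alpha> * w)) = w" "\<alpha> * (\<alpha> * \<alpha>) = 1" for w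
    using alpha_cube by (simp_all add: power3_eq_cube flip: mult.assoc)
  show ?thesis
    unfolding Delta_eP eps_def P_def[symmetric] S_def[symmetric] Q
    using nz by (simp add: field_simps power2_eq_square a3)
qed

text \<open>The zero condition solved for the periodic factor: 1 / (2 \<alpha>^2) = \<alpha> / 2
  because \<alpha>^3 = 1. A logarithm turns this form into a fixed point equation.\<close>

lemma Delta_eq_0_iff: "Delta z = 0 \<longleftrightarrow> eP z = - (\<alpha> / 2) * (1 + eps z)"
proof -
  have "1 + 2 * \<alpha>\<^sup>2 * eP z + eps z = 2 * \<alpha>\<^sup>2 * (eP z + (\<alpha> / 2) * (1 + eps z))"
  proof -
    have "2 * \<alpha>\<^sup>2 * ((\<alpha> / 2) * w) = \<alpha> ^ 3 * w" for w
      by (simp add: power2_eq_square power3_eq_cube)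
    then show ?thesis unfolding distrib_left[of _ "eP z"] alpha_cube by simp
  qed
  then have "Delta z = 0 \<longleftrightarrow> eP z + (\<alpha> / 2) * (1 + eps z) = 0"
    by (simp add: Delta_eps)
  then show ?thesis by (simp add: eq_neg_iff_add_eq_0)
qed

lemma norm_eP_alpha_sq: "cmod (eP (\<alpha>\<^sup>2 * z)) = exp ((sqrt 3 * Re z + Im z) / 2)"
  unfolding norm_eP by (simp add: Re_alpha_sq Im_alpha_sq field_simps)

lemma norm_inv_eP_alpha_sq: "cmod (inverse (eP (\<alpha>\<^sup>2 * z))) = exp (- (sqrt 3 * Re z + Im z) / 2)"
  unfolding norm_inverse norm_eP_alpha_sq by (simp only: exp_minus[symmetric] minus_divide_left)

lemma norm_inv_eP: "cmod (inverse (eP z)) = exp (Im z)"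
  unfolding norm_inverse norm_eP by (simp add: exp_minus[symmetric])

lemma norm_eps_le:
  "cmod (eps z) \<le> (exp (- Im z) + 2 * exp (Im z)) * exp (- (sqrt 3 * Re z + Im z) / 2)
     + (exp (Im z) + 2) * (exp (- (sqrt 3 * Re z + Im z) / 2))\<^sup>2"
  unfolding eps_def
  by (intro norm_triangle_mono; (simp only: norm_mult norm_power norm_inv_eP_alpha_sq)?;
      (intro mult_right_mono)?)
    (auto simp: norm_mult norm_power norm_inv_eP norm_eP intro!: norm_triangle_mono)

lemma sqrt3_bounds: "1732/1000 \<le> sqrt 3" "sqrt 3 \<le> 2"
  by (rule real_le_rsqrt, simp add: power2_eq_square) (rule real_le_lsqrt, auto)

lemma pi_ge_3: "3 \<le> pi"
proof -
  have "1/2 = sin (pi/6)" by (simp add: sin_30)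
  also have "\<dots> \<le> pi/6" by (rule sin_x_le_x) simp
  finally show ?thesis by simp
qed

lemma e_ge_27: "27/10 \<le> exp (1::real)"
proof -
  have "27/10 \<le> (1 + 1/8 + (1/8)\<^sup>2/2 :: real) ^ 8" by (simp add: power_divide power2_eq_square) 
  also have "\<dots> \<le> exp (1/8) ^ 8" by (intro power_mono exp_lower_Taylor_quadratic) auto
  also have "\<dots> = exp (1::real)" by (simp flip: exp_of_nat_mult)
  finally show ?thesis .
qed

text \<open>On \<open>strip\<close> the exponent (sqrt 3 Re z + Im z) / 2 is at least 1.732 * 13/6 >
  15/4, so this yields the bound 1/40 for
  \<open>inverse (eP (\<alpha>\<^sup>2 * z))\<close>.\<close>

lemma exp_375_ge_40: "40 \<le> exp (15/4::real)"
proof -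
  have "40 \<le> (1 + 1/4 + (1/4)\<^sup>2/2 :: real) ^ 15" by (simp add: power_divide power2_eq_square) 
  also have "\<dots> \<le> exp (1/4) ^ 15" by (intro power_mono exp_lower_Taylor_quadratic) auto
  also have "\<dots> = exp (15/4::real)" by (simp flip: exp_of_nat_mult)
  finally show ?thesis .
qed

text \<open>The zeros of \<open>1 + 2 * \<alpha>\<^sup>2 * eP z\<close> in the right half-plane.\<close>

definition lat :: "nat \<Rightarrow> complex" where
  "lat k = Complex (5 * pi / 3 + 2 * pi * k) (ln 2)"

text \<open>The angle 5 pi / 3 = 2 pi / 3 + pi supplies \<alpha> and the sign, the height ln 2 the
  factor 1/2.\<close>

lemma eP_lat: "eP (lat k) = - (\<alpha> / 2)"
proof -
  have "\<i> * lat k = Complex (- ln 2) (5 * pi / 3 + 2 * pi * k)" by (simp add: lat_def complex_eq_iff)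
  then have "eP (lat k) = of_real (exp (- ln 2)) * cis (5 * pi / 3 + 2 * pi * k)"
    by (simp add: eP_def exp_eq_polar)
  also have "cis (5 * pi / 3 + 2 * pi * k) = cis (5 * pi / 3)"
    by (simp add: cis_multiple_2pi flip: cis_mult)
  also have "\<dots> = cis (2 * pi / 3 + pi)" by (simp add: field_simps)
  also have "\<dots> = - cis (2 * pi / 3)" unfolding cis_mult[symmetric] by simp
  also have "cis (2 * pi / 3) = \<alpha>" by (simp add: \<alpha>_def cis_conv_exp mult_ac)
  finally show ?thesis by (simp add: exp_minus)
qed

text \<open>A region containing every disc \<open>cball (lat k) (2/3)\<close>: the real parts are at
  least 5 - 2/3 because pi >= 3, and 2/3 <= ln 2 keeps the imaginary parts between 0 and 2 ln 2. It
  is convex, so one derivative bound is a Lipschitz constant for all k.\<close>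

definition strip :: "complex set" where
  "strip = {z. 13/3 \<le> Re z \<and> 0 \<le> Im z \<and> Im z \<le> 2 * ln 2}"

lemma convex_strip: "convex strip"
proof -
  have *: "strip = {z. 13/3 \<le> Re z} \<inter> {z. 0 \<le> Im z} \<inter> {z. Im z \<le> 2 * ln 2}" by (auto simp: strip_def)
  show ?thesis unfolding *
    by (intro convex_Int convex_halfspace_Re_ge convex_halfspace_Im_ge convex_halfspace_Im_le)
qed

lemma cball_lat_strip: "cball (lat k) (2/3) \<subseteq> strip"
proof
  fix z assume "z \<in> cball (lat k) (2/3)"
  then have z: "cmod (z - lat k) \<le> 2/3" by (simp add: dist_norm norm_minus_commute)
  have "\<bar>Re z - (5 * pi / 3 + 2 * pi * k)\<bar> \<le> 2/3" "\<bar>Im z - ln 2\<bar> \<le> 2/3"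
    using abs_Re_le_cmod[of "z - lat k"] abs_Im_le_cmod[of "z - lat k"] z by (auto simp: lat_def)
  moreover have "0 \<le> 2 * pi * k" by simp
  moreover have "5 * 3 / 3 \<le> 5 * pi / 3" using pi_ge_3 by simp
  ultimately show "z \<in> strip" using ln2_ge_two_thirds unfolding strip_def mem_Collect_eq by linarith
qed

lemma strip_norms:
  assumes "z \<in> strip"
  shows "cmod (eP z) \<le> 1" "1/4 \<le> cmod (eP z)" "cmod (inverse (eP z)) \<le> 4"
    "cmod (inverse (eP (\<alpha>\<^sup>2 * z))) \<le> 1/40"
proof -
  have z: "13/3 \<le> Re z" "0 \<le> Im z" "Im z \<le> 2 * ln 2" using assms by (auto simp: strip_def)
  show "cmod (eP z) \<le> 1" using z by (simp add: norm_eP)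
  have "exp (Im z) \<le> exp (2 * ln 2)" using z by simp
  also have "\<dots> = (4::real)" by (simp add: exp_double)
  finally show "cmod (inverse (eP z)) \<le> 4" unfolding norm_inv_eP .
  moreover have "0 < cmod (eP z)" by simp
  ultimately show "1/4 \<le> cmod (eP z)" unfolding norm_inverse by (simp add: field_simps)
  have "1732/1000 * (13/3) \<le> sqrt 3 * Re z" using z sqrt3_bounds by (intro mult_mono) auto
  then have "15/4 \<le> (sqrt 3 * Re z + Im z) / 2" using z by simp
  then have "exp (15/4) \<le> exp ((sqrt 3 * Re z + Im z) / 2)" by simp
  then have "40 \<le> cmod (eP (\<alpha>\<^sup>2 * z))" unfolding norm_eP_alpha_sq using exp_375_ge_40 by linarith
  then show "cmod (inverse (eP (\<alpha>\<^sup>2 * z))) \<le> 1/40"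
    using le_imp_inverse_le[of 40 "cmod (eP (\<alpha>\<^sup>2 * z))"] unfolding norm_inverse by simp
qed

lemma norm_eps_strip:
  assumes "z \<in> strip" shows "cmod (eps z) \<le> 10 * cmod (inverse (eP (\<alpha>\<^sup>2 * z)))" "cmod (eps z) \<le> 1/4"
proof -
  note n = strip_norms[OF assms]
  let ?t = "inverse (eP (\<alpha>\<^sup>2 * z))"
  \<comment> \<open>Linear coefficient 9, quadratic coefficient 6; one factor 1/40 of the quadratic
    term makes the total 9 + 6/40 < 10.\<close>
  have "cmod (eps z) \<le> 1 * (1 + 2 * 4) * cmod ?t + (1 * 4 + 2) * (1/40 * cmod ?t)"
    unfolding eps_def power2_eq_square[of ?t] norm_mult
    by (intro norm_triangle_mono; (simp only: norm_mult)?; intro mult_mono norm_triangle_mono)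
      (use n in \<open>auto simp: norm_mult norm_power\<close>)
  then have "cmod (eps z) \<le> 9 * cmod ?t + 6 / 40 * cmod ?t" by simp
  then show "cmod (eps z) \<le> 10 * cmod ?t" using norm_ge_zero[of ?t] by linarith
  with n(4) show "cmod (eps z) \<le> 1/4" by linarith
qed

lemma has_field_derivative_eP [derivative_intros]:
  "(f has_field_derivative f') (at z within A) \<Longrightarrow>
    ((\<lambda>z. eP (f z)) has_field_derivative (\<i> * f' * eP (f z))) (at z within A)"
  unfolding eP_def by (auto intro!: derivative_eq_intros)

lemma eps_deriv_strip:
  assumes "z \<in> strip"
  shows "\<exists>e'. (eps has_field_derivative e') (at z within A) \<and> cmod e' \<le> 1/2"
proof -
  note n = strip_norms[OF assms]
  define P t where "P = eP z" and "t = inverse (eP (\<alpha>\<^sup>2 * z))"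
  have nz: "P \<noteq> 0" by (simp add: P_def)
  define e' where "e' = \<alpha> * (\<i> * P - 2 * \<i> * inverse P) * t - \<alpha> * (P + 2 * inverse P) * (\<i> * \<alpha>\<^sup>2 * t)
    - \<alpha>\<^sup>2 * \<i> * inverse P * t\<^sup>2 - (\<alpha>\<^sup>2 * inverse P + 2) * (2 * \<i> * \<alpha>\<^sup>2 * t\<^sup>2)"
  have dP: "(eP has_field_derivative \<i> * P) (at z within A)"
    unfolding P_def by (rule DERIV_cong[OF has_field_derivative_eP]) (auto intro: DERIV_ident)
  have inv: "inverse (eP w) = eP (- w)" for w by (simp add: eP_def exp_minus)
  have dI: "((\<lambda>z. inverse (eP (c * z))) has_field_derivative - \<i> * c * inverse (eP (c * z))) (at z within A)" for c
    unfolding inv by (rule DERIV_cong[OF has_field_derivative_eP]) (auto intro!: derivative_eq_intros)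
  have "(eps has_field_derivative e') (at z within A)"
    unfolding eps_def[abs_def]
    by (rule DERIV_cong, (rule DERIV_add DERIV_mult DERIV_power DERIV_const dP dI dI[of 1, simplified])+)
      (simp only: e'_def P_def[symmetric] t_def[symmetric], simp add: power2_eq_square algebra_simps)
  moreover have "cmod e' \<le> 1 * (1 + 2 * 4) * (1/40) + 1 * (1 + 2 * 4) * (1/40) + 1 * 4 * (1/40)\<^sup>2 + (1 * 4 + 2) * (2 * (1/40)\<^sup>2)"
  proof -
    have tri: "cmod (a - b - c - d) \<le> cmod a + cmod b + cmod c + cmod d" for a b c d
      using norm_triangle_ineq4[of "a - b - c" d] norm_triangle_ineq4[of "a - b" c] norm_triangle_ineq4[of a b]
      by linarith
    have t: "cmod t \<le> 1/40" "cmod t ^ 2 \<le> (1/40)\<^sup>2" and P: "cmod P \<le> 1" "cmod (inverse P) \<le> 4"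
      using n by (auto simp: t_def P_def intro!: power_mono)
    have "cmod (\<i> * P - 2 * \<i> * inverse P) \<le> 1 + 2 * 4"
      using norm_triangle_ineq4[of "\<i> * P" "2 * \<i> * inverse P"] P by (simp add: norm_mult)
    then have 1: "cmod (\<alpha> * (\<i> * P - 2 * \<i> * inverse P) * t) \<le> 1 * (1 + 2 * 4) * (1/40)"
      unfolding norm_mult[of _ t] norm_mult[of \<alpha>] using t by (intro mult_mono) auto
    have "cmod (P + 2 * inverse P) \<le> 1 + 2 * 4"
      using norm_triangle_ineq[of P "2 * inverse P"] P by (simp add: norm_mult)
    then have 2: "cmod (\<alpha> * (P + 2 * inverse P) * (\<i> * \<alpha>\<^sup>2 * t)) \<le> 1 * (1 + 2 * 4) * (1/40)"
      unfolding norm_mult[of _ "\<i> * \<alpha>\<^sup>2 * t"] norm_mult[of \<alpha>] using t by (intro mult_mono) (auto simp: norm_mult norm_power)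
    have 3: "cmod (\<alpha>\<^sup>2 * \<i> * inverse P * t\<^sup>2) \<le> 1 * 4 * (1/40)\<^sup>2"
      unfolding norm_mult[of _ "t\<^sup>2"] norm_mult[of _ "inverse P"] norm_power using t P
      by (intro mult_mono) (auto simp: norm_mult norm_power)
    have "cmod (\<alpha>\<^sup>2 * inverse P + 2) \<le> 1 * 4 + 2"
      using norm_triangle_ineq[of "\<alpha>\<^sup>2 * inverse P" 2] P by (simp add: norm_mult norm_power)
    then have 4: "cmod ((\<alpha>\<^sup>2 * inverse P + 2) * (2 * \<i> * \<alpha>\<^sup>2 * t\<^sup>2)) \<le> (1 * 4 + 2) * (2 * (1/40)\<^sup>2)"
      unfolding norm_mult[of _ "2 * \<i> * \<alpha>\<^sup>2 * t\<^sup>2"] using t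
      by (intro mult_mono) (auto simp: norm_mult norm_power)
    show ?thesis unfolding e'_def by (rule order_trans[OF tri]) (intro add_mono 1 2 3 4)
  qed
  ultimately show ?thesis by (intro exI[of _ e']) (auto simp: power2_eq_square)
qed

section \<open>Location of the zeros\<close>

text \<open>A fixed point satisfies \<open>eP z = eP (lat k) * (1 + eps z)\<close>, which is \<open>Delta z = 0\<close>.\<close>

definition newt :: "nat \<Rightarrow> complex \<Rightarrow> complex" where
  "newt k z = lat k - \<i> * Ln (1 + eps z)"

text \<open>As |1 + eps| >= 3/4 and |eps'| <= 1/2, the derivative of Ln (1 + eps) is at most 4/3 *
  1/2 = 2/3. The positive real part of 1 + eps keeps the argument off the branch cut.\<close>

lemma newt_lipschitz:
  assumes "z \<in> strip" "w \<in> strip"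
  shows "dist (newt k z) (newt k w) \<le> 2/3 * dist z w"
proof -
  obtain e' where e': "(eps has_field_derivative e' z) (at z within strip)" "cmod (e' z) \<le> 1/2" if "z \<in> strip" for z
    using eps_deriv_strip[of _ strip] by metis
  have n: "3/4 \<le> cmod (1 + eps z)" "0 < Re (1 + eps z)" if "z \<in> strip" for z
    using norm_eps_strip(2)[OF that] norm_triangle_ineq2[of 1 "- eps z"] abs_Re_le_cmod[of "eps z"] by auto
  have d: "((\<lambda>z. Ln (1 + eps z)) has_field_derivative inverse (1 + eps z) * e' z) (at z within strip)"
    if "z \<in> strip" for z
    using n[OF that] e'(1)[OF that]
    by (intro DERIV_chain2[of Ln]) (auto intro!: derivative_eq_intros has_field_derivative_Ln simp: complex_nonpos_Reals_iff)
  have b: "cmod (inverse (1 + eps z) * e' z) \<le> 2/3" if "z \<in> strip" for z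
  proof -
    have "cmod (inverse (1 + eps z)) \<le> 4/3"
      using le_imp_inverse_le[OF n(1)[OF that]] by (simp add: norm_inverse)
    then have "cmod (inverse (1 + eps z) * e' z) \<le> 4/3 * (1/2)"
      unfolding norm_mult by (intro mult_mono e' that) auto
    then show ?thesis by simp
  qed
  have "cmod (Ln (1 + eps z) - Ln (1 + eps w)) \<le> 2/3 * cmod (z - w)"
    by (rule field_differentiable_bound[OF convex_strip d b assms])
  moreover have "newt k z - newt k w = - \<i> * (Ln (1 + eps z) - Ln (1 + eps w))"
    by (simp add: newt_def algebra_simps)
  ultimately show ?thesis by (simp only: dist_norm norm_mult) simp
qed

lemma newt_fixpoint_iff:
  assumes "z \<in> cball (lat k) (2/3)"
  shows "newt k z = z \<longleftrightarrow> Delta z = 0"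
proof
  have eps: "cmod (eps z) \<le> 1/4" using norm_eps_strip(2) assms cball_lat_strip by blast
  then have nz: "1 + eps z \<noteq> 0"
    by (metis add_cancel_right_right add_diff_cancel_left' add_eq_0_iff norm_minus_cancel norm_one not_le one_less_numeral_iff semiring_norm(76) less_divide_eq_1_pos zero_less_numeral diff_0 divide_less_eq_1)
  {
    assume "newt k z = z"
    then have "\<i> * z = \<i> * lat k + Ln (1 + eps z)"
      by (metis (no_types) newt_def add.commute add_diff_cancel_right' complex_i_mult_minus diff_add_cancel right_diff_distrib' minus_diff_eq diff_minus_eq_add)
    then have "eP z = eP (lat k) * (1 + eps z)" using nz by (simp add: eP_def exp_add)
    then show "Delta z = 0" by (simp add: Delta_eq_0_iff eP_lat)
  }
  {
    assume "Delta z = 0"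
    then have "eP z = eP (lat k) * (1 + eps z)" by (simp add: Delta_eq_0_iff eP_lat)
    then have "exp (\<i> * z) = exp (\<i> * lat k + Ln (1 + eps z))" using nz by (simp add: eP_def exp_add)
    \<comment> \<open>The exponential determines z only up to a period. Both z - lat k and the
      logarithm are small, so the period has modulus at most 2/3 + 1/2, which forces n = 0.\<close>
    then obtain n :: int where n: "\<i> * z = \<i> * lat k + Ln (1 + eps z) + (of_int (2 * n) * pi) * \<i>"
      unfolding exp_eq by blast
    have "cmod (of_int (2 * n) * pi * \<i>) = cmod (\<i> * (z - lat k) - Ln (1 + eps z))"
      using n by (simp add: algebra_simps)
    also have "\<dots> \<le> cmod (\<i> * (z - lat k)) + cmod (Ln (1 + eps z))" by (rule norm_triangle_ineq4)
    also have "\<dots> \<le> 2/3 + 2 * (1/4)"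
      using assms eps norm_Ln_le[of "eps z"] by (intro add_mono) (auto simp: norm_mult dist_norm norm_minus_commute)
    finally have "\<bar>2 * of_int n\<bar> * pi < 2" by (simp add: norm_mult)
    moreover have "\<bar>2 * of_int n :: real\<bar> * 3 \<le> \<bar>2 * of_int n\<bar> * pi" using pi_ge_3 by (intro mult_left_mono) auto
    ultimately have "n = 0" by linarith
    with n have "\<i> * z = \<i> * lat k + Ln (1 + eps z)" by simp
    then have "\<i> * (\<i> * z) = \<i> * (\<i> * lat k + Ln (1 + eps z))" by simp
    then show "newt k z = z" by (simp add: newt_def algebra_simps)
  }
qed

lemma ex1_zero_near_lat: "\<exists>!z. z \<in> cball (lat k) (2/3) \<and> Delta z = 0"
proof -
  have "\<exists>!z\<in>cball (lat k) (2/3). newt k z = z"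
  proof (rule Banach_fix)
    show "complete (cball (lat k) (2/3))" by (rule compact_imp_complete) simp
    show "newt k ` cball (lat k) (2/3) \<subseteq> cball (lat k) (2/3)"
    proof safe
      fix z assume z: "z \<in> cball (lat k) (2/3)"
      have "cmod (eps z) \<le> 1/4" using norm_eps_strip(2) z cball_lat_strip by blast
      then have "cmod (Ln (1 + eps z)) \<le> 1/2" using norm_Ln_le[of "eps z"] by simp
      then show "newt k z \<in> cball (lat k) (2/3)" by (simp add: newt_def dist_norm norm_mult)
    qed
    show "dist (newt k z) (newt k w) \<le> 2/3 * dist z w" if "z \<in> cball (lat k) (2/3)" "w \<in> cball (lat k) (2/3)" for z w
      using newt_lipschitz that cball_lat_strip by blast
  qed auto
  then show ?thesis using newt_fixpoint_iff by (metis (no_types, lifting))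
qed

definition sig :: "nat \<Rightarrow> complex" where
  "sig k = (THE z. z \<in> cball (lat k) (2/3) \<and> Delta z = 0)"

lemma sig: "sig k \<in> cball (lat k) (2/3)" "Delta (sig k) = 0"
  using theI'[OF ex1_zero_near_lat, of k] by (auto simp: sig_def)

lemma sig_unique: "z \<in> cball (lat k) (2/3) \<Longrightarrow> Delta z = 0 \<Longrightarrow> z = sig k"
  using ex1_zero_near_lat[of k] sig[of k] by blast

lemma sig_strip: "sig k \<in> strip"
  using sig cball_lat_strip by blast

lemma Re_sig: "\<bar>Re (sig k) - (5 * pi / 3 + 2 * pi * k)\<bar> \<le> 2/3"
proof -
  have "cmod (sig k - lat k) \<le> 2/3" using sig(1)[of k] by (simp add: dist_norm norm_minus_commute)
  then show ?thesis using abs_Re_le_cmod[of "sig k - lat k"] by (simp add: lat_def)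
qed

text \<open>Here z is not yet known to lie in \<open>strip\<close>, so \<open>eps\<close> is
  estimated anew from sqrt 3 Re z >= 6 and the sector condition. The target |eps| <= 1/3 makes the
  logarithm at most 2/3, the radius of the disc in which \<open>sig k\<close> is unique.\<close>

lemma sector_zero:
  assumes "Delta z = 0" "z \<noteq> 0" "sqrt 3 * \<bar>Im z\<bar> \<le> Re z"
  shows "\<exists>k. z = sig k"
proof -
  define x y where "x = Re z" and "y = Im z"
  have xy: "sqrt 3 * \<bar>y\<bar> \<le> x" using assms by (simp add: x_def y_def)
  have "0 \<le> sqrt 3 * \<bar>y\<bar>" by simp
  with xy have x0: "0 \<le> x" by linarith
  have "cmod z > 4" using Delta_zero_small[OF assms(1)] assms(2) by fastforce
  \<comment> \<open>With 3 y^2 <= x^2 this gives 4/3 x^2 > 16, so x > 2 sqrt 3 and sqrt 3 x exceeds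
    6.\<close>
  then have "4\<^sup>2 < (cmod z)\<^sup>2" by (intro power_strict_mono) auto
  then have "16 < x\<^sup>2 + y\<^sup>2" by (simp add: cmod_power2 x_def y_def)
  moreover have "3 * y\<^sup>2 \<le> x\<^sup>2"
    using power_mono[OF xy, of 2] by (simp add: power_mult_distrib)
  ultimately have "12 < x\<^sup>2" by simp
  then have "(2 * sqrt 3)\<^sup>2 < x\<^sup>2" by (simp add: power_mult_distrib)
  then have x: "2 * sqrt 3 < x" using power2_less_imp_less x0 by blast
  have "sqrt 3 * (2 * sqrt 3) \<le> sqrt 3 * x" using x by (intro mult_left_mono) auto
  moreover have "sqrt 3 * (2 * sqrt 3) = 6" by simp
  ultimately have x3: "6 \<le> sqrt 3 * x" by (simp only:)
  have y3: "\<bar>y\<bar> \<le> sqrt 3 * x / 3"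
    using mult_left_mono[OF xy, of "sqrt 3"] by (simp flip: mult.assoc)
  define E where "E = exp (- (sqrt 3 * x + y) / 2)"
  have e: "exp (- y) * E = exp (- (sqrt 3 * x + 3 * y) / 2)" "exp y * E = exp (- (sqrt 3 * x - y) / 2)"
      "exp y * E\<^sup>2 = exp (- (sqrt 3 * x))" "E\<^sup>2 = exp (- (sqrt 3 * x + y))"
    by (simp_all add: E_def power2_eq_square mult_exp_exp field_simps)
  have "cmod (eps z) \<le> (exp (- y) + 2 * exp y) * E + (exp y + 2) * E\<^sup>2"
    using norm_eps_le[of z] by (simp add: x_def y_def E_def)
  then have eps: "cmod (eps z) \<le> exp (- (sqrt 3 * x + 3 * y) / 2) + 2 * exp (- (sqrt 3 * x - y) / 2)
     + exp (- (sqrt 3 * x)) + 2 * exp (- (sqrt 3 * x + y))"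
    unfolding e[symmetric] by (simp add: algebra_simps)
  define q where "q = exp (-1 :: real)"
  have q: "0 < q" "q \<le> 10/27" using e_ge_27 by (auto simp: q_def exp_minus field_simps)
  have q3: "q ^ 2 \<le> (10/27) ^ 2" "q ^ 3 \<le> (10/27) ^ 3" "q ^ 6 \<le> (10/27) ^ 6" using q by (auto intro!: power_mono)
  have expq: "exp (- real n) = q ^ n" for n by (simp add: q_def flip: exp_of_nat_mult)
  have P: "eP z = - (\<alpha> / 2) * (1 + eps z)" using assms(1) Delta_eq_0_iff by blast
  then have "cmod (eP z) = cmod (1 + eps z) / 2" by (simp add: norm_mult norm_divide)
  then have nP: "2 * exp (- y) = cmod (1 + eps z)" by (simp add: norm_eP y_def)
  \<comment> \<open>For y < 0 put E = e^(-y) > 1. Then |eps| <= E/2, whereas a zero satisfies 2 E =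
    |1 + eps| <= 1 + E/2, which is impossible.\<close>
  have y: "0 \<le> y"
  proof (rule ccontr)
    assume "\<not> 0 \<le> y"
    then have y: "y < 0" by simp
    define E where "E = exp (- y)"
    have E: "1 < E" using y by (simp add: E_def)
    have "exp (- (sqrt 3 * x + 3 * y) / 2) = exp (- (sqrt 3 * x + y) / 2) * E"
      by (simp add: E_def field_simps flip: exp_add)
    also have "exp (- (sqrt 3 * x + y) / 2) \<le> exp (- real 2)"
      using x3 y3 y by simp
    finally have 1: "exp (- (sqrt 3 * x + 3 * y) / 2) \<le> q ^ 2 * E" unfolding expq using E by simp
    have 2: "exp (- (sqrt 3 * x - y) / 2) \<le> q ^ 3 * E"
    proof -
      have "exp (- (sqrt 3 * x - y) / 2) \<le> exp (- real 3)" using x3 y by simp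
      also have "\<dots> \<le> q ^ 3 * E" unfolding expq using E q by simp
      finally show ?thesis .
    qed
    have 3: "exp (- (sqrt 3 * x)) \<le> q ^ 6 * E"
    proof -
      have "exp (- (sqrt 3 * x)) \<le> exp (- real 6)" using x3 y by simp
      also have "\<dots> \<le> q ^ 6 * E" unfolding expq using E q by simp
      finally show ?thesis .
    qed
    have 4: "exp (- (sqrt 3 * x + y)) \<le> q ^ 6 * E"
    proof -
      have "exp (- (sqrt 3 * x + y)) = exp (- (sqrt 3 * x)) * E" by (simp add: E_def flip: exp_add)
      also have "exp (- (sqrt 3 * x)) \<le> exp (- real 6)" using x3 y by simp
      finally show ?thesis unfolding expq using E by simp
    qed
    have "cmod (eps z) \<le> (q ^ 2 + 2 * q ^ 3 + 3 * q ^ 6) * E" using eps 1 2 3 4 by (simp add: algebra_simps)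
    also have "\<dots> \<le> ((10/27) ^ 2 + 2 * (10/27) ^ 3 + 3 * (10/27) ^ 6) * E"
      using q3 E by (intro mult_right_mono) auto
    also have "\<dots> \<le> (1/2) * E" using E by (intro mult_right_mono) (auto simp: power_divide)
    finally have "cmod (eps z) \<le> E / 2" by simp
    moreover have "2 * E \<le> 1 + cmod (eps z)" using nP norm_triangle_ineq[of 1 "eps z"] by (simp add: E_def)
    ultimately show False using E by simp
  qed
  have "exp (- (sqrt 3 * x + 3 * y) / 2) \<le> exp (- real 3)" "exp (- (sqrt 3 * x - y) / 2) \<le> exp (- real 2)"
     "exp (- (sqrt 3 * x)) \<le> exp (- real 6)" "exp (- (sqrt 3 * x + y)) \<le> exp (- real 6)"
    using x3 y3 y by auto
  then have "cmod (eps z) \<le> q ^ 3 + 2 * q ^ 2 + 3 * q ^ 6" using eps unfolding expq by linarith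
  also have "\<dots> \<le> (10/27) ^ 3 + 2 * (10/27) ^ 2 + 3 * (10/27) ^ 6" using q3 by linarith
  \<comment> \<open>Hardly any slack: the sum is about 0.3329. Hence the rather sharp bound 27/10
    for e.\<close>
  also have "\<dots> \<le> 1/3" by (simp add: power_divide)
  finally have eps3: "cmod (eps z) \<le> 1/3" .
  have nz: "1 + eps z \<noteq> 0"
  proof
    assume "1 + eps z = 0"
    then have "eps z = -1" by (simp add: eq_neg_iff_add_eq_0 add.commute)
    with eps3 show False by simp
  qed
  have "exp (\<i> * z) = exp (\<i> * lat 0 + Ln (1 + eps z))"
    using P nz eP_lat[of 0] by (simp add: eP_def exp_add)
  then obtain n :: int where n: "\<i> * z = \<i> * lat 0 + Ln (1 + eps z) + (of_int (2 * n) * pi) * \<i>"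
    unfolding exp_eq by blast
  have "- \<i> * (\<i> * z) = - \<i> * (\<i> * lat 0 + Ln (1 + eps z) + (of_int (2 * n) * pi) * \<i>)" using n by simp
  then have "z - (lat 0 + of_int (2 * n) * pi) = - \<i> * Ln (1 + eps z)"
    by (simp add: algebra_simps)
  then have "cmod (z - (lat 0 + of_int (2 * n) * pi)) = cmod (Ln (1 + eps z))"
    by (simp only: norm_mult) simp
  also have "\<dots> \<le> 2/3" using norm_Ln_le[of "eps z"] eps3 by simp
  finally have zl: "cmod (z - (lat 0 + of_int (2 * n) * pi)) \<le> 2/3" .
  then have "\<bar>x - (5 * pi / 3 + 2 * n * pi)\<bar> \<le> 2/3"
    using abs_Re_le_cmod[of "z - (lat 0 + of_int (2 * n) * pi)"] by (simp add: lat_def x_def)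
  \<comment> \<open>Excludes the continuation of the lattice to the left: n <= -1 would give a
    lattice point of real part at most -pi/3, against at least 3 - 2/3.\<close>
  moreover have "3 \<le> x" using x sqrt3_bounds by linarith
  ultimately have "7/3 \<le> 5 * pi / 3 + 2 * n * pi" by linarith
  moreover have "5 * pi / 3 + 2 * n * pi \<le> 5 * pi / 3 + 2 * (-1) * pi" if "n \<le> -1"
    using that by (intro add_left_mono mult_right_mono mult_left_mono) auto
  ultimately have "n \<ge> 0" using pi_ge_3 by (cases "n \<le> -1") auto
  then obtain k where k: "n = int k" using nonneg_int_cases by blast
  have "lat 0 + of_int (2 * n) * pi = lat k" by (simp add: k lat_def complex_eq_iff)
  with zl have "z \<in> cball (lat k) (2/3)" by (simp add: dist_norm norm_minus_commute)
  then show ?thesis using sig_unique assms by blast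
qed

section \<open>Symmetric description and separation of all zeros\<close>

definition zero_base :: "complex set" where
  "zero_base = range sig \<union> (\<lambda>k. - cnj (sig k)) ` UNIV"

lemma zero_base_bounds:
  assumes "v \<in> zero_base"
  shows "Delta v = 0" "13/3 \<le> \<bar>Re v\<bar>" "0 \<le> Im v" "Im v \<le> 25/18" "v \<noteq> 0"
proof -
  have s: "13/3 \<le> Re (sig k) \<and> 0 \<le> Im (sig k) \<and> Im (sig k) \<le> 25/18" for k
    using sig_strip[of k] ln2_le_25_over_36 unfolding strip_def by auto
  then have "13/3 \<le> \<bar>Re (sig k)\<bar>" for k by (meson abs_ge_self order_trans)
  with s show "13/3 \<le> \<bar>Re v\<bar>" "0 \<le> Im v" "Im v \<le> 25/18" 
    using assms by (auto simp: zero_base_def)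
  then show "v \<noteq> 0" by auto
  show "Delta v = 0" using assms sig(2) by (auto simp: zero_base_def Delta_mcnj)
qed

lemma Im_alpha_mult: "Im (\<alpha> * v) = (sqrt 3 * Re v - Im v) / 2"
  and Im_alpha_sq_mult: "Im (\<alpha>\<^sup>2 * v) = (- sqrt 3 * Re v - Im v) / 2"
  by (simp_all add: Re_alpha_sq Im_alpha_sq field_simps)

text \<open>Rotation carries these zeros away from the real axis: |Im| becomes at least (7 - 25/18)
  / 2, while the unrotated zeros have Im at most 25/18, and the difference exceeds 1.\<close>

lemma zero_base_rot_dist:
  assumes "v \<in> zero_base" "w \<in> zero_base" "m = 1 \<or> m = 2"
  shows "1 < cmod (\<alpha> ^ m * v - w)"
proof -
  note v = zero_base_bounds[OF assms(1)] and w = zero_base_bounds[OF assms(2)]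
  have "1732/1000 * (13/3) \<le> sqrt 3 * \<bar>Re v\<bar>" using v sqrt3_bounds by (intro mult_mono) auto
  then have *: "7 \<le> \<bar>sqrt 3 * Re v\<bar>" by (simp add: abs_mult)
  define s where "s = sqrt 3 * Re v"
  have *: "1 < \<bar>(s - Im v) / 2 - Im w\<bar>" "1 < \<bar>(- s - Im v) / 2 - Im w\<bar>"
  proof -
    have "7 \<le> s \<or> s \<le> - 7" using * unfolding s_def[symmetric] by linarith
    then show "1 < \<bar>(s - Im v) / 2 - Im w\<bar>" "1 < \<bar>(- s - Im v) / 2 - Im w\<bar>"
      using v(3,4) w(3,4) by (auto simp: abs_if field_simps)
  qed
  have "1 < \<bar>Im (\<alpha> ^ m * v - w)\<bar>"
    using assms(3)
  proof
    assume "m = 1" with * show ?thesis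
      by (simp only: power_one_right minus_complex.sel Im_alpha_mult s_def)
  next
    assume "m = 2" with * show ?thesis
      by (simp only: minus_complex.sel Im_alpha_sq_mult s_def mult_minus_left)
  qed
  then show ?thesis using abs_Im_le_cmod[of "\<alpha> ^ m * v - w"] by linarith
qed

lemma Re_sig_diff: "k \<noteq> l \<Longrightarrow> 1 < \<bar>Re (sig k) - Re (sig l)\<bar>"
proof (induction k l rule: linorder_wlog)
  case (le a b)
  then have "real a + 1 \<le> real b" by simp
  then have "2 * pi * (real a + 1) \<le> 2 * pi * real b" by (intro mult_left_mono) auto
  then have "2 * pi * real a + 6 \<le> 2 * pi * real b" using pi_ge_3 by (simp add: algebra_simps)
  then show ?case using Re_sig[of a] Re_sig[of b] by linarith
qed auto

lemma zero_base_dist: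
  assumes "v \<in> zero_base" "w \<in> zero_base" "v \<noteq> w"
  shows "1 < cmod (v - w)"
proof -
  have s: "13/3 \<le> Re (sig k)" for k using sig_strip[of k] by (auto simp: strip_def)
  have ss: "1 < \<bar>Re (sig k) + Re (sig l)\<bar>" for k l using s[of k] s[of l] by linarith
  have "1 < \<bar>Re (v - w)\<bar>"
    using assms(1)[unfolded zero_base_def] assms(2)[unfolded zero_base_def]
  proof (elim UnE imageE)
    fix k l assume "v = sig k" "w = sig l"
    then show ?thesis using Re_sig_diff[of k l] assms(3) by auto
  next
    fix k l assume "v = sig k" "w = - cnj (sig l)"
    then show ?thesis using ss[of k l] by simp
  next
    fix k l assume "v = - cnj (sig k)" "w = sig l"
    then show ?thesis using ss[of k l] by simp
  next
    fix k l assume "v = - cnj (sig k)" "w = - cnj (sig l)"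
    then show ?thesis using Re_sig_diff[of l k] assms(3) by auto
  qed
  then show ?thesis using abs_Re_le_cmod[of "v - w"] by linarith
qed

lemma alpha_rot_dist:
  assumes "v \<in> zero_base" "w \<in> zero_base" "i < 3" "j < 3" "i \<noteq> j \<or> v \<noteq> w"
  shows "1 < cmod (\<alpha> ^ i * v - \<alpha> ^ j * w)"
proof -
  consider "i = j" | "i < j" | "j < i" by linarith
  then show ?thesis
  proof cases
    case 1
    then have "\<alpha> ^ i * v - \<alpha> ^ j * w = \<alpha> ^ i * (v - w)" by (simp add: algebra_simps)
    then show ?thesis using zero_base_dist[OF assms(1,2)] assms 1 by (simp add: norm_mult norm_power)
  next
    case 2
    then have "\<alpha> ^ j = \<alpha> ^ i * \<alpha> ^ (j - i)" by (simp flip: power_add)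
    then have "\<alpha> ^ i * v - \<alpha> ^ j * w = (- (\<alpha> ^ i)) * (\<alpha> ^ (j - i) * w - v)" by (simp add: algebra_simps)
    moreover have "j - i = 1 \<or> j - i = 2" using 2 assms by auto
    ultimately show ?thesis using zero_base_rot_dist[OF assms(2,1)] by (simp add: norm_mult norm_power)
  next
    case 3
    then have "\<alpha> ^ i = \<alpha> ^ j * \<alpha> ^ (i - j)" by (simp flip: power_add)
    then have "\<alpha> ^ i * v - \<alpha> ^ j * w = \<alpha> ^ j * (\<alpha> ^ (i - j) * v - w)" by (simp add: algebra_simps)
    moreover have "i - j = 1 \<or> i - j = 2" using 3 assms by auto
    ultimately show ?thesis using zero_base_rot_dist[OF assms(1,2)] by (simp add: norm_mult norm_power)
  qed
qed

lemma Delta_alpha_power: "Delta (\<alpha> ^ i * z) = \<alpha> ^ (2 * i) * Delta z"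
  by (induction i) (simp_all add: Delta_alpha mult.assoc power2_eq_square)

lemma Delta_zeros_eq: "Delta_zeros = insert 0 {\<alpha> ^ i * v | i v. i < 3 \<and> v \<in> zero_base}"
proof (intro equalityI subsetI)
  fix z assume "z \<in> insert 0 {\<alpha> ^ i * v | i v. i < 3 \<and> v \<in> zero_base}"
  then show "z \<in> Delta_zeros"
    using zero_base_bounds(1) Delta_0 by (auto simp: Delta_zeros_def Delta_alpha_power)
next
  fix z assume "z \<in> Delta_zeros"
  then have z: "Delta z = 0" by (simp add: Delta_zeros_def)
  show "z \<in> insert 0 {\<alpha> ^ i * v | i v. i < 3 \<and> v \<in> zero_base}"
  proof (cases "z = 0")
    case False
    \<comment> \<open>The rotation with least |Im| is singled out. The other two have imaginary
      parts (sqrt 3 Re w - Im w) / 2 and (- sqrt 3 Re w - Im w) / 2, so minimality means 3 |Im w| <=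
      sqrt 3 |Re w|; the reflection w -> - cnj w then reduces to Re w >= 0.\<close>
    have *: "w \<in> zero_base" if w: "Delta w = 0" "w \<noteq> 0" "\<bar>Im w\<bar> \<le> \<bar>Im (\<alpha> * w)\<bar>" "\<bar>Im w\<bar> \<le> \<bar>Im (\<alpha>\<^sup>2 * w)\<bar>" for w
    proof -
      have sec: "sqrt 3 * \<bar>Im w\<bar> \<le> \<bar>Re w\<bar>"
      proof -
        define s where "s = sqrt 3 * Re w"
        have "3 * \<bar>Im w\<bar> \<le> \<bar>s\<bar>"
          using w(3,4) unfolding Im_alpha_mult Im_alpha_sq_mult by (simp add: s_def[symmetric])
        also have "\<bar>s\<bar> = sqrt 3 * \<bar>Re w\<bar>" by (simp add: s_def abs_mult)
        also have "3 * \<bar>Im w\<bar> = sqrt 3 * (sqrt 3 * \<bar>Im w\<bar>)" by (simp flip: mult.assoc)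
        finally show ?thesis by simp
      qed
      show ?thesis
      proof (cases "0 \<le> Re w")
        case True
        then show ?thesis using sector_zero[of w] w sec by (auto simp: zero_base_def)
      next
        case False
        then obtain k where "- cnj w = sig k" using sector_zero[of "- cnj w"] w sec by (auto simp: Delta_mcnj)
        then have "w = - cnj (sig k)" by (metis complex_cnj_cnj complex_cnj_minus minus_minus)
        then show ?thesis by (auto simp: zero_base_def)
      qed
    qed
    have D: "Delta (\<alpha> * z) = 0" "Delta (\<alpha>\<^sup>2 * z) = 0"
      using z by (simp_all add: Delta_alpha flip: alpha_mult(1))
    consider "\<bar>Im z\<bar> \<le> \<bar>Im (\<alpha> * z)\<bar>" "\<bar>Im z\<bar> \<le> \<bar>Im (\<alpha>\<^sup>2 * z)\<bar>"
      | "\<bar>Im (\<alpha> * z)\<bar> \<le> \<bar>Im z\<bar>" "\<bar>Im (\<alpha> * z)\<bar> \<le> \<bar>Im (\<alpha>\<^sup>2 * z)\<bar>"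
      | "\<bar>Im (\<alpha>\<^sup>2 * z)\<bar> \<le> \<bar>Im z\<bar>" "\<bar>Im (\<alpha>\<^sup>2 * z)\<bar> \<le> \<bar>Im (\<alpha> * z)\<bar>"
      by linarith
    then have "\<exists>i<3. \<exists>v\<in>zero_base. z = \<alpha> ^ i * v"
    proof cases
      case 1
      then show ?thesis using *[of z] z False by (intro exI[of _ 0]) auto
    next
      case 2
      then have "\<alpha> * z \<in> zero_base" using *[of "\<alpha> * z"] D False by (simp add: alpha_mult)
      then show ?thesis by (intro exI[of _ 2] conjI bexI[of _ "\<alpha> * z"]) (simp_all add: alpha_mult)
    next
      case 3
      then have "\<alpha>\<^sup>2 * z \<in> zero_base" using *[of "\<alpha>\<^sup>2 * z", unfolded alpha_mult, OF D(2) _ 3] False by simp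
      then show ?thesis by (intro exI[of _ 1] conjI bexI[of _ "\<alpha>\<^sup>2 * z"]) (simp_all add: alpha_mult)
    qed
    then show ?thesis by blast
  qed simp
qed

text \<open>A distance above 1 makes circles of radius 1/2 disjoint and leaves every zero alone in
  its closed unit disc.\<close>

lemma Delta_zeros_separated:
  assumes "z \<in> Delta_zeros" "w \<in> Delta_zeros" "z \<noteq> w"
  shows "1 < cmod (z - w)"
proof (cases "z = 0 \<or> w = 0")
  case True
  then have "4 < cmod (z - w)"
    using Delta_zero_small[of z] Delta_zero_small[of w] assms by (force simp: Delta_zeros_def)
  then show ?thesis by simp
next
  case False
  then obtain i v j w' where "z = \<alpha> ^ i * v" "w = \<alpha> ^ j * w'" "i < 3" "j < 3" "v \<in> zero_base" "w' \<in> zero_base"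
    using assms unfolding Delta_zeros_eq by blast
  then show ?thesis using alpha_rot_dist[of v w' i j] assms(3) by auto
qed

text \<open>The six images of \<open>sig k\<close> under the symmetries \<open>z \<mapsto> \<alpha> * z\<close> and \<open>z \<mapsto> - cnj z\<close> of the zero set.\<close>

definition zr :: "nat \<Rightarrow> nat \<Rightarrow> complex" where
  "zr i k = (if i < 3 then \<alpha> ^ i * sig k else - cnj (\<alpha> ^ (i - 3) * sig k))"

lemma less6_cases: "i < (6::nat) \<Longrightarrow> i = 0 \<or> i = 1 \<or> i = 2 \<or> i = 3 \<or> i = 4 \<or> i = 5"
  by auto

lemma zr_simps:
  "zr 0 k = sig k" "zr 1 k = \<alpha> * sig k" "zr (Suc 0) k = \<alpha> * sig k" "zr 2 k = \<alpha>\<^sup>2 * sig k"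
  "zr 3 k = - cnj (sig k)" "zr 4 k = - cnj (\<alpha> * sig k)" "zr 5 k = - cnj (\<alpha>\<^sup>2 * sig k)"
  by (simp_all add: zr_def)

text \<open>Conjugation interchanges \<alpha> and \<alpha>^2, hence the exponents 0, 2, 1 in the
  reflected half of the list.\<close>

lemma zr_rot:
  assumes "i < 6"
  shows "zr i k = \<alpha> ^ ([0,1,2,0,2,1] ! i) * (if i < 3 then sig k else - cnj (sig k))"
  using less6_cases[OF assms]
  by (elim disjE) (simp_all only: zr_simps cnj_alpha_mult, simp_all)

lemma Delta_zeros_zr: "Delta_zeros = insert 0 {zr i k | i k. i < 6}"
proof -
  have "\<exists>l k. l < 6 \<and> \<alpha> ^ i * v = zr l k" if v: "i < 3" "v \<in> zero_base" for i v
  proof -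
    have i: "i = 0 \<or> i = 1 \<or> i = 2" using v by auto
    obtain k where "v = sig k \<or> v = - cnj (sig k)" using v(2) by (auto simp: zero_base_def)
    then show ?thesis
    proof
      assume "v = sig k" then show ?thesis using v by (intro exI[of _ i] exI[of _ k]) (simp add: zr_def)
    next
      assume "v = - cnj (sig k)"
      then have "\<alpha> ^ i * v = zr (if i = 0 then 3 else if i = 1 then 5 else 4) k"
        using i by (elim disjE) (simp_all add: zr_rot)
      then show ?thesis by (intro exI[of _ "if i = 0 then 3 else if i = 1 then 5 else 4"] exI[of _ k]) simp
    qed
  qed
  moreover have "\<exists>i v. zr l k = \<alpha> ^ i * v \<and> i < 3 \<and> v \<in> zero_base" if "l < 6" for l k
  proof -
    have "[0,1,2,0,2,1] ! l < (3::nat)" using less6_cases[OF that] by (elim disjE) auto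
    moreover have "(if l < 3 then sig k else - cnj (sig k)) \<in> zero_base" by (auto simp: zero_base_def)
    ultimately show ?thesis using zr_rot[OF that] by blast
  qed
  ultimately show ?thesis unfolding Delta_zeros_eq by fastforce
qed

lemma norm_zr: "cmod (zr i k) = cmod (sig k)"
  by (simp add: zr_def norm_mult norm_power)

text \<open>The real parts advance by 2 pi up to errors of 2/3, and the imaginary parts stay between
  0 and 25/18. Strictness makes the six zeros \<open>zr i k\<close> with equal k a full level set of
  the modulus.\<close>

lemma norm_sig_mono: "k < l \<Longrightarrow> cmod (sig k) < cmod (sig l)"
proof -
  assume "k < l"
  then have "real k + 1 \<le> real l" by simp
  then have "2 * pi * (real k + 1) \<le> 2 * pi * real l" by (intro mult_left_mono) auto
  then have "2 * pi * real k + 6 \<le> 2 * pi * real l" using pi_ge_3 by (simp add: algebra_simps)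
  moreover have "cmod (sig k) \<le> \<bar>Re (sig k)\<bar> + \<bar>Im (sig k)\<bar>" by (rule cmod_le)
  moreover have "0 \<le> Im (sig k)" "Im (sig k) \<le> 25/18" "0 \<le> Re (sig k)"
    using zero_base_bounds[of "sig k"] sig_strip[of k] by (auto simp: zero_base_def strip_def)
  moreover have "Re (sig l) \<le> cmod (sig l)" by (rule complex_Re_le_cmod)
  ultimately show ?thesis using Re_sig[of k] Re_sig[of l] by linarith
qed

lemma zr_inj:
  assumes "i < 6" "j < 6" "zr i k = zr j l"
  shows "i = j \<and> k = l"
proof -
  have kl: "k = l" using norm_zr[of i k] norm_zr[of j l] assms(3) norm_sig_mono[of k l] norm_sig_mono[of l k]
    by (cases k l rule: linorder_cases) auto
  let ?r = "\<lambda>i. [0,1,2,0,2,1] ! i :: nat" and ?v = "\<lambda>i. if i < (3::nat) then sig k else - cnj (sig k)"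
  have "?v i \<in> zero_base" for i by (auto simp: zero_base_def)
  moreover have r: "?r i < 3" if "i < 6" for i using less6_cases[OF that] by (elim disjE) auto
  moreover have "\<alpha> ^ ?r i * ?v i = \<alpha> ^ ?r j * ?v j" using assms zr_rot kl by metis
  ultimately have "?r i = ?r j \<and> ?v i = ?v j"
    using alpha_rot_dist[of "?v i" "?v j" "?r i" "?r j"] assms by (metis diff_self norm_zero not_one_less_zero)
  moreover have "sig k \<noteq> - cnj (sig k)"
    using zero_base_bounds[of "sig k"] by (auto simp: zero_base_def complex_eq_iff)
  ultimately have "?r i = ?r j \<and> (i < 3 \<longleftrightarrow> j < 3)" by (metis (full_types))
  then have "i = j" using less6_cases[OF assms(1)] less6_cases[OF assms(2)] by (elim disjE) auto
  with kl show ?thesis by simp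
qed

text \<open>Decides the branch of \<open>F\<close>: families 2 and 5 are the ones integrated with
  \<open>phi_minus\<close>.\<close>

lemma Im_zr: "i < 6 \<Longrightarrow> Im (zr i k) < 0 \<longleftrightarrow> i = 2 \<or> i = 5"
proof -
  assume "i < 6"
  have v: "sig k \<in> zero_base" by (simp add: zero_base_def)
  note b = zero_base_bounds[OF v]
  have "13/3 \<le> Re (sig k)" using sig_strip[of k] by (auto simp: strip_def)
  then have "1732/1000 * (13/3) \<le> sqrt 3 * Re (sig k)" using sqrt3_bounds by (intro mult_mono) auto
  then have *: "7 \<le> sqrt 3 * Re (sig k)" by simp
  have "Im (- cnj z) = Im z" for z by simp
  then show ?thesis
    using less6_cases[OF \<open>i < 6\<close>] * b
    by (elim disjE) (simp_all only: zr_simps Im_alpha_mult Im_alpha_sq_mult, auto)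
qed

section \<open>The transform and its remainder functional\<close>

definition hat :: "complex \<Rightarrow> (real \<Rightarrow> complex) \<Rightarrow> complex" where
  "hat m f = integral {0..1} (\<lambda>x. exp (- \<i> * m * of_real x) * f x)"

text \<open>The integral of f against \<open>phi_plus\<close> is this quantity divided by 2 pi Delta
  z; it is entire in z for continuous f. The analogue for \<open>phi_minus\<close> is
  \<open>Nminus\<close>. Their difference is \<open>Delta z * hat z f\<close>, so both agree at
  every zero of \<open>Delta\<close>.\<close>

definition Nplus :: "complex \<Rightarrow> (real \<Rightarrow> complex) \<Rightarrow> complex" where
  "Nplus z f = hat z f * (eP z + 2 * \<alpha> * inverse (eP (\<alpha> * z)) + 2 * \<alpha>\<^sup>2 * inverse (eP (\<alpha>\<^sup>2 * z)))
     + hat (\<alpha> * z) f * (\<alpha> * eP (\<alpha> * z) - 2 * \<alpha> * inverse (eP z))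
     + hat (\<alpha>\<^sup>2 * z) f * (\<alpha>\<^sup>2 * eP (\<alpha>\<^sup>2 * z) - 2 * \<alpha>\<^sup>2 * inverse (eP z))"

definition Nminus :: "complex \<Rightarrow> (real \<Rightarrow> complex) \<Rightarrow> complex" where
  "Nminus z f = - inverse (eP z) *
     (hat z f * (2 + \<alpha>\<^sup>2 * inverse (eP (\<alpha> * z)) + \<alpha> * inverse (eP (\<alpha>\<^sup>2 * z)))
     + hat (\<alpha> * z) f * (\<alpha> * (2 - inverse (eP (\<alpha>\<^sup>2 * z))))
     + hat (\<alpha>\<^sup>2 * z) f * (\<alpha>\<^sup>2 * (2 - inverse (eP (\<alpha> * z)))))"

lemma integrable_exp_times:
  assumes "continuous_on {0..1} f"
  shows "(\<lambda>x. exp (- \<i> * m * of_real x) * f x) integrable_on {0..1}"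
  by (intro integrable_continuous_real continuous_intros assms)

lemma integral_hat_comb:
  assumes "continuous_on {0..1} f"
  shows "integral {0..1} (\<lambda>x. k * (exp (- \<i> * m0 * of_real x) * c0 + exp (- \<i> * m1 * of_real x) * c1
      + exp (- \<i> * m2 * of_real x) * c2) * f x) = k * (hat m0 f * c0 + hat m1 f * c1 + hat m2 f * c2)"
proof -
  have "((\<lambda>x. k * (exp (- \<i> * m0 * of_real x) * f x * c0 + exp (- \<i> * m1 * of_real x) * f x * c1
      + exp (- \<i> * m2 * of_real x) * f x * c2)) has_integral k * (hat m0 f * c0 + hat m1 f * c1 + hat m2 f * c2)) {0..1}"
    unfolding hat_def
    by (intro has_integral_mult_right has_integral_add has_integral_mult_left integrable_integral
        integrable_exp_times assms)
  then show ?thesis by (intro integral_unique) (simp add: algebra_simps)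
qed

lemma integral_phi_plus:
  assumes "continuous_on {0..1} f"
  shows "integral {0..1} (\<lambda>x. phi_plus x z * f x) = Nplus z f / (2 * of_real pi * Delta z)"
proof -
  have e: "exp (- \<i> * c * z) = inverse (eP (c * z))" "exp (\<i> * c * z) = eP (c * z)" for c
    by (simp_all add: eP_def exp_minus mult.assoc)
  show ?thesis
    using integral_hat_comb[OF assms, of "1 / (2 * of_real pi * Delta z)" z _ "\<alpha> * z" _ "\<alpha>\<^sup>2 * z"]
    unfolding phi_plus_def e Nplus_def eP_minus eP_def[of z, symmetric] by (simp add: mult.assoc)
qed

lemma integral_phi_minus:
  assumes "continuous_on {0..1} f"
  shows "integral {0..1} (\<lambda>x. phi_minus x z * f x) = Nminus z f / (2 * of_real pi * Delta z)"
proof -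
  have e: "exp (- \<i> * c * z) = inverse (eP (c * z))" for c
    by (simp_all add: eP_def exp_minus mult.assoc)
  have "integral {0..1} (\<lambda>x. phi_minus x z * f x) =
    integral {0..1} (\<lambda>x. (- inverse (eP z) / (2 * of_real pi * Delta z)) * (exp (- \<i> * z * of_real x) *
       (2 + \<alpha>\<^sup>2 * inverse (eP (\<alpha> * z)) + \<alpha> * inverse (eP (\<alpha>\<^sup>2 * z)))
     + exp (- \<i> * (\<alpha> * z) * of_real x) * (\<alpha> * (2 - inverse (eP (\<alpha>\<^sup>2 * z))))
     + exp (- \<i> * (\<alpha>\<^sup>2 * z) * of_real x) * (\<alpha>\<^sup>2 * (2 - inverse (eP (\<alpha> * z))))) * f x)"
    unfolding phi_minus_def e eP_minus by (simp add: mult_ac)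
  then show ?thesis
    unfolding integral_hat_comb[OF assms] Nminus_def by simp
qed

lemma path_image_Gam: "path_image (Gam \<sigma>) = sphere \<sigma> (1/2)"
  by (simp add: Gam_def path_image_circlepath)

lemma Delta_neq_0_near:
  assumes "\<sigma> \<in> Delta_zeros" "z \<in> cball \<sigma> 1" "z \<noteq> \<sigma>"
  shows "Delta z \<noteq> 0"
  using Delta_zeros_separated[of \<sigma> z] assms by (auto simp: Delta_zeros_def dist_norm)

lemma Delta_neq_0_Gam: "\<sigma> \<in> Delta_zeros \<Longrightarrow> z \<in> path_image (Gam \<sigma>) \<Longrightarrow> Delta z \<noteq> 0"
  by (rule Delta_neq_0_near[of \<sigma>]) (auto simp: path_image_Gam dist_norm)

lemma Gam_disjoint:
  assumes "\<sigma> \<in> Delta_zeros" "\<tau> \<in> Delta_zeros" "z \<in> path_image (Gam \<sigma>)" "z \<in> path_image (Gam \<tau>)"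
  shows "\<sigma> = \<tau>"
proof (rule ccontr)
  assume "\<sigma> \<noteq> \<tau>"
  then have "1 < dist \<sigma> \<tau>" using Delta_zeros_separated assms by (simp add: dist_norm)
  moreover have "dist \<sigma> \<tau> \<le> dist \<sigma> z + dist \<tau> z" by (rule dist_triangle2)
  ultimately show False using assms by (simp add: path_image_Gam)
qed

lemma F_Gam:
  assumes "\<sigma> \<in> Delta_zeros" "z \<in> path_image (Gam \<sigma>)" "continuous_on {0..1} f"
  shows "F z f = (if 0 \<le> Im \<sigma> then Nplus z f else Nminus z f) / (2 * of_real pi * Delta z)"
proof -
  have "(\<exists>\<sigma>\<in>Delta_zeros. 0 \<le> Im \<sigma> \<and> z \<in> path_image (Gam \<sigma>)) \<longleftrightarrow> 0 \<le> Im \<sigma>"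
    using Gam_disjoint assms by blast
  then show ?thesis by (simp add: F_def integral_phi_plus integral_phi_minus assms)
qed

text \<open>Holds for every z, on the contour or not: where \<open>Delta\<close> vanishes, division
  by zero makes the kernel 0. Linearity and continuity of \<open>F z\<close> thus follow without
  locating z.\<close>

lemma F_kernel: "\<exists>K. continuous_on {0..1} K \<and> (\<forall>f. F z f = integral {0..1} (\<lambda>x. K x * f x))"
proof (cases "\<exists>\<sigma>\<in>Delta_zeros. 0 \<le> Im \<sigma> \<and> z \<in> path_image (Gam \<sigma>)")
  case True
  have "continuous_on {0..1} (\<lambda>x. phi_plus x z)" unfolding phi_plus_def by (intro continuous_intros)
  then show ?thesis using True by (intro exI[of _ "\<lambda>x. phi_plus x z"]) (auto simp: F_def)
next
  case False
  have "continuous_on {0..1} (\<lambda>x. phi_minus x z)" unfolding phi_minus_def by (intro continuous_intros)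
  then show ?thesis using False by (intro exI[of _ "\<lambda>x. phi_minus x z"]) (auto simp: F_def)
qed

lemma smooth01_cont0: "f \<in> smooth01 \<Longrightarrow> continuous_on {0..1} f"
  using smooth01_cont[of f 0] by simp

lemma F_lincomb:
  assumes "f \<in> smooth01" "g \<in> smooth01"
  shows "F z (\<lambda>x. a * f x + b * g x) = a * F z f + b * F z g"
proof -
  obtain K where K: "continuous_on {0..1} K" "\<And>f. F z f = integral {0..1} (\<lambda>x. K x * f x)"
    using F_kernel[of z] by blast
  have "((\<lambda>x. a * (K x * f x) + b * (K x * g x)) has_integral a * F z f + b * F z g) {0..1}"
    unfolding K(2) using assms
    by (intro has_integral_add has_integral_mult_right integrable_integral integrable_continuous_real
       continuous_on_mult K(1) smooth01_cont0)
  then show ?thesis unfolding K(2)[of "\<lambda>x. a * f x + b * g x"]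
    by (intro integral_unique) (simp add: algebra_simps)
qed

lemma F_bound: "\<exists>B\<ge>0. \<forall>f\<in>smooth01. cmod (F z f) \<le> B * seminorm01 0 f"
proof -
  obtain K where K: "continuous_on {0..1} K" "\<And>f. F z f = integral {0..1} (\<lambda>x. K x * f x)"
    using F_kernel[of z] by blast
  have "bounded (K ` {0..1})" by (intro compact_imp_bounded compact_continuous_image K) simp
  then obtain B where B: "\<And>x. x \<in> {0..1} \<Longrightarrow> cmod (K x) \<le> B" unfolding bounded_iff by blast
  have B0: "0 \<le> B" using order_trans[OF norm_ge_zero B[of 0]] by simp
  have "cmod (F z f) \<le> B * seminorm01 0 f" if f: "f \<in> smooth01" for f
  proof -
    have "cmod (integral {0..1} (\<lambda>x. K x * f x)) \<le> (B * seminorm01 0 f) * (1 - 0)"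
      by (rule integral_bound)
       (use B0 B seminorm01_upper[OF f, of _ 0] in
        \<open>auto intro!: continuous_on_mult K(1) smooth01_cont0[OF f] mult_mono simp: norm_mult\<close>)
    then show ?thesis by (simp add: K(2))
  qed
  with B0 show ?thesis by blast
qed

lemma F_dual: "F z \<in> topological_dual smooth01_topology"
proof -
  obtain B where "\<forall>f\<in>smooth01. cmod (F z f) \<le> B * seminorm01 0 f" using F_bound by blast
  then show ?thesis
    using F_lincomb[of _ _ z 1 1] F_lincomb[of _ _ z _ 0]
    by (intro topological_dual_smooth01I[of _ B 0]) auto
qed

lemma S_op_eq: "S_op f = (\<lambda>x. \<i> * (deriv01 ^^ 3) f x)"
  by (simp add: S_op_def power3_eq_cube)

lemma S_op_smooth: "f \<in> smooth01 \<Longrightarrow> S_op f \<in> smooth01"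
  unfolding S_op_eq by (intro smooth01_cmult(2) smooth01_deriv)

lemma S_op_lincomb:
  assumes "f \<in> smooth01" "g \<in> smooth01"
  shows "S_op (\<lambda>x. a * f x + b * g x) = (\<lambda>x. a * S_op f x + b * S_op g x)"
  by (simp add: S_op_eq smooth01_lincomb[OF assms] algebra_simps del: funpow.simps)

lemma F_S_dual: "(\<lambda>f. F z (S_op f)) \<in> topological_dual smooth01_topology"
proof -
  obtain B where B: "0 \<le> B" "\<forall>f\<in>smooth01. cmod (F z f) \<le> B * seminorm01 0 f" using F_bound by blast
  have "cmod (F z (S_op f)) \<le> B * seminorm01 3 f" if f: "f \<in> smooth01" for f
  proof -
    have "cmod (F z (S_op f)) \<le> B * seminorm01 0 (S_op f)" using B S_op_smooth[OF f] by blast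
    also have "seminorm01 0 (S_op f) \<le> seminorm01 3 f"
      by (rule seminorm01_le) (auto simp: S_op_eq norm_mult intro!: seminorm01_upper[OF f] simp del: funpow.simps)
    finally show ?thesis using B by (simp add: mult_left_mono)
  qed
  moreover have "F z (S_op (\<lambda>x. a * f x + b * g x)) = a * F z (S_op f) + b * F z (S_op g)"
    if "f \<in> smooth01" "g \<in> smooth01" for f g a b
    by (simp add: S_op_lincomb F_lincomb S_op_smooth that)
  from this[where a=1 and b=1] this[where b=0]
  have "f \<in> smooth01 \<Longrightarrow> g \<in> smooth01 \<Longrightarrow> F z (S_op (\<lambda>x. f x + g x)) = F z (S_op f) + F z (S_op g)"
    "f \<in> smooth01 \<Longrightarrow> F z (S_op (\<lambda>x. c * f x)) = c * F z (S_op f)" for f g c by simp_all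
  ultimately show ?thesis by (intro topological_dual_smooth01I[of _ B 3])
qed

text \<open>Three integrations by parts at once, through the antiderivative \<open>W\<close>. The
  terms with f vanish at both ends and f'(0) = 2 f'(1) merges those with f', so only f'(1), f''(0)
  and f''(1) remain.\<close>

lemma hat_S_op:
  assumes "f \<in> smooth01" "f 0 = 0" "f 1 = 0" "deriv01 f 0 = 2 * deriv01 f 1"
  shows "hat m (S_op f) = m ^ 3 * hat m f
     + (\<i> * (inverse (eP m) * (deriv01 ^^ 2) f 1 - (deriv01 ^^ 2) f 0) - m * deriv01 f 1 * (inverse (eP m) - 2))"
proof -
  define f1 f2 f3 where "f1 = deriv01 f" and "f2 = (deriv01 ^^ 2) f" and "f3 = (deriv01 ^^ 3) f"
  have d: "(f has_vector_derivative f1 x) (at x within {0..1})"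
     "(f1 has_vector_derivative f2 x) (at x within {0..1})"
     "(f2 has_vector_derivative f3 x) (at x within {0..1})" if "x \<in> {0..1}" for x
    using smooth01_has_deriv[OF assms(1) that, of 0] smooth01_has_deriv[OF assms(1) that, of 1]
      smooth01_has_deriv[OF assms(1) that, of 2] by (simp_all add: f1_def f2_def f3_def numeral_eq_Suc)
  define e where "e x = exp (- \<i> * m * of_real x)" for x
  have e: "(e has_vector_derivative - \<i> * m * e x) (at x within {0..1})" for x
    unfolding e_def by (rule has_vector_derivative_real_field) (auto intro!: derivative_eq_intros)
  define W where "W x = \<i> * (e x * f2 x) - m * (e x * f1 x) - \<i> * m\<^sup>2 * (e x * f x)" for x
  have "((\<lambda>x. e x * S_op f x - m ^ 3 * (e x * f x)) has_integral W 1 - W 0) {0..1}"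
  proof (rule fundamental_theorem_of_calculus)
    fix x :: real assume x: "x \<in> {0..1}"
    have "(W has_vector_derivative \<i> * (e x * f3 x + (- \<i> * m * e x) * f2 x) - m * (e x * f2 x + (- \<i> * m * e x) * f1 x)
       - \<i> * m\<^sup>2 * (e x * f1 x + (- \<i> * m * e x) * f x)) (at x within {0..1})"
      unfolding W_def
      by (intro has_vector_derivative_diff has_vector_derivative_mult_right has_vector_derivative_mult d x e)
    moreover have "\<i> * (e x * f3 x + (- \<i> * m * e x) * f2 x) - m * (e x * f2 x + (- \<i> * m * e x) * f1 x)
       - \<i> * m\<^sup>2 * (e x * f1 x + (- \<i> * m * e x) * f x) = e x * S_op f x - m ^ 3 * (e x * f x)"
      by (simp add: S_op_eq f3_def algebra_simps power2_eq_square power3_eq_cube)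
    ultimately show "(W has_vector_derivative e x * S_op f x - m ^ 3 * (e x * f x)) (at x within {0..1})" by simp
  qed simp
  moreover have "((\<lambda>x. e x * S_op f x - m ^ 3 * (e x * f x)) has_integral hat m (S_op f) - m ^ 3 * hat m f) {0..1}"
    unfolding hat_def e_def
    by (intro has_integral_diff has_integral_mult_right integrable_integral integrable_exp_times smooth01_cont0
        S_op_smooth assms)
  ultimately have "hat m (S_op f) - m ^ 3 * hat m f = W 1 - W 0" using has_integral_unique by blast
  moreover have "e 0 = 1" "e 1 = inverse (eP m)" by (simp_all add: e_def eP_def exp_minus)
  ultimately show ?thesis using assms by (simp add: W_def f1_def f2_def algebra_simps)
qed

text \<open>With E A B = 1 all six exponentials are polynomials in E, A and B, so identities between
  \<open>Delta\<close> and the numerators become ideal membership problems for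
  \<open>algebra\<close>.\<close>

lemma eP_relations:
  fixes z :: complex
  defines "E \<equiv> inverse (eP z)" and "A \<equiv> inverse (eP (\<alpha> * z))" and "B \<equiv> inverse (eP (\<alpha>\<^sup>2 * z))"
  shows "E * A * B = 1" "eP z = A * B" "eP (\<alpha> * z) = E * B" "eP (\<alpha>\<^sup>2 * z) = E * A"
proof -
  have 1: "eP z * eP (\<alpha> * z) * eP (\<alpha>\<^sup>2 * z) = 1" by (rule eP_prod)
  show "E * A * B = 1" using arg_cong[OF 1, of inverse] by (simp add: E_def A_def B_def)
  show "eP z = A * B" "eP (\<alpha> * z) = E * B" "eP (\<alpha>\<^sup>2 * z) = E * A"
    using 1 by (simp_all add: E_def A_def B_def field_simps)
qed

text \<open>The three transforms share the factor (\<alpha>^j z)^3 = z^3. The coefficient of f''(1)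
  is a multiple of 1 + \<alpha> + \<alpha>^2 = 0; the boundary values that stay carry the factor
  \<open>Delta\<close>, which cancels the denominator of \<open>F\<close>.\<close>

lemma Nplus_S_op:
  assumes "f \<in> smooth01" "f 0 = 0" "f 1 = 0" "deriv01 f 0 = 2 * deriv01 f 1"
  shows "Nplus z (S_op f) = z ^ 3 * Nplus z f + Delta z * (2 * z * deriv01 f 1 - \<i> * (deriv01 ^^ 2) f 0)"
proof -
  define E A B where "E = inverse (eP z)" and "A = inverse (eP (\<alpha> * z))" and "B = inverse (eP (\<alpha>\<^sup>2 * z))"
  define a u v w where "a = \<alpha>" and "u = hat z f" and "v = hat (\<alpha> * z) f" and "w = hat (\<alpha>\<^sup>2 * z) f"
  define g where "g = (deriv01 ^^ 2) f"
  note rel = eP_relations[of z, folded E_def A_def B_def]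
  have a: "a\<^sup>2 + a + 1 = 0" using alpha_sq_sum by (simp add: a_def)
  have z3: "(\<alpha> * z) ^ 3 = z ^ 3" "(\<alpha>\<^sup>2 * z) ^ 3 = z ^ 3"
  proof -
    have "(\<alpha>\<^sup>2) ^ 3 = (\<alpha> ^ 3) ^ 2" by (simp flip: power_mult)
    then show "(\<alpha> * z) ^ 3 = z ^ 3" "(\<alpha>\<^sup>2 * z) ^ 3 = z ^ 3" by (simp_all add: power_mult_distrib alpha_cube)
  qed
  show ?thesis
    unfolding Nplus_def hat_S_op[OF assms] Delta_eP z3 E_def[symmetric] A_def[symmetric] B_def[symmetric]
    unfolding rel(2-4) u_def[symmetric] v_def[symmetric] w_def[symmetric] g_def[symmetric]
    unfolding a_def[symmetric]
    using rel(1) a by algebra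
qed

text \<open>The same cancellation, with f''(0) dropping out in place of f''(1).\<close>

lemma Nminus_S_op:
  assumes "f \<in> smooth01" "f 0 = 0" "f 1 = 0" "deriv01 f 0 = 2 * deriv01 f 1"
  shows "Nminus z (S_op f) = z ^ 3 * Nminus z f
     + Delta z * (inverse (eP z) * (z * deriv01 f 1 - \<i> * (deriv01 ^^ 2) f 1))"
proof -
  define E A B where "E = inverse (eP z)" and "A = inverse (eP (\<alpha> * z))" and "B = inverse (eP (\<alpha>\<^sup>2 * z))"
  define a u v w where "a = \<alpha>" and "u = hat z f" and "v = hat (\<alpha> * z) f" and "w = hat (\<alpha>\<^sup>2 * z) f"
  define g where "g = (deriv01 ^^ 2) f"
  note rel = eP_relations[of z, folded E_def A_def B_def]
  have a: "a\<^sup>2 + a + 1 = 0" using alpha_sq_sum by (simp add: a_def)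
  have z3: "(\<alpha> * z) ^ 3 = z ^ 3" "(\<alpha>\<^sup>2 * z) ^ 3 = z ^ 3"
  proof -
    have "(\<alpha>\<^sup>2) ^ 3 = (\<alpha> ^ 3) ^ 2" by (simp flip: power_mult)
    then show "(\<alpha> * z) ^ 3 = z ^ 3" "(\<alpha>\<^sup>2 * z) ^ 3 = z ^ 3" by (simp_all add: power_mult_distrib alpha_cube)
  qed
  show ?thesis
    unfolding Nminus_def hat_S_op[OF assms] Delta_eP z3 E_def[symmetric] A_def[symmetric] B_def[symmetric]
    unfolding rel(2-4) u_def[symmetric] v_def[symmetric] w_def[symmetric] g_def[symmetric]
    unfolding a_def[symmetric]
    using rel(1) a by algebra
qed

definition Rem :: "complex \<Rightarrow> (real \<Rightarrow> complex) \<Rightarrow> complex" where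
  "Rem z f = F z (S_op f) - z ^ 3 * F z f"

lemma Rem_dual: "Rem z \<in> topological_dual smooth01_topology"
  using topological_dual_lincomb[OF F_S_dual F_dual, of z "- (z ^ 3)" z] by (simp add: Rem_def[abs_def])

lemma Rem_Gam:
  assumes "\<sigma> \<in> Delta_zeros" "z \<in> path_image (Gam \<sigma>)" "f \<in> Phi_space"
  shows "Rem z f = (if 0 \<le> Im \<sigma> then 2 * z * deriv01 f 1 - \<i> * (deriv01 ^^ 2) f 0
    else inverse (eP z) * (z * deriv01 f 1 - \<i> * (deriv01 ^^ 2) f 1)) / (2 * of_real pi)"
proof -
  have f: "f \<in> smooth01" "f 0 = 0" "f 1 = 0" "deriv01 f 0 = 2 * deriv01 f 1"
    using assms(3) by (auto simp: Phi_space_def)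
  have "Delta z \<noteq> 0" using Delta_neq_0_Gam assms by blast
  then show ?thesis
    unfolding Rem_def F_Gam[OF assms(1,2) smooth01_cont0[OF S_op_smooth[OF f(1)]]]
      F_Gam[OF assms(1,2) smooth01_cont0[OF f(1)]] Nplus_S_op[OF f] Nminus_S_op[OF f]
    by (simp add: field_simps)
qed

lemma contour_integral_Rem:
  assumes "\<sigma> \<in> Delta_zeros" "f \<in> Phi_space"
  shows "((\<lambda>z. exp (\<i> * z * of_real x) * Rem z f) has_contour_integral 0) (Gam \<sigma>)"
proof -
  let ?r = "\<lambda>z. exp (\<i> * z * of_real x) * ((if 0 \<le> Im \<sigma> then 2 * z * deriv01 f 1 - \<i> * (deriv01 ^^ 2) f 0
    else inverse (eP z) * (z * deriv01 f 1 - \<i> * (deriv01 ^^ 2) f 1)) / (2 * of_real pi))"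
  have "?r holomorphic_on UNIV"
    by (cases "0 \<le> Im \<sigma>") (auto simp: eP_def intro!: holomorphic_intros)
  then have "(?r has_contour_integral 0) (Gam \<sigma>)"
    by (intro Cauchy_theorem_convex_simple[of _ UNIV]) (auto simp: Gam_def)
  then show ?thesis
    by (rule has_contour_integral_eq) (use Rem_Gam[OF assms(1) _ assms(2)] in auto)
qed

section \<open>Entire dependence on the spectral parameter, and elimination\<close>

lemma hat_holomorphic:
  assumes "continuous_on {0..1} f"
  shows "(\<lambda>m. hat m f) holomorphic_on UNIV"
proof -
  have "(\<lambda>m. integral (cbox 0 1) (\<lambda>x. exp (- \<i> * m * of_real x) * f x)) holomorphic_on UNIV"
  proof (rule leibniz_rule_holomorphic[where fx = "\<lambda>m x. - \<i> * of_real x * exp (- \<i> * m * of_real x) * f x"])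
    show "((\<lambda>m. exp (- \<i> * m * of_real t) * f t) has_field_derivative
        - \<i> * of_real t * exp (- \<i> * m * of_real t) * f t) (at m within UNIV)" for m t
      by (auto intro!: derivative_eq_intros)
    show "(\<lambda>t. exp (- \<i> * m * of_real t) * f t) integrable_on cbox 0 1" for m
      using integrable_exp_times[OF assms] by simp
    have "continuous_on (UNIV \<times> cbox 0 1) (\<lambda>p::complex \<times> real. f (snd p))"
      by (rule continuous_on_compose2[OF assms continuous_on_snd]) (auto intro!: continuous_intros)
    then show "continuous_on (UNIV \<times> cbox 0 1) (\<lambda>(m::complex, t::real). - \<i> * of_real t * exp (- \<i> * m * of_real t) * f t)"
      unfolding case_prod_unfold by (intro continuous_intros)
  qed simp
  then show ?thesis by (simp add: hat_def)
qed

lemma hat_holomorphic_comp [holomorphic_intros]: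
  assumes "continuous_on {0..1} f" "g holomorphic_on A"
  shows "(\<lambda>z. hat (g z) f) holomorphic_on A"
  using holomorphic_on_compose_gen[OF assms(2) hat_holomorphic[OF assms(1)]] by (simp add: o_def)

lemma eP_holomorphic [holomorphic_intros]: "g holomorphic_on A \<Longrightarrow> (\<lambda>z. eP (g z)) holomorphic_on A"
  unfolding eP_def by (intro holomorphic_intros)

lemma Delta_holomorphic: "Delta holomorphic_on A"
  unfolding Delta_def[abs_def] by (intro holomorphic_intros)

lemma Nplus_holomorphic: "continuous_on {0..1} f \<Longrightarrow> (\<lambda>z. Nplus z f) holomorphic_on A"
  unfolding Nplus_def by (intro holomorphic_intros) auto

lemma Nminus_holomorphic: "continuous_on {0..1} f \<Longrightarrow> (\<lambda>z. Nminus z f) holomorphic_on A"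
  unfolding Nminus_def by (intro holomorphic_intros) auto

text \<open>The three equations \<open>Nplus (\<alpha>^j z) f = 0\<close> are linear in the values \<open>eP (\<alpha>^j z) * hat (\<alpha>^j z) f\<close>; eliminating
  leaves \<^const>\<open>Delta\<close> times a difference of two of them.\<close>

lemma Nplus_zero_imp_rotation:
  assumes N: "\<And>z. Nplus z f = 0" and "Delta z \<noteq> 0"
  shows "eP (\<alpha> * z) * hat (\<alpha> * z) f = eP z * hat z f"
proof -
  define E A B where "E = inverse (eP z)" and "A = inverse (eP (\<alpha> * z))" and "B = inverse (eP (\<alpha>\<^sup>2 * z))"
  define a u v w where "a = \<alpha>" and "u = hat z f" and "v = hat (\<alpha> * z) f" and "w = hat (\<alpha>\<^sup>2 * z) f"
  note rel = eP_relations[of z, folded E_def A_def B_def]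
  have a: "a\<^sup>2 + a + 1 = 0" using alpha_sq_sum by (simp add: a_def)
  have N0: "u * (A * B + 2 * a * A + 2 * a\<^sup>2 * B) + v * (a * (E * B) - 2 * a * E) + w * (a\<^sup>2 * (E * A) - 2 * a\<^sup>2 * E) = 0"
    using N[of z] unfolding Nplus_def E_def[symmetric] A_def[symmetric] B_def[symmetric]
    unfolding rel(2-4)
    by (simp add: a_def u_def v_def w_def)
  have N1: "v * (E * B + 2 * a * B + 2 * a\<^sup>2 * E) + w * (a * (E * A) - 2 * a * A) + u * (a\<^sup>2 * (A * B) - 2 * a\<^sup>2 * A) = 0"
    using N[of "\<alpha> * z"] unfolding Nplus_def alpha_mult E_def[symmetric] A_def[symmetric] B_def[symmetric]
    unfolding rel(2-4)
    by (simp add: a_def u_def v_def w_def)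
  have N2: "w * (E * A + 2 * a * E + 2 * a\<^sup>2 * A) + u * (a * (A * B) - 2 * a * B) + v * (a\<^sup>2 * (E * B) - 2 * a\<^sup>2 * B) = 0"
    using N[of "\<alpha>\<^sup>2 * z"] unfolding Nplus_def alpha_mult E_def[symmetric] A_def[symmetric] B_def[symmetric]
    unfolding rel(2-4)
    by (simp add: a_def u_def v_def w_def)
  define D where "D = A * B + a * (E * B) + a\<^sup>2 * (E * A) + 2 * (E + a * A + a\<^sup>2 * B)"
  have D: "D = Delta z"
    unfolding D_def Delta_eP E_def[symmetric] A_def[symmetric] B_def[symmetric] unfolding rel(2-4) by (simp add: a_def)
  define H0 H1 H2 where "H0 = A * B * u" and "H1 = E * B * v" and "H2 = E * A * w"
  have uvw: "u = E * H0" "v = A * H1" "w = B * H2"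
    using rel(1) by (auto simp: H0_def H1_def H2_def algebra_simps)
  \<comment> \<open>M0 is N0 in the new unknowns, and N0 - a N1 is a multiple of M1. As 1 + a + a^2
    = 0, both involve only the differences H0 - H1 and H0 - H2, and the determinant of this 2 by 2
    system is D.\<close>
  have M0: "H0 + a * H1 + a\<^sup>2 * H2 + 2 * a * (E * A) * (H0 - H1) + 2 * a\<^sup>2 * (E * B) * (H0 - H2) = 0"
    using N0 rel(1) unfolding uvw by algebra
  have M1: "E * A * (H0 - H1) + A * B * (H1 - H2) + E * B * (H2 - H0) = 0"
    using N0 N1 rel(1) a unfolding uvw by algebra
  have "D * (H0 - H1) = 0"
    using M0 M1 rel(1) a unfolding D_def by algebra
  then have "H1 = H0" using assms(2) D by simp
  then show ?thesis unfolding H0_def H1_def u_def v_def rel(2,3) by simp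
qed

section \<open>Completeness\<close>

text \<open>For a polynomial p within e of g, vanishing moments make the integral of g^2 equal to
  that of (g - p) g, which is at most e times the integral of |g|.\<close>

lemma real_moments_zero_imp_zero:
  fixes g :: "real \<Rightarrow> real"
  assumes g: "continuous_on {0..1} g" and m: "\<And>n. ((\<lambda>x. x ^ n * g x) has_integral 0) {0..1}"
    and x: "x \<in> {0..1}"
  shows "g x = 0"
proof -
  have gg: "continuous_on {0..1} (\<lambda>x. g x * g x)" by (intro continuous_on_mult g)
  have int: "(\<lambda>x. \<bar>g x\<bar>) integrable_on {0..1}"
    by (intro integrable_continuous_real continuous_on_rabs g)
  define I where "I = integral {0..1} (\<lambda>x. \<bar>g x\<bar>)"
  have I0: "0 \<le> I" unfolding I_def by (rule integral_nonneg[OF int]) simp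
  have small: "integral {0..1} (\<lambda>x. g x * g x) \<le> e * I" if e: "0 < e" for e
  proof -
    obtain p where p: "real_polynomial_function p" "\<And>x. x \<in> {0..1} \<Longrightarrow> \<bar>g x - p x\<bar> < e"
      using Stone_Weierstrass_real_polynomial_function[OF compact_Icc g e] by metis
    obtain a n where pa: "p = (\<lambda>x. \<Sum>i\<le>n. a i * x ^ i)" using p(1) real_polynomial_function_iff_sum by blast
    have "((\<lambda>x. \<Sum>i\<le>n. a i * (x ^ i * g x)) has_integral (\<Sum>i\<le>n. a i * 0)) {0..1}"
      by (intro has_integral_sum has_integral_mult_right m) simp
    then have pg: "((\<lambda>x. p x * g x) has_integral 0) {0..1}"
      by (simp add: pa sum_distrib_right mult.assoc)
    have l: "((\<lambda>x. g x * g x - p x * g x) has_integral integral {0..1} (\<lambda>x. g x * g x) - 0) {0..1}"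
      by (intro has_integral_diff pg integrable_integral integrable_continuous_real gg)
    have r: "((\<lambda>x. e * \<bar>g x\<bar>) has_integral e * I) {0..1}"
      unfolding I_def by (intro has_integral_mult_right integrable_integral int)
    have "g x * g x - p x * g x \<le> e * \<bar>g x\<bar>" if "x \<in> {0..1}" for x
    proof -
      have "g x * g x - p x * g x = (g x - p x) * g x" by (simp add: algebra_simps)
      also have "\<dots> \<le> \<bar>g x - p x\<bar> * \<bar>g x\<bar>" by (metis abs_ge_self abs_mult)
      also have "\<dots> \<le> e * \<bar>g x\<bar>" using p(2)[OF that] by (intro mult_right_mono) auto
      finally show ?thesis .
    qed
    then show ?thesis using has_integral_le[OF l r] by simp
  qed
  have "integral {0..1} (\<lambda>x. g x * g x) \<le> 0"
  proof (rule ccontr)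
    define J where "J = integral {0..1} (\<lambda>x. g x * g x)"
    assume "\<not> integral {0..1} (\<lambda>x. g x * g x) \<le> 0"
    then have J: "0 < J" by (simp add: J_def)
    have I1: "0 < I + 1" using I0 by simp
    \<comment> \<open>This choice of e pushes the bound down to J/2; adding 1 to I allows for I =
      0.\<close>
    have "J \<le> J / (2 * (I + 1)) * I" using small[of "J / (2 * (I + 1))"] J I1 by (simp add: J_def)
    also have "\<dots> \<le> J / (2 * (I + 1)) * (I + 1)" using J I0 by (intro mult_left_mono) auto
    also have "\<dots> = J / 2" using I1 by (simp add: field_simps)
    finally show False using J by simp
  qed
  moreover have "0 \<le> integral {0..1} (\<lambda>x. g x * g x)"
    by (rule integral_nonneg[OF integrable_continuous_real[OF gg]]) simp
  ultimately have "integral {0..1} (\<lambda>x. g x * g x) = 0" by simp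
  then show ?thesis using integral_eq_0_iff[OF gg] x by simp
qed

lemma moments_zero_imp_zero:
  fixes f :: "real \<Rightarrow> complex"
  assumes f: "continuous_on {0..1} f" and m: "\<And>n. integral {0..1} (\<lambda>x. of_real x ^ n * f x) = 0"
    and x: "x \<in> {0..1}"
  shows "f x = 0"
proof -
  have i: "((\<lambda>x. of_real x ^ n * f x) has_integral 0) {0..1}" for n
  proof -
    have "(\<lambda>x. of_real x ^ n * f x) integrable_on {0..1}"
      by (intro integrable_continuous_real continuous_intros f)
    then show ?thesis unfolding m[of n, symmetric] by (rule integrable_integral)
  qed
  have "Re (f x) = 0"
    using has_integral_linear[OF i bounded_linear_Re]
    by (intro real_moments_zero_imp_zero[OF _ _ x] continuous_on_Re f) (simp add: o_def flip: of_real_power)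
  moreover have "Im (f x) = 0"
    using has_integral_linear[OF i bounded_linear_Im]
    by (intro real_moments_zero_imp_zero[OF _ _ x] continuous_on_Im f) (simp add: o_def flip: of_real_power)
  ultimately show ?thesis by (simp add: complex_eq_iff)
qed

lemma hat_has_derivative:
  assumes "continuous_on {0..1} f"
  shows "((\<lambda>m. hat m f) has_field_derivative - \<i> * hat m (\<lambda>x. of_real x * f x)) (at m)"
proof -
  have "((\<lambda>m. integral (cbox 0 1) (\<lambda>x. exp (- \<i> * m * of_real x) * f x)) has_field_derivative
     integral (cbox 0 1) (\<lambda>x. - \<i> * of_real x * exp (- \<i> * m * of_real x) * f x)) (at m within UNIV)"
  proof (rule leibniz_rule_field_derivative)
    show "((\<lambda>m. exp (- \<i> * m * of_real t) * f t) has_field_derivative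
        - \<i> * of_real t * exp (- \<i> * m * of_real t) * f t) (at m within UNIV)" for m t
      by (auto intro!: derivative_eq_intros)
    show "(\<lambda>t. exp (- \<i> * m * of_real t) * f t) integrable_on cbox 0 1" for m
      using integrable_exp_times[OF assms] by simp
    have "continuous_on (UNIV \<times> cbox 0 1) (\<lambda>p::complex \<times> real. f (snd p))"
      by (rule continuous_on_compose2[OF assms continuous_on_snd]) (auto intro!: continuous_intros)
    then show "continuous_on (UNIV \<times> cbox 0 1) (\<lambda>(m::complex, t::real). - \<i> * of_real t * exp (- \<i> * m * of_real t) * f t)"
      unfolding case_prod_unfold by (intro continuous_intros)
  qed auto
  moreover have "integral (cbox 0 1) (\<lambda>x. - \<i> * of_real x * exp (- \<i> * m * of_real x) * f x) = - \<i> * hat m (\<lambda>x. of_real x * f x)"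
    unfolding hat_def by (subst integral_mult_right[symmetric]) (simp add: mult_ac)
  ultimately show ?thesis by (simp add: hat_def)
qed

text \<open>Differentiation in m multiplies f by x, so the transforms of all x^n f vanish; at m = 0
  they are the moments.\<close>

lemma hat_zero_imp_zero:
  assumes f: "continuous_on {0..1} f" and z: "\<And>m. hat m f = 0" and x: "x \<in> {0..1}"
  shows "f x = 0"
proof (rule moments_zero_imp_zero[OF f _ x])
  fix n
  have c: "continuous_on {0..1} (\<lambda>x. of_real x ^ n * f x)" for n
    by (intro continuous_intros f)
  have "hat m (\<lambda>x. of_real x ^ n * f x) = 0" for m
  proof (induction n arbitrary: m)
    case (Suc n)
    have "((\<lambda>m. 0) has_field_derivative - \<i> * hat m (\<lambda>x. of_real x * (of_real x ^ n * f x))) (at m)"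
      using hat_has_derivative[OF c, of n m] unfolding Suc .
    then have "- \<i> * hat m (\<lambda>x. of_real x * (of_real x ^ n * f x)) = 0"
      using DERIV_unique DERIV_const by blast
    then show ?case by (simp add: mult.assoc)
  qed (simp add: z)
  from this[of 0] show "integral {0..1} (\<lambda>x. of_real x ^ n * f x) = 0" by (simp add: hat_def)
qed

text \<open>If \<open>hat m f\<close> is a multiple of \<open>exp (- \<i> * m)\<close>, its derivative shows that the transform of \<open>(1 - x) * f x\<close> vanishes.\<close>

lemma eP_hat_constant_imp_zero:
  assumes f: "continuous_on {0..1} f" and c: "\<And>m. eP m * hat m f = c" and x: "x \<in> {0..<1}"
  shows "f x = 0"
proof -
  have h: "hat m f = c * inverse (eP m)" for m using c[of m] by (simp add: field_simps)
  have "hat m (\<lambda>x. (1 - of_real x) * f x) = 0" for m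
  proof -
    have "((\<lambda>m. c * eP (- m)) has_field_derivative c * (\<i> * (- 1) * eP (- m))) (at m)"
      by (intro DERIV_cmult has_field_derivative_eP) (auto intro!: derivative_eq_intros)
    moreover have "(\<lambda>m. c * eP (- m)) = (\<lambda>m. hat m f)" by (simp add: h eP_def exp_minus)
    ultimately have "((\<lambda>m. hat m f) has_field_derivative - \<i> * hat m f) (at m)"
      by (simp add: h eP_def exp_minus mult_ac)
    then have "hat m (\<lambda>x. of_real x * f x) = hat m f"
      using DERIV_unique[OF _ hat_has_derivative[OF f, of m], of "- \<i> * hat m f"] by simp
    moreover have "((\<lambda>x. exp (- \<i> * m * of_real x) * f x - exp (- \<i> * m * of_real x) * (of_real x * f x)) has_integral
       hat m f - hat m (\<lambda>x. of_real x * f x)) {0..1}"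
      unfolding hat_def by (intro has_integral_diff integrable_integral integrable_exp_times continuous_intros f)
    ultimately show ?thesis unfolding hat_def by (intro integral_unique) (simp add: algebra_simps)
  qed
  then have "(1 - of_real x) * f x = 0"
    using x by (intro hat_zero_imp_zero[where f = "\<lambda>x. (1 - of_real x) * f x"] continuous_intros f) auto
  moreover have "1 - complex_of_real x \<noteq> 0" using x by (simp add: complex_eq_iff)
  ultimately show ?thesis by simp
qed

text \<open>The exponential under the integral becomes e^(iz(1 - x)), of modulus at most 1 in the
  closed upper half-plane.\<close>

lemma eP_hat_bound:
  assumes f: "continuous_on {0..1} f" and B: "\<And>x. x \<in> {0..1} \<Longrightarrow> cmod (f x) \<le> B" and z: "0 \<le> Im z"
  shows "cmod (eP z * hat z f) \<le> B"
proof -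
  have B0: "0 \<le> B" using order_trans[OF norm_ge_zero B[of 0]] by simp
  have "eP z * hat z f = integral {0..1} (\<lambda>x. eP z * (exp (- \<i> * z * of_real x) * f x))"
    unfolding hat_def by (rule integral_mult_right[symmetric])
  also have "cmod \<dots> \<le> B * (1 - 0)"
  proof (rule integral_bound)
    show "continuous_on {0..1} (\<lambda>x. eP z * (exp (- \<i> * z * of_real x) * f x))" by (intro continuous_intros f)
    fix x :: real assume x: "x \<in> {0..1}"
    have "cmod (eP z * (exp (- \<i> * z * of_real x) * f x)) = exp (- (Im z * (1 - x))) * cmod (f x)"
      by (simp add: norm_mult norm_eP algebra_simps flip: exp_add)
    also have "\<dots> \<le> 1 * B" using x z B[OF x] B0 by (intro mult_mono) auto
    finally show "cmod (eP z * (exp (- \<i> * z * of_real x) * f x)) \<le> B" by simp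
  qed simp
  finally show ?thesis by simp
qed

text \<open>Identity theorem: the circle is connected and not a single point, so 1/2 is a limit
  point of it.\<close>

lemma holomorphic_zero_on_circle:
  assumes "f holomorphic_on UNIV" "\<And>z. z \<in> sphere (0::complex) (1/2) \<Longrightarrow> f z = 0"
  shows "f z = 0"
proof (rule analytic_continuation[OF assms(1), of "sphere 0 (1/2)" "1/2"])
  have "(1/2::complex) \<in> sphere 0 (1/2)" "(-1/2::complex) \<in> sphere 0 (1/2)" by simp_all
  then show "(1/2::complex) islimpt sphere 0 (1/2)"
  proof (intro connected_imp_perfect connected_sphere)
    fix x :: complex
    assume h: "(1/2::complex) \<in> sphere 0 (1/2)" "(-1/2::complex) \<in> sphere 0 (1/2)"
    show "sphere (0::complex) (1/2) \<noteq> {x}"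
    proof
      assume "sphere (0::complex) (1/2) = {x}"
      then have "1/2 = x" "-1/2 = x" using h by (simp_all only: singleton_iff)
      then have "(1/2::complex) = -1/2" by simp
      then show False by (simp add: complex_eq_iff)
    qed
  qed simp_all
qed (use assms in auto)

lemma complete_family_F: "complete_family Phi_space gamma_contour F"
  unfolding complete_family_def
proof (intro ballI impI)
  fix f assume f: "f \<in> Phi_space" and z: "\<forall>z\<in>gamma_contour. F z f = 0"
  have fs: "f \<in> smooth01" using f by (simp add: Phi_space_def)
  have cont: "continuous_on {0..1} f" by (rule smooth01_cont0[OF fs])
  have 0: "0 \<in> Delta_zeros" by (simp add: Delta_zeros_def Delta_0)
  have Gam0: "sphere 0 (1/2) \<subseteq> gamma_contour"
    using 0 by (auto simp: gamma_contour_def path_image_Gam intro!: bexI[of _ 0])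
  have D0: "Delta z \<noteq> 0" if "z \<in> sphere 0 (1/2)" for z
    using Delta_neq_0_Gam[OF 0, of z] that by (simp add: path_image_Gam)
  have N: "Nplus z f = 0" for z
  proof (rule holomorphic_zero_on_circle[OF Nplus_holomorphic[OF cont]])
    fix z :: complex assume zs: "z \<in> sphere 0 (1/2)"
    have "F z f = 0" using z Gam0 zs by blast
    then show "Nplus z f = 0"
      using F_Gam[OF 0 _ cont, of z] zs D0[OF zs] by (simp add: path_image_Gam)
  qed
  \<comment> \<open>Elimination gives this where \<open>Delta\<close> is nonzero, in particular on
    the circle around 0; the identity theorem extends it to the plane.\<close>
  have rot: "eP (\<alpha> * z) * hat (\<alpha> * z) f = eP z * hat z f" for z
  proof -
    have "eP (\<alpha> * z) * hat (\<alpha> * z) f - eP z * hat z f = 0"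
      by (rule holomorphic_zero_on_circle[of "\<lambda>z. eP (\<alpha> * z) * hat (\<alpha> * z) f - eP z * hat z f"])
        (auto intro!: holomorphic_intros cont simp: Nplus_zero_imp_rotation[OF N D0])
    then show ?thesis by simp
  qed
  define B where "B = seminorm01 0 f"
  have B: "cmod (f x) \<le> B" if "x \<in> {0..1}" for x using seminorm01_upper[OF fs that, of 0] by (simp add: B_def)
  have bound: "cmod (eP z * hat z f) \<le> B" for z
  proof -
    \<comment> \<open>Hence one of the three rotations lies in the closed upper half-plane, and the
      invariance carries its bound over to z.\<close>
    have "Im z + Im (\<alpha> * z) + Im (\<alpha>\<^sup>2 * z) = 0"
      unfolding Im_alpha_mult Im_alpha_sq_mult by (simp add: field_simps)
    then consider "0 \<le> Im z" | "0 \<le> Im (\<alpha> * z)" | "0 \<le> Im (\<alpha>\<^sup>2 * z)" by linarith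
    then show ?thesis
    proof cases
      case 1 then show ?thesis using eP_hat_bound[OF cont B, of z] by simp
    next
      case 2 then show ?thesis using eP_hat_bound[OF cont B, of "\<alpha> * z"] rot by simp
    next
      case 3 then show ?thesis using eP_hat_bound[OF cont B, of "\<alpha>\<^sup>2 * z"] rot[of "\<alpha> * z"] rot[of z] by (simp add: alpha_mult)
    qed
  qed
  have "eP z * hat z f = eP 0 * hat 0 f" for z
  proof -
    have "(\<lambda>z. eP z * hat z f) holomorphic_on UNIV" by (intro holomorphic_intros cont)
    from Liouville_polynomial[OF this, of 0 B 0 z] bound show ?thesis by simp
  qed
  then have "f x = 0" if "x \<in> {0..<1}" for x using eP_hat_constant_imp_zero[OF cont _ that] by blast
  \<comment> \<open>The transform of (1 - x) f gives no information at x = 1; the boundary condition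
    does.\<close>
  moreover have "f 1 = 0" using f by (simp add: Phi_space_def)
  moreover have "f x = 0" if "x \<notin> {0..1}" for x using fs that by (simp add: smooth01_def)
  moreover have "x \<in> {0..<1} \<or> x = 1 \<or> x \<notin> {0..1}" for x :: real by auto
  ultimately have "f x = 0" for x by metis
  then show "f = (\<lambda>x. 0)" by blast
qed

section \<open>Residues\<close>

definition dDelta :: "complex \<Rightarrow> complex" where
  "dDelta z = \<i> * (eP z + \<alpha>\<^sup>2 * eP (\<alpha> * z) + \<alpha> * eP (\<alpha>\<^sup>2 * z))
     - 2 * \<i> * (inverse (eP z) + \<alpha>\<^sup>2 * inverse (eP (\<alpha> * z)) + \<alpha> * inverse (eP (\<alpha>\<^sup>2 * z)))"

lemma DERIV_inverse_eP:
  "((\<lambda>z. inverse (eP (c * z))) has_field_derivative - \<i> * c * inverse (eP (c * z))) (at z within A)"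
proof -
  have inv: "inverse (eP w) = eP (- w)" for w by (simp add: eP_def exp_minus)
  show ?thesis
    unfolding inv by (rule DERIV_cong[OF has_field_derivative_eP]) (auto intro!: derivative_eq_intros)
qed

lemma DERIV_eP_cmult:
  "((\<lambda>z. eP (c * z)) has_field_derivative \<i> * c * eP (c * z)) (at z within A)"
  by (rule DERIV_cong[OF has_field_derivative_eP]) (auto intro!: derivative_eq_intros)

lemma Delta_has_derivative: "(Delta has_field_derivative dDelta z) (at z)"
proof -
  have gen: "i * 1 * p + a * (i * a * q) + a\<^sup>2 * (i * a\<^sup>2 * s) + 2 * (- i * 1 * p' + a * (- i * a * q') + a\<^sup>2 * (- i * a\<^sup>2 * s'))
      = i * (p + a\<^sup>2 * q + a * s) - 2 * i * (p' + a\<^sup>2 * q' + a * s')"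
    if "a\<^sup>2 + a + 1 = 0" for a i p q s p' q' s' :: complex
    using that by algebra
  have eq: "\<i> * 1 * eP (1 * z) + \<alpha> * (\<i> * \<alpha> * eP (\<alpha> * z)) + \<alpha>\<^sup>2 * (\<i> * \<alpha>\<^sup>2 * eP (\<alpha>\<^sup>2 * z))
     + 2 * (- \<i> * 1 * inverse (eP (1 * z)) + \<alpha> * (- \<i> * \<alpha> * inverse (eP (\<alpha> * z)))
      + \<alpha>\<^sup>2 * (- \<i> * \<alpha>\<^sup>2 * inverse (eP (\<alpha>\<^sup>2 * z)))) = dDelta z"
    unfolding dDelta_def mult_1[of z] by (rule gen) (simp add: alpha_sq_sum)
  have "((\<lambda>z. eP (1 * z) + \<alpha> * eP (\<alpha> * z) + \<alpha>\<^sup>2 * eP (\<alpha>\<^sup>2 * z)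
     + 2 * (inverse (eP (1 * z)) + \<alpha> * inverse (eP (\<alpha> * z)) + \<alpha>\<^sup>2 * inverse (eP (\<alpha>\<^sup>2 * z)))) has_field_derivative dDelta z) (at z)"
    unfolding eq[symmetric] by (intro DERIV_add DERIV_cmult DERIV_eP_cmult DERIV_inverse_eP)
  moreover have "(\<lambda>z. eP (1 * z) + \<alpha> * eP (\<alpha> * z) + \<alpha>\<^sup>2 * eP (\<alpha>\<^sup>2 * z)
     + 2 * (inverse (eP (1 * z)) + \<alpha> * inverse (eP (\<alpha> * z)) + \<alpha>\<^sup>2 * inverse (eP (\<alpha>\<^sup>2 * z)))) = Delta"
    by (auto simp: Delta_eP)
  ultimately show ?thesis by simp
qed

lemma dDelta_alpha: "dDelta (\<alpha> * z) = \<alpha> * dDelta z"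
proof -
  have gen: "i * (q + a\<^sup>2 * s + a * p) - 2 * i * (q' + a\<^sup>2 * s' + a * p')
      = a * (i * (p + a\<^sup>2 * q + a * s) - 2 * i * (p' + a\<^sup>2 * q' + a * s'))"
    if "a\<^sup>2 + a + 1 = 0" for a i p q s p' q' s' :: complex
    using that by algebra
  show ?thesis unfolding dDelta_def alpha_mult by (rule gen) (simp add: alpha_sq_sum)
qed

lemma dDelta_mcnj: "dDelta (- cnj z) = - cnj (dDelta z)"
proof -
  have "cnj (\<alpha>\<^sup>2) = \<alpha>" using cnj_alpha_mult(2)[of 1] by simp
  then show ?thesis
    unfolding dDelta_def eP_mcnj eP_alpha_mcnj
    by (simp add: cnj_alpha algebra_simps del: complex_cnj_power)
qed

text \<open>At a zero the derivative of the prefactor in \<open>Delta_eps\<close> drops out. The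
  remaining factor is 2 i \<alpha>^2 eP(sig k) + eps', where the zero condition gives the first
  summand modulus |1 + eps| >= 3/4, and |eps'| <= 1/2. In particular these zeros are simple.\<close>

lemma norm_dDelta_sig: "cmod (eP (\<alpha>\<^sup>2 * sig k)) / 4 \<le> cmod (dDelta (sig k))"
proof -
  let ?\<sigma> = "sig k"
  obtain e' where e': "(eps has_field_derivative e') (at ?\<sigma>)" "cmod e' \<le> 1/2"
    using eps_deriv_strip[OF sig_strip] by blast
  have z0: "1 + 2 * \<alpha>\<^sup>2 * eP ?\<sigma> + eps ?\<sigma> = 0"
    using sig(2)[of k] unfolding Delta_eps by simp
  have "((\<lambda>z. \<alpha>\<^sup>2 * eP (\<alpha>\<^sup>2 * z) * (1 + 2 * \<alpha>\<^sup>2 * eP (1 * z) + eps z)) has_field_derivative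
      (\<alpha>\<^sup>2 * (\<i> * \<alpha>\<^sup>2 * eP (\<alpha>\<^sup>2 * ?\<sigma>))) * (1 + 2 * \<alpha>\<^sup>2 * eP (1 * ?\<sigma>) + eps ?\<sigma>)
      + (0 + 2 * \<alpha>\<^sup>2 * (\<i> * 1 * eP (1 * ?\<sigma>)) + e') * (\<alpha>\<^sup>2 * eP (\<alpha>\<^sup>2 * ?\<sigma>))) (at ?\<sigma>)"
    by (intro DERIV_mult DERIV_cmult DERIV_add DERIV_const DERIV_eP_cmult e')
  then have "(Delta has_field_derivative (2 * \<alpha>\<^sup>2 * (\<i> * eP ?\<sigma>) + e') * (\<alpha>\<^sup>2 * eP (\<alpha>\<^sup>2 * ?\<sigma>))) (at ?\<sigma>)"
    using z0 by (simp add: Delta_eps[abs_def])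
  then have d: "dDelta ?\<sigma> = (2 * \<alpha>\<^sup>2 * (\<i> * eP ?\<sigma>) + e') * (\<alpha>\<^sup>2 * eP (\<alpha>\<^sup>2 * ?\<sigma>))"
    using Delta_has_derivative DERIV_unique by blast
  have "2 * \<alpha>\<^sup>2 * eP ?\<sigma> = - (1 + eps ?\<sigma>)" using z0 by algebra
  then have "2 * \<alpha>\<^sup>2 * (\<i> * eP ?\<sigma>) = - \<i> * (1 + eps ?\<sigma>)" by algebra
  then have "cmod (2 * \<alpha>\<^sup>2 * (\<i> * eP ?\<sigma>)) = cmod (1 + eps ?\<sigma>)" by (simp only: norm_mult) simp
  moreover have "3/4 \<le> cmod (1 + eps ?\<sigma>)"
    using norm_eps_strip(2)[OF sig_strip[of k]] norm_triangle_ineq2[of 1 "- eps ?\<sigma>"] by simp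
  ultimately have "1/4 \<le> cmod (2 * \<alpha>\<^sup>2 * (\<i> * eP ?\<sigma>) + e')"
    using norm_triangle_ineq2[of "2 * \<alpha>\<^sup>2 * (\<i> * eP ?\<sigma>)" "- e'"] e'(2) by simp
  then have "1/4 * cmod (eP (\<alpha>\<^sup>2 * ?\<sigma>)) \<le> cmod (2 * \<alpha>\<^sup>2 * (\<i> * eP ?\<sigma>) + e') * cmod (eP (\<alpha>\<^sup>2 * ?\<sigma>))"
    by (intro mult_right_mono) auto
  then show ?thesis unfolding d by (simp add: norm_mult norm_power)
qed

lemma dDelta_sig_neq_0: "dDelta (sig k) \<noteq> 0"
proof -
  have "0 < cmod (eP (\<alpha>\<^sup>2 * sig k)) / 4" by simp
  also have "\<dots> \<le> cmod (dDelta (sig k))" by (rule norm_dDelta_sig)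
  finally show ?thesis by simp
qed

lemma dDelta_zr: "i < 6 \<Longrightarrow> cmod (dDelta (zr i k)) = cmod (dDelta (sig k))"
proof -
  assume "i < 6"
  have "dDelta (\<alpha>\<^sup>2 * z) = \<alpha> * (\<alpha> * dDelta z)" for z
    by (simp only: alpha_mult(1)[symmetric] dDelta_alpha)
  then show ?thesis
    using less6_cases[OF \<open>i < 6\<close>]
    by (elim disjE) (simp_all only: zr_simps dDelta_mcnj dDelta_alpha norm_minus_cancel complex_mod_cnj norm_mult norm_alpha mult_1)
qed

text \<open>The centre selects the branch, z is the point of evaluation: with the centre fixed this
  is entire in z, whereas \<open>F\<close> changes branch with z.\<close>

definition Nsel :: "complex \<Rightarrow> complex \<Rightarrow> (real \<Rightarrow> complex) \<Rightarrow> complex" where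
  "Nsel \<sigma> z g = (if 0 \<le> Im \<sigma> then Nplus z g else Nminus z g)"

text \<open>2 pi i times the residue at a simple zero; the 2 pi cancels against the normalisation of
  \<open>F\<close>.\<close>

definition res_term :: "real \<Rightarrow> (real \<Rightarrow> complex) \<Rightarrow> complex \<Rightarrow> complex" where
  "res_term x g \<sigma> = \<i> * exp (\<i> * \<sigma> * of_real x) * Nsel \<sigma> \<sigma> g / dDelta \<sigma>"

lemma Nsel_holomorphic: "continuous_on {0..1} g \<Longrightarrow> (\<lambda>z. Nsel \<sigma> z g) holomorphic_on A"
  by (cases "0 \<le> Im \<sigma>") (simp_all add: Nsel_def Nplus_holomorphic Nminus_holomorphic)

text \<open>On the circle the integrand agrees with h / Delta, which is holomorphic in the unit disc
  around the zero except at its centre. Integrability is stated apart from the residue formula so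
  that it covers the double zero 0.\<close>

lemma contour_integral_F:
  assumes "\<sigma> \<in> Delta_zeros" "continuous_on {0..1} g"
  shows "(\<lambda>z. exp (\<i> * z * of_real x) * F z g) contour_integrable_on Gam \<sigma>"
    and "dDelta \<sigma> \<noteq> 0 \<Longrightarrow> contour_integral (Gam \<sigma>) (\<lambda>z. exp (\<i> * z * of_real x) * F z g) = res_term x g \<sigma>"
proof -
  define h where "h z = exp (\<i> * z * of_real x) * Nsel \<sigma> z g / (2 * of_real pi)" for z
  have hol: "h holomorphic_on A" for A
    unfolding h_def by (intro holomorphic_intros Nsel_holomorphic assms) auto
  let ?f = "\<lambda>z. h z / Delta z"
  have "Delta z \<noteq> 0" if "z \<in> ball \<sigma> 1 - {\<sigma>}" for z
    using Delta_neq_0_near[OF assms(1), of z] that by auto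
  then have fhol: "?f holomorphic_on ball \<sigma> 1 - {\<sigma>}"
    by (intro holomorphic_on_divide hol Delta_holomorphic)
  from fhol have "(?f has_contour_integral 2 * pi * \<i> * residue ?f \<sigma>) (circlepath \<sigma> (1/2))"
    by (intro base_residue[of "ball \<sigma> 1"]) auto
  then have I: "((\<lambda>z. exp (\<i> * z * of_real x) * F z g) has_contour_integral 2 * pi * \<i> * residue ?f \<sigma>) (Gam \<sigma>)"
    unfolding Gam_def[symmetric]
    by (rule has_contour_integral_eq) (simp add: F_Gam[OF assms(1) _ assms(2)] h_def Nsel_def)
  then show "(\<lambda>z. exp (\<i> * z * of_real x) * F z g) contour_integrable_on Gam \<sigma>"
    by (auto simp: contour_integrable_on_def)
  assume d: "dDelta \<sigma> \<noteq> 0"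
  have D0: "Delta \<sigma> = 0" using assms(1) by (simp add: Delta_zeros_def)
  have "residue ?f \<sigma> = h \<sigma> / dDelta \<sigma>"
  proof (rule residue_simple'[of "ball \<sigma> 1"])
    have "(h \<longlongrightarrow> h \<sigma>) (at \<sigma>)"
      using holomorphic_on_imp_continuous_on[OF hol[of UNIV]] by (simp add: continuous_on_def)
    moreover have "((\<lambda>z. Delta z / (z - \<sigma>)) \<longlongrightarrow> dDelta \<sigma>) (at \<sigma>)"
      using Delta_has_derivative[of \<sigma>] D0 by (simp add: has_field_derivative_iff)
    ultimately have "((\<lambda>z. h z / (Delta z / (z - \<sigma>))) \<longlongrightarrow> h \<sigma> / dDelta \<sigma>) (at \<sigma>)"
      using d by (rule tendsto_divide)
    then show "((\<lambda>z. h z / Delta z * (z - \<sigma>)) \<longlongrightarrow> h \<sigma> / dDelta \<sigma>) (at \<sigma>)" by simp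
  qed (use fhol in auto)
  then show "contour_integral (Gam \<sigma>) (\<lambda>z. exp (\<i> * z * of_real x) * F z g) = res_term x g \<sigma>"
    using contour_integral_unique[OF I] by (simp add: res_term_def h_def)
qed

section \<open>Asymptotics along the zeros near the real axis\<close>

text \<open>A limit with rate \<open>O(1/k)\<close>: after the factor \<open>1 / sig k\<close> is split off, this is the precision at which
  errors in the residues become absolutely summable.\<close>

definition near :: "(nat \<Rightarrow> complex) \<Rightarrow> complex \<Rightarrow> bool" where
  "near p l \<longleftrightarrow> (\<exists>C. \<forall>k. cmod (p k - l) \<le> C / (real k + 1))"

lemma nearI: "(\<And>k. cmod (p k - l) \<le> C / (real k + 1)) \<Longrightarrow> near p l"
  unfolding near_def by blast

lemma nearE:
  assumes "near p l"
  obtains C where "0 \<le> C" "\<And>k. cmod (p k - l) \<le> C / (real k + 1)"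
proof -
  obtain C where C: "\<And>k. cmod (p k - l) \<le> C / (real k + 1)" using assms unfolding near_def by blast
  have "0 \<le> C" using order_trans[OF norm_ge_zero C[of 0]] by simp
  with C that show thesis by blast
qed

lemma near_const: "near (\<lambda>k. c) c"
  by (rule nearI[of _ _ 0]) simp

lemma near_add:
  assumes "near p l" "near q m" shows "near (\<lambda>k. p k + q k) (l + m)"
proof -
  obtain C where C: "\<And>k. cmod (p k - l) \<le> C / (real k + 1)" using nearE[OF assms(1)] by blast
  obtain D where D: "\<And>k. cmod (q k - m) \<le> D / (real k + 1)" using nearE[OF assms(2)] by blast
  show ?thesis
  proof (rule nearI)
    fix k
    have "cmod (p k + q k - (l + m)) \<le> cmod (p k - l) + cmod (q k - m)"
      using norm_triangle_ineq[of "p k - l" "q k - m"] by (simp add: algebra_simps)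
    also have "\<dots> \<le> (C + D) / (real k + 1)" using C[of k] D[of k] by (simp add: add_divide_distrib)
    finally show "cmod (p k + q k - (l + m)) \<le> (C + D) / (real k + 1)" .
  qed
qed

lemma near_bounded:
  assumes "near p l" obtains B where "0 \<le> B" "\<And>k. cmod (p k) \<le> B"
proof -
  obtain C where C: "0 \<le> C" "\<And>k. cmod (p k - l) \<le> C / (real k + 1)" using nearE[OF assms] by blast
  have "cmod (p k) \<le> cmod l + C" for k
  proof -
    have "C / (real k + 1) \<le> C" using mult_left_mono[of 1 "real k + 1" C] C(1) by (simp add: divide_le_eq)
    then show ?thesis using C(2)[of k] norm_triangle_ineq[of "p k - l" l] by simp
  qed
  moreover have "0 \<le> cmod l + C" using C by simp
  ultimately show thesis using that by blast
qed

lemma near_mult: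
  assumes "near p l" "near q m" shows "near (\<lambda>k. p k * q k) (l * m)"
proof -
  obtain C where C: "0 \<le> C" "\<And>k. cmod (p k - l) \<le> C / (real k + 1)" using nearE[OF assms(1)] by blast
  obtain D where D: "0 \<le> D" "\<And>k. cmod (q k - m) \<le> D / (real k + 1)" using nearE[OF assms(2)] by blast
  obtain B where B: "0 \<le> B" "\<And>k. cmod (q k) \<le> B" using near_bounded[OF assms(2)] by blast
  show ?thesis
  proof (rule nearI)
    fix k
    have "p k * q k - l * m = (p k - l) * q k + l * (q k - m)" by (simp add: algebra_simps)
    then have "cmod (p k * q k - l * m) \<le> cmod (p k - l) * cmod (q k) + cmod l * cmod (q k - m)"
      by (metis norm_triangle_ineq norm_mult)
    also have "\<dots> \<le> C / (real k + 1) * B + cmod l * (D / (real k + 1))"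
      using B C D by (intro add_mono mult_mono) auto
    also have "\<dots> = (C * B + cmod l * D) / (real k + 1)" by (simp add: add_divide_distrib)
    finally show "cmod (p k * q k - l * m) \<le> (C * B + cmod l * D) / (real k + 1)" .
  qed
qed

lemma near_inverse:
  assumes "near p l" "l \<noteq> 0" "0 < c" "\<And>k. c \<le> cmod (p k)"
  shows "near (\<lambda>k. inverse (p k)) (inverse l)"
proof -
  obtain C where C: "0 \<le> C" "\<And>k. cmod (p k - l) \<le> C / (real k + 1)" using nearE[OF assms(1)] by blast
  show ?thesis
  proof (rule nearI)
    fix k
    have p: "p k \<noteq> 0" using assms(3) assms(4)[of k] by auto
    then have "inverse (p k) - inverse l = (l - p k) * (inverse (p k) * inverse l)"
      using assms(2) by (simp add: field_simps)
    then have "cmod (inverse (p k) - inverse l) = cmod (p k - l) * (inverse (cmod (p k)) * inverse (cmod l))"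
      by (simp add: norm_mult norm_inverse norm_minus_commute)
    also have "\<dots> \<le> C / (real k + 1) * (inverse c * inverse (cmod l))"
      using C assms by (intro mult_mono le_imp_inverse_le) auto
    also have "\<dots> = (C * (inverse c * inverse (cmod l))) / (real k + 1)" by simp
    finally show "cmod (inverse (p k) - inverse l) \<le> (C * (inverse c * inverse (cmod l))) / (real k + 1)" .
  qed
qed

lemma near_cong: "near p l \<Longrightarrow> (\<And>k. p k = q k) \<Longrightarrow> l = m \<Longrightarrow> near q m"
  by (simp add: near_def)

lemma near_cmult: "near p l \<Longrightarrow> near (\<lambda>k. c * p k) (c * l)"
  by (rule near_mult[OF near_const])

lemma near_diff: "near p l \<Longrightarrow> near q m \<Longrightarrow> near (\<lambda>k. p k - q k) (l - m)"
  using near_add[OF _ near_cmult[of q m "-1"]] by simp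

lemmas near_intros = near_const near_add near_diff near_mult

text \<open>Multiplied by \<open>1 - w\<close>, the terms telescope up to an absolutely summable remainder.\<close>

lemma summable_unit_power_over:
  fixes w :: complex
  assumes "cmod w = 1" "w \<noteq> 1"
  shows "summable (\<lambda>k. w ^ k / of_nat (k + 1))"
proof -
  let ?a = "\<lambda>k. 1 / of_nat (k + 1) :: complex"
  have "(\<lambda>k. ?a k) \<longlonglongrightarrow> 0" using lim_inverse_n[THEN LIMSEQ_Suc] by (simp add: inverse_eq_divide)
  then have "(\<lambda>k. w ^ k * ?a k) \<longlonglongrightarrow> 0"
    by (rule Lim_null_comparison[rotated, OF tendsto_norm_zero]) (simp add: assms norm_mult norm_power norm_divide)
  then have tele: "summable (\<lambda>k. w ^ k * ?a k - w ^ Suc k * ?a (Suc k))"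
    by (rule telescope_summable')
  have "summable (\<lambda>k. w ^ Suc k * (?a k - ?a (Suc k)))"
  proof (rule summable_comparison_test')
    have "summable (\<lambda>k. inverse (real k ^ 2))" by (rule inverse_power_summable) simp
    then show "summable (\<lambda>k. inverse (real (Suc k) ^ 2))" by (subst summable_Suc_iff)
    fix k :: nat
    have "?a k - ?a (Suc k) = 1 / (of_nat (k + 1) * of_nat (k + 2))"
      by (simp add: field_simps del: of_nat_add of_nat_Suc) (simp add: algebra_simps)
    then have "cmod (w ^ Suc k * (?a k - ?a (Suc k))) = 1 / (real (k + 1) * real (k + 2))"
      using assms by (simp add: norm_mult norm_power norm_divide del: of_nat_add of_nat_Suc)
    also have "\<dots> \<le> inverse (real (Suc k) ^ 2)"
      by (simp add: power2_eq_square inverse_eq_divide) (intro divide_left_mono mult_left_mono, auto)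
    finally show "norm (w ^ Suc k * (?a k - ?a (Suc k))) \<le> inverse (real (Suc k) ^ 2)" .
  qed
  note s2 = this
  have eq: "w ^ k * a - w ^ Suc k * b - w ^ Suc k * (a - b) = (1 - w) * (w ^ k * a)" for k a b
    by (simp add: algebra_simps)
  have "summable (\<lambda>k. (1 - w) * (w ^ k * ?a k))"
    using summable_diff[OF tele s2] unfolding eq .
  then have "summable (\<lambda>k. inverse (1 - w) * ((1 - w) * (w ^ k * ?a k)))" by (rule summable_mult)
  moreover have "inverse (1 - w) * ((1 - w) * c) = c" for c
    using assms by (simp flip: mult.assoc)
  ultimately show ?thesis by simp
qed

text \<open>The limit l is left to the telescoped series; the deviation p - l is compared with
  1/k^2.\<close>

lemma summable_near:
  assumes "near p l" "cmod w = 1" "w \<noteq> 1"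
  shows "summable (\<lambda>k. w ^ k / of_nat (k + 1) * p k)"
proof -
  obtain C where C: "0 \<le> C" "\<And>k. cmod (p k - l) \<le> C / (real k + 1)" using nearE[OF assms(1)] by blast
  have "summable (\<lambda>k. w ^ k / of_nat (k + 1) * (p k - l))"
  proof (rule summable_comparison_test')
    have "summable (\<lambda>k. inverse (real k ^ 2))" by (rule inverse_power_summable) simp
    then have "summable (\<lambda>k. inverse (real (Suc k) ^ 2))" by (subst summable_Suc_iff)
    then show "summable (\<lambda>k. C * inverse (real (Suc k) ^ 2))" by (rule summable_mult)
    fix k :: nat
    have "norm (w ^ k / of_nat (k + 1) * (p k - l)) = 1 / (real k + 1) * cmod (p k - l)"
      using assms by (simp add: norm_mult norm_divide norm_power del: of_nat_add of_nat_Suc)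
    also have "\<dots> \<le> 1 / (real k + 1) * (C / (real k + 1))" by (intro mult_left_mono C) simp
    also have "\<dots> = C * inverse (real (Suc k) ^ 2)" by (simp add: power2_eq_square field_simps)
    finally show "norm (w ^ k / of_nat (k + 1) * (p k - l)) \<le> C * inverse (real (Suc k) ^ 2)" .
  qed
  from summable_add[OF this summable_mult2[OF summable_unit_power_over[OF assms(2,3)], of l]]
  show ?thesis unfolding distrib_left[symmetric] diff_add_cancel .
qed

section \<open>Limits of the exponentials at the zeros\<close>

lemma sig_decay: "sqrt 3 * Re (sig k) \<ge> 2 * real k + 7" "real k + 1 \<le> cmod (sig k)"
  "cmod (inverse (eP (\<alpha>\<^sup>2 * sig k))) \<le> exp (- real k)"
  "cmod (inverse (eP (\<alpha>\<^sup>2 * sig k))) \<le> 1 / (real k + 1)"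
proof -
  have s: "0 \<le> Im (sig k)" using sig_strip[of k] by (simp add: strip_def)
  have "5 * 3 / 3 \<le> 5 * pi / 3" "2 * 3 * real k \<le> 2 * pi * real k"
    using pi_ge_3 by (auto intro!: mult_right_mono)
  then have R: "6 * real k + 13/3 \<le> Re (sig k)" using Re_sig[of k] by linarith
  have "1732/1000 * (6 * real k + 13/3) \<le> sqrt 3 * Re (sig k)"
    using R sqrt3_bounds by (intro mult_mono) auto
  then show d: "sqrt 3 * Re (sig k) \<ge> 2 * real k + 7" by simp
  show "real k + 1 \<le> cmod (sig k)" using R complex_Re_le_cmod[of "sig k"] by linarith
  show e: "cmod (inverse (eP (\<alpha>\<^sup>2 * sig k))) \<le> exp (- real k)"
    unfolding norm_inv_eP_alpha_sq using d s by simp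
  have "real k + 1 \<le> exp (real k)" using exp_ge_add_one_self[of "real k"] by linarith
  then have "exp (- real k) \<le> 1 / (real k + 1)" by (simp add: exp_minus inverse_eq_divide frac_le)
  with e show "cmod (inverse (eP (\<alpha>\<^sup>2 * sig k))) \<le> 1 / (real k + 1)" by simp
qed

text \<open>Reciprocal of an exponential that dominates at \<open>sig k\<close>; multiplied by it,
  both \<open>dDelta (sig k)\<close> and \<open>sig k * Nplus (sig k) g\<close> converge.\<close>

abbreviation "tk k \<equiv> inverse (eP (\<alpha>\<^sup>2 * sig k))"

lemma near_tk: "near (\<lambda>k. tk k) 0"
  using sig_decay(4) by (intro nearI[of _ _ 1]) simp

lemma near_eP_sig: "near (\<lambda>k. eP (sig k)) (- (\<alpha> / 2))"
proof (rule nearI[of _ _ 5])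
  fix k
  have "eP (sig k) - - (\<alpha> / 2) = - (\<alpha> / 2) * eps (sig k)"
    using sig(2)[of k] by (simp add: Delta_eq_0_iff algebra_simps)
  then have "cmod (eP (sig k) - - (\<alpha> / 2)) = cmod (eps (sig k)) / 2" by (simp only: norm_mult) (simp add: norm_divide)
  also have "\<dots> \<le> 10 * cmod (tk k) / 2" using norm_eps_strip(1)[OF sig_strip] by (intro divide_right_mono) auto
  also have "\<dots> \<le> 5 / (real k + 1)" using sig_decay(4)[of k] by simp
  finally show "cmod (eP (sig k) - - (\<alpha> / 2)) \<le> 5 / (real k + 1)" .
qed

lemma near_inv_eP_sig: "near (\<lambda>k. inverse (eP (sig k))) (inverse (- (\<alpha> / 2)))"
  by (rule near_inverse[OF near_eP_sig, of "1/4"]) (use strip_norms(2)[OF sig_strip] in auto)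

lemma sig_lat: "cmod (sig k - lat k) \<le> 20 / (real k + 1)" "cmod (sig k - lat k) \<le> 2/3"
proof -
  have "newt k (sig k) = sig k" using newt_fixpoint_iff[OF sig(1)] sig(2) by blast
  then have "sig k - lat k = - \<i> * Ln (1 + eps (sig k))" unfolding newt_def by (simp add: algebra_simps)
  then have "cmod (sig k - lat k) = cmod (Ln (1 + eps (sig k)))" by (simp only: norm_mult) simp
  also have "\<dots> \<le> 2 * cmod (eps (sig k))" using norm_eps_strip(2)[OF sig_strip[of k]] by (intro norm_Ln_le) simp
  also have "\<dots> \<le> 2 * (10 * cmod (tk k))" using norm_eps_strip(1)[OF sig_strip] by (intro mult_left_mono) auto
  also have "\<dots> \<le> 20 / (real k + 1)" using sig_decay(4)[of k] by simp
  finally show "cmod (sig k - lat k) \<le> 20 / (real k + 1)" .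
  show "cmod (sig k - lat k) \<le> 2/3" using sig(1)[of k] by (simp add: dist_norm norm_minus_commute)
qed

lemma near_exp_sig:
  assumes "0 \<le> x" "x \<le> 1"
  shows "near (\<lambda>k. exp (\<i> * (sig k - lat k) * of_real x)) 1"
proof (rule nearI)
  fix k
  let ?u = "\<i> * (sig k - lat k) * of_real x"
  have u: "cmod ?u \<le> cmod (sig k - lat k)" using assms by (simp add: norm_mult mult_left_le)
  have "cmod (exp ?u - 1) \<le> exp \<bar>Re ?u\<bar> * cmod ?u" using Taylor_exp[of ?u 0] by simp
  also have "\<dots> \<le> exp 1 * (20 / (real k + 1))"
    using u sig_lat[of k] abs_Re_le_cmod[of ?u] by (intro mult_mono) (auto simp del: times_complex.sel)
  finally show "cmod (exp ?u - 1) \<le> (exp 1 * 20) / (real k + 1)" by simp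
qed

lemma near_inv_sig: "near (\<lambda>k. of_nat (k + 1) / sig k) (1 / (2 * of_real pi))"
proof (rule nearI)
  fix k
  have s: "real k + 1 \<le> cmod (sig k)" by (rule sig_decay)
  then have s0: "sig k \<noteq> 0" by auto
  \<comment> \<open>\<open>lat k\<close> is 2 pi (k + 1) plus the fixed number
    \<open>lat 0 - 2 * of_real pi\<close>.\<close>
  define K where "K = cmod (lat 0 - 2 * of_real pi)"
  have "2 * of_real pi * of_nat (k + 1) - sig k = - (sig k - lat k) - (lat 0 - 2 * of_real pi)"
    by (simp add: lat_def complex_eq_iff algebra_simps)
  then have "cmod (2 * of_real pi * of_nat (k + 1) - sig k) \<le> cmod (sig k - lat k) + K"
    unfolding K_def using norm_triangle_ineq4[of "- (sig k - lat k)"] by (metis norm_minus_cancel)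
  then have n: "cmod (2 * of_real pi * of_nat (k + 1) - sig k) \<le> 1 + K" using sig_lat(2)[of k] by simp
  have "of_nat (k + 1) / sig k - 1 / (2 * of_real pi) = (2 * of_real pi * of_nat (k + 1) - sig k) / (2 * of_real pi * sig k)"
    using s0 by (simp add: field_simps)
  then have "cmod (of_nat (k + 1) / sig k - 1 / (2 * of_real pi)) = cmod (2 * of_real pi * of_nat (k + 1) - sig k) / (2 * pi * cmod (sig k))"
    by (simp add: norm_divide norm_mult)
  also have "\<dots> \<le> (1 + K) / (1 * (real k + 1))"
    using n s pi_ge_3 by (intro frac_le mult_mono) (auto simp: K_def)
  finally show "cmod (of_nat (k + 1) / sig k - 1 / (2 * of_real pi)) \<le> (1 + K) / (real k + 1)" by simp
qed

section \<open>Decay of the transform of a smooth function\<close>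

lemma norm_hat_le:
  assumes "continuous_on {0..1} f" "\<And>x. x \<in> {0..1} \<Longrightarrow> cmod (f x) \<le> B"
  shows "cmod (hat m f) \<le> B * max 1 (cmod (inverse (eP m)))"
proof -
  have B0: "0 \<le> B" using order_trans[OF norm_ge_zero assms(2)[of 0]] by simp
  have "cmod (integral {0..1} (\<lambda>x. exp (- \<i> * m * of_real x) * f x)) \<le> (B * max 1 (cmod (inverse (eP m)))) * (1 - 0)"
  proof (rule integral_bound)
    show "continuous_on {0..1} (\<lambda>x. exp (- \<i> * m * of_real x) * f x)" by (intro continuous_intros assms)
    fix x :: real assume x: "x \<in> {0..1}"
    have "Im m * x \<le> max 0 (Im m)"
      using x by (cases "0 \<le> Im m") (auto simp: mult_left_le mult_nonpos_nonneg)
    then have "exp (Im m * x) \<le> max 1 (exp (Im m))" by (auto simp: max_def split: if_splits)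
    then have "cmod (exp (- \<i> * m * of_real x)) \<le> max 1 (cmod (inverse (eP m)))"
      unfolding norm_inv_eP by simp
    then show "cmod (exp (- \<i> * m * of_real x) * f x) \<le> B * max 1 (cmod (inverse (eP m)))"
      unfolding norm_mult using assms(2)[OF x] B0 by (subst mult.commute) (intro mult_mono, auto)
  qed simp
  then show ?thesis by (simp add: hat_def)
qed

lemma hat_by_parts:
  assumes "g \<in> smooth01"
  shows "m * hat m g = \<i> * (inverse (eP m) * g 1 - g 0) - \<i> * hat m (deriv01 g)"
proof -
  define e where "e x = exp (- \<i> * m * of_real x)" for x
  have e: "(e has_vector_derivative - \<i> * m * e x) (at x within {0..1})" for x
    unfolding e_def by (rule has_vector_derivative_real_field) (auto intro!: derivative_eq_intros)
  have "((\<lambda>x. e x * deriv01 g x - \<i> * m * (e x * g x)) has_integral e 1 * g 1 - e 0 * g 0) {0..1}"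
  proof (rule fundamental_theorem_of_calculus)
    fix x :: real assume x: "x \<in> {0..1}"
    have "((\<lambda>x. e x * g x) has_vector_derivative e x * deriv01 g x + (- \<i> * m * e x) * g x) (at x within {0..1})"
      using smooth01_has_deriv[OF assms x, of 0] by (intro has_vector_derivative_mult e) simp
    then show "((\<lambda>x. e x * g x) has_vector_derivative e x * deriv01 g x - \<i> * m * (e x * g x)) (at x within {0..1})"
      by (simp add: algebra_simps)
  qed simp
  moreover have "((\<lambda>x. e x * deriv01 g x - \<i> * m * (e x * g x)) has_integral hat m (deriv01 g) - \<i> * m * hat m g) {0..1}"
    unfolding hat_def e_def using smooth01_cont[OF assms, of 1] smooth01_cont0[OF assms]
    by (intro has_integral_diff has_integral_mult_right integrable_integral integrable_exp_times) simp_all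
  ultimately have "hat m (deriv01 g) - \<i> * m * hat m g = e 1 * g 1 - e 0 * g 0" using has_integral_unique by blast
  moreover have "e 0 = 1" "e 1 = inverse (eP m)" by (simp_all add: e_def eP_def exp_minus)
  ultimately have "\<i> * m * hat m g = hat m (deriv01 g) - (inverse (eP m) * g 1 - g 0)" by (simp add: algebra_simps)
  then have "- \<i> * (\<i> * m * hat m g) = - \<i> * (hat m (deriv01 g) - (inverse (eP m) * g 1 - g 0))" by (simp only:)
  then show ?thesis by (simp add: algebra_simps)
qed

lemma hat_smooth_bound:
  assumes "g \<in> smooth01"
  shows "cmod (hat m g) \<le> seminorm01 0 g * max 1 (cmod (inverse (eP m)))"
  using norm_hat_le[OF smooth01_cont0[OF assms]] seminorm01_upper[OF assms, of _ 0] by simp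

lemma hat_decay:
  assumes "g \<in> smooth01"
  obtains C where "0 \<le> C" "\<And>m. cmod (m * hat m g) \<le> C * max 1 (cmod (inverse (eP m)))"
proof
  have d: "deriv01 g \<in> smooth01" using smooth01_deriv[OF assms, of 1] by simp
  let ?C = "cmod (g 1) + cmod (g 0) + seminorm01 0 (deriv01 g)"
  show "0 \<le> ?C" using seminorm01_nonneg[OF d, of 0] by simp
  fix m
  let ?M = "max 1 (cmod (inverse (eP m)))"
  have "cmod (m * hat m g) \<le> cmod (inverse (eP m)) * cmod (g 1) + cmod (g 0) + cmod (hat m (deriv01 g))"
    unfolding hat_by_parts[OF assms]
    by (rule order_trans[OF norm_triangle_ineq4]) (auto simp: norm_mult intro!: order_trans[OF norm_triangle_ineq4])
  also have "\<dots> \<le> ?M * cmod (g 1) + ?M * cmod (g 0) + seminorm01 0 (deriv01 g) * ?M"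
  proof (intro add_mono hat_smooth_bound d mult_right_mono)
    show "cmod (g 0) \<le> ?M * cmod (g 0)" using mult_right_mono[of 1 ?M "cmod (g 0)"] by simp
  qed auto
  also have "\<dots> = ?C * ?M" by (simp add: algebra_simps)
  finally show "cmod (m * hat m g) \<le> ?C * ?M" .
qed

text \<open>One integration by parts yields the boundary values in the limit; a second one, inside
  \<open>hat_decay\<close> for the derivative, makes the remaining transform O(1/k). As the
  transform may grow like 1 / eP(m k), the weight u has to control that factor too.\<close>

lemma near_hat:
  assumes g: "g \<in> smooth01" and u: "near u l" and v: "near (\<lambda>k. u k * inverse (eP (m k))) l'"
    and m: "\<And>k. real k + 1 \<le> cmod (m k)"
  shows "near (\<lambda>k. u k * (m k * hat (m k) g)) (\<i> * (l' * g 1 - l * g 0))"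
proof -
  have d: "deriv01 g \<in> smooth01" using smooth01_deriv[OF g, of 1] by simp
  obtain C where C: "0 \<le> C" "\<And>m. cmod (m * hat m (deriv01 g)) \<le> C * max 1 (cmod (inverse (eP m)))"
    using hat_decay[OF d] by blast
  obtain B where B: "0 \<le> B" "\<And>k. cmod (u k) \<le> B" using near_bounded[OF u] by blast
  obtain D where D: "0 \<le> D" "\<And>k. cmod (u k * inverse (eP (m k))) \<le> D" using near_bounded[OF v] by blast
  have "near (\<lambda>k. u k * hat (m k) (deriv01 g)) 0"
  proof (rule nearI)
    fix k
    have m0: "0 < cmod (m k)" using m[of k] by linarith
    have "cmod (u k) * max 1 (cmod (inverse (eP (m k)))) \<le> B + D"
    proof (cases "1 \<le> cmod (inverse (eP (m k)))")
      case True
      then show ?thesis using B(1) D(2)[of k] by (simp add: norm_mult max_def)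
    next
      case False
      then show ?thesis using D(1) B(2)[of k] by (simp add: max_def)
    qed
    then have "C * (cmod (u k) * max 1 (cmod (inverse (eP (m k))))) \<le> C * (B + D)" by (rule mult_left_mono[OF _ C(1)])
    then have "cmod (u k) * cmod (m k * hat (m k) (deriv01 g)) \<le> C * (B + D)"
      using mult_left_mono[OF C(2)[of "m k"] norm_ge_zero[of "u k"]] by (simp add: mult_ac)
    then have "cmod (u k * hat (m k) (deriv01 g)) * cmod (m k) \<le> C * (B + D)"
      by (simp add: norm_mult mult_ac)
    then have "cmod (u k * hat (m k) (deriv01 g)) \<le> C * (B + D) / cmod (m k)"
      using m0 by (simp add: field_simps)
    also have "\<dots> \<le> C * (B + D) / (real k + 1)" using m[of k] B(1) D(1) C(1) m0
      by (intro divide_left_mono mult_pos_pos mult_nonneg_nonneg add_nonneg_nonneg) auto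
    finally show "cmod (u k * hat (m k) (deriv01 g) - 0) \<le> C * (B + D) / (real k + 1)" by simp
  qed
  then have "near (\<lambda>k. \<i> * ((u k * inverse (eP (m k))) * g 1 - u k * g 0) - \<i> * (u k * hat (m k) (deriv01 g)))
     (\<i> * (l' * g 1 - l * g 0) - \<i> * 0)"
    by (intro near_intros u v)
  then show ?thesis by (rule near_cong) (simp_all add: hat_by_parts[OF g] algebra_simps)
qed

lemma eP_alpha_sig: "eP (\<alpha> * sig k) = inverse (eP (sig k)) * tk k"
  and inv_eP_alpha_sig: "inverse (eP (\<alpha> * sig k)) = eP (sig k) * eP (\<alpha>\<^sup>2 * sig k)"
  using eP_prod[of "sig k"] by (simp_all add: field_simps)

lemma near_dDelta: "near (\<lambda>k. dDelta (sig k) * tk k) (\<i> * \<alpha> - 2 * \<i> * (\<alpha>\<^sup>2 * (- (\<alpha> / 2))))"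
proof -
  let ?P = "\<lambda>k. eP (sig k)" and ?I = "\<lambda>k. inverse (eP (sig k))" and ?p = "- (\<alpha> / 2)"
  have "near (\<lambda>k. \<i> * (?P k * tk k + \<alpha>\<^sup>2 * (?I k * tk k * tk k) + \<alpha>) - 2 * \<i> * (?I k * tk k + \<alpha>\<^sup>2 * ?P k + \<alpha> * (tk k * tk k)))
     (\<i> * (?p * 0 + \<alpha>\<^sup>2 * (inverse ?p * 0 * 0) + \<alpha>) - 2 * \<i> * (inverse ?p * 0 + \<alpha>\<^sup>2 * ?p + \<alpha> * (0 * 0)))"
    by (intro near_intros near_eP_sig near_inv_eP_sig near_tk)
  then show ?thesis
  proof (rule near_cong)
    fix k
    show "\<i> * (?P k * tk k + \<alpha>\<^sup>2 * (?I k * tk k * tk k) + \<alpha>) - 2 * \<i> * (?I k * tk k + \<alpha>\<^sup>2 * ?P k + \<alpha> * (tk k * tk k)) = dDelta (sig k) * tk k"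
      unfolding dDelta_def eP_alpha_sig inv_eP_alpha_sig by (simp add: algebra_simps)
  qed (simp add: algebra_simps)
qed

lemma near_inv_dDelta: "\<exists>l. near (\<lambda>k. inverse (dDelta (sig k) * tk k)) l"
proof
  show "near (\<lambda>k. inverse (dDelta (sig k) * tk k)) (inverse (\<i> * \<alpha> - 2 * \<i> * (\<alpha>\<^sup>2 * (- (\<alpha> / 2)))))"
  proof (rule near_inverse[OF near_dDelta, of "1/4"])
    have "\<alpha>\<^sup>2 * \<alpha> = 1" using alpha_mult(3)[of 1] by simp
    then have "\<i> * \<alpha> - 2 * \<i> * (\<alpha>\<^sup>2 * (- (\<alpha> / 2))) = \<i> * (\<alpha> + 1)" by (simp add: algebra_simps)
    moreover have "\<alpha> + 1 \<noteq> 0" by (simp add: complex_eq_iff)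
    ultimately show "\<i> * \<alpha> - 2 * \<i> * (\<alpha>\<^sup>2 * (- (\<alpha> / 2))) \<noteq> 0" by simp
    fix k
    have "cmod (eP (\<alpha>\<^sup>2 * sig k)) / 4 * cmod (tk k) \<le> cmod (dDelta (sig k)) * cmod (tk k)"
      by (intro mult_right_mono norm_dDelta_sig) simp
    then show "1/4 \<le> cmod (dDelta (sig k) * tk k)" by (simp add: norm_mult norm_inverse)
  qed simp
qed

lemma near_Nplus_sig:
  assumes g: "g \<in> smooth01"
  shows "\<exists>l. near (\<lambda>k. sig k * Nplus (sig k) g * tk k) l"
proof
  let ?P = "\<lambda>k. eP (sig k)" and ?I = "\<lambda>k. inverse (eP (sig k))" and ?p = "- (\<alpha> / 2)"
  \<comment> \<open>Coefficients of the three transforms in \<open>Nplus\<close>, multiplied by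
    \<open>tk k\<close>. The facts v0, v1, v2 provide the second limit that \<open>near_hat\<close>
    asks for.\<close>
  define u0 where "u0 k = ?P k * tk k + 2 * \<alpha> * ?P k + 2 * \<alpha>\<^sup>2 * (tk k * tk k)" for k
  define u1 where "u1 k = \<alpha> * (?I k * tk k * tk k) - 2 * \<alpha> * (?I k * tk k)" for k
  define u2 where "u2 k = \<alpha>\<^sup>2 - 2 * \<alpha>\<^sup>2 * (?I k * tk k)" for k
  have n0: "real k + 1 \<le> cmod (sig k)" "real k + 1 \<le> cmod (\<alpha> * sig k)" "real k + 1 \<le> cmod (\<alpha>\<^sup>2 * sig k)" for k
    using sig_decay(2)[of k] by (simp_all add: norm_mult norm_power)
  have u0: "near u0 (?p * 0 + 2 * \<alpha> * ?p + 2 * \<alpha>\<^sup>2 * (0 * 0))"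
    unfolding u0_def by (intro near_intros near_eP_sig near_inv_eP_sig near_tk)
  have v0: "near (\<lambda>k. u0 k * inverse (eP (sig k))) ((?p * 0 + 2 * \<alpha> * ?p + 2 * \<alpha>\<^sup>2 * (0 * 0)) * inverse ?p)"
    by (intro near_mult u0 near_inv_eP_sig)
  have u1: "near u1 (\<alpha> * (inverse ?p * 0 * 0) - 2 * \<alpha> * (inverse ?p * 0))"
    unfolding u1_def by (intro near_intros near_eP_sig near_inv_eP_sig near_tk)
  have "near (\<lambda>k. \<alpha> * tk k - 2 * \<alpha>) (\<alpha> * 0 - 2 * \<alpha>)"
    by (intro near_intros near_tk)
  then have v1: "near (\<lambda>k. u1 k * inverse (eP (\<alpha> * sig k))) (\<alpha> * 0 - 2 * \<alpha>)"
    by (rule near_cong) (simp_all add: u1_def inv_eP_alpha_sig algebra_simps)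
  have u2: "near u2 (\<alpha>\<^sup>2 - 2 * \<alpha>\<^sup>2 * (inverse ?p * 0))"
    unfolding u2_def by (intro near_intros near_eP_sig near_inv_eP_sig near_tk)
  have v2: "near (\<lambda>k. u2 k * inverse (eP (\<alpha>\<^sup>2 * sig k))) ((\<alpha>\<^sup>2 - 2 * \<alpha>\<^sup>2 * (inverse ?p * 0)) * 0)"
    by (intro near_mult u2 near_tk)
  let ?l = "\<lambda>l l'. \<i> * (l' * g 1 - l * g 0)"
  have "near (\<lambda>k. u0 k * (sig k * hat (sig k) g) + \<alpha>\<^sup>2 * (u1 k * (\<alpha> * sig k * hat (\<alpha> * sig k) g))
      + \<alpha> * (u2 k * (\<alpha>\<^sup>2 * sig k * hat (\<alpha>\<^sup>2 * sig k) g)))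
     (?l (?p * 0 + 2 * \<alpha> * ?p + 2 * \<alpha>\<^sup>2 * (0 * 0)) ((?p * 0 + 2 * \<alpha> * ?p + 2 * \<alpha>\<^sup>2 * (0 * 0)) * inverse ?p)
      + \<alpha>\<^sup>2 * ?l (\<alpha> * (inverse ?p * 0 * 0) - 2 * \<alpha> * (inverse ?p * 0)) (\<alpha> * 0 - 2 * \<alpha>)
      + \<alpha> * ?l (\<alpha>\<^sup>2 - 2 * \<alpha>\<^sup>2 * (inverse ?p * 0)) ((\<alpha>\<^sup>2 - 2 * \<alpha>\<^sup>2 * (inverse ?p * 0)) * 0))"
    (is "near ?f ?L")
    by (rule near_add[OF near_add[OF near_hat[OF g u0 v0 n0(1)] near_cmult[OF near_hat[OF g u1 v1 n0(2)]]]
       near_cmult[OF near_hat[OF g u2 v2 n0(3)]]])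
  then show "near (\<lambda>k. sig k * Nplus (sig k) g * tk k) ?L"
  proof (rule near_cong)
    fix k
    have a: "\<alpha>\<^sup>2 * (c * (\<alpha> * s * h)) = c * (s * h)" "\<alpha> * (c * (\<alpha>\<^sup>2 * s * h)) = c * (s * h)" for c s h
      using alpha_mult(3)[of "c * s * h"] by (simp_all add: mult_ac)
    have gen: "(P * t + 2 * b * P + 2 * b\<^sup>2 * (t * t)) * (s * h0) + (b * (I * t * t) - 2 * b * (I * t)) * (s * h1)
        + (b\<^sup>2 - 2 * b\<^sup>2 * (I * t)) * (s * h2)
        = s * (h0 * (P + 2 * b * (P * S) + 2 * b\<^sup>2 * t) + h1 * (b * (I * t) - 2 * b * I) + h2 * (b\<^sup>2 * S - 2 * b\<^sup>2 * I)) * t"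
      if "S * t = 1" for P t b S I s h0 h1 h2 :: complex
      using that by algebra
    show "?f k = sig k * Nplus (sig k) g * tk k"
      unfolding a unfolding Nplus_def inv_eP_alpha_sig u0_def u1_def u2_def unfolding eP_alpha_sig
      by (rule gen) simp
  qed simp
qed

lemma exp_lat: "exp (\<i> * lat k * of_real x) = exp (\<i> * lat 0 * of_real x) * exp (\<i> * of_real (2 * pi * x)) ^ k"
proof -
  have "lat k = lat 0 + of_nat k * of_real (2 * pi)" by (simp add: lat_def complex_eq_iff)
  then show ?thesis unfolding exp_of_nat_mult[symmetric] exp_add[symmetric] by (simp add: algebra_simps)
qed

lemma summable_res_sig:
  assumes g: "g \<in> smooth01" and x: "0 < x" "x < 1"
  shows "summable (\<lambda>k. res_term x g (sig k))"
proof -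
  obtain l1 where l1: "near (\<lambda>k. inverse (dDelta (sig k) * tk k)) l1" using near_inv_dDelta by blast
  obtain l2 where l2: "near (\<lambda>k. sig k * Nplus (sig k) g * tk k) l2" using near_Nplus_sig[OF g] by blast
  define w where "w = exp (\<i> * of_real (2 * pi * x))"
  have w: "cmod w = 1" "w \<noteq> 1"
  proof -
    show "cmod w = 1" by (simp add: w_def)
    show "w \<noteq> 1"
    proof
      assume "w = 1"
      then obtain n :: int where n: "2 * pi * x = of_int (2 * n) * pi" unfolding w_def exp_eq_1 by auto
      then have "x = of_int n" by simp
      with x show False by auto
    qed
  qed
  \<comment> \<open>Everything except the oscillating w^k / (k + 1); powers of \<open>sig k\<close>
    and \<open>tk k\<close> are inserted in cancelling pairs so that each factor has a
    limit.\<close>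
  define p where "p k = \<i> * exp (\<i> * lat 0 * of_real x) * (exp (\<i> * (sig k - lat k) * of_real x) *
     (of_nat (k + 1) / sig k) * (sig k * Nplus (sig k) g * tk k) * inverse (dDelta (sig k) * tk k))" for k
  have "near p (\<i> * exp (\<i> * lat 0 * of_real x) * (1 * (1 / (2 * of_real pi)) * l2 * l1))"
    unfolding p_def using x by (intro near_cmult near_mult near_exp_sig near_inv_sig l1 l2) auto
  from summable_near[OF this w] have "summable (\<lambda>k. w ^ k / of_nat (k + 1) * p k)" .
  moreover have "w ^ k / of_nat (k + 1) * p k = res_term x g (sig k)" for k
  proof -
    have im: "0 \<le> Im (sig k)" using sig_strip[of k] by (simp add: strip_def)
    have nz: "sig k \<noteq> 0" "dDelta (sig k) \<noteq> 0" "of_nat (k + 1) \<noteq> (0::complex)"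
      using sig_decay(2)[of k] dDelta_sig_neq_0 by (auto simp del: of_nat_Suc of_nat_add)
    have "\<i> * sig k * of_real x = \<i> * lat k * of_real x + \<i> * (sig k - lat k) * of_real x" by (simp add: algebra_simps)
    then have e: "exp (\<i> * sig k * of_real x) = exp (\<i> * lat 0 * of_real x) * w ^ k * exp (\<i> * (sig k - lat k) * of_real x)"
      by (simp only: exp_add exp_lat[of k] w_def)
    show ?thesis unfolding res_term_def e p_def Nsel_def using nz im by (simp add: field_simps del: of_nat_Suc of_nat_add)
  qed
  ultimately show ?thesis by simp
qed

section \<open>Exponentially small residues away from the real axis\<close>

lemma sig_norms:
  defines "S k \<equiv> cmod (eP (\<alpha>\<^sup>2 * sig k))"
  shows "cmod (eP (sig k)) \<le> 1" "cmod (inverse (eP (sig k))) \<le> 4" "cmod (tk k) \<le> 1"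
    "cmod (eP (\<alpha> * sig k)) \<le> 1" "cmod (inverse (eP (\<alpha> * sig k))) \<le> S k" "1 \<le> S k" "S k * cmod (tk k) = 1"
proof -
  note n = strip_norms[OF sig_strip[of k]]
  show "cmod (eP (sig k)) \<le> 1" "cmod (inverse (eP (sig k))) \<le> 4" "cmod (tk k) \<le> 1" using n by auto
  have "cmod (eP (\<alpha> * sig k)) \<le> 4 * (1/40)"
    unfolding eP_alpha_sig norm_mult using n by (intro mult_mono) auto
  then show "cmod (eP (\<alpha> * sig k)) \<le> 1" by simp
  have "cmod (inverse (eP (\<alpha> * sig k))) \<le> 1 * S k"
    unfolding inv_eP_alpha_sig norm_mult S_def using n by (intro mult_mono) auto
  then show "cmod (inverse (eP (\<alpha> * sig k))) \<le> S k" by simp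
  show St: "S k * cmod (tk k) = 1" by (simp add: S_def norm_inverse)
  have "0 \<le> S k" by (simp add: S_def)
  then have "S k * cmod (tk k) \<le> S k * 1" using \<open>cmod (tk k) \<le> 1\<close> by (intro mult_left_mono)
  with St show "1 \<le> S k" by simp
qed

text \<open>In each product only one factor has the size S of the dominant exponential: the
  transform at \<open>\<alpha> * sig k\<close> in one, the coefficient in the other two.\<close>

lemma norm_Nplus_alpha:
  assumes g: "g \<in> smooth01"
  shows "cmod (Nplus (\<alpha> * sig k) g) \<le> 27 * seminorm01 0 g * cmod (eP (\<alpha>\<^sup>2 * sig k))"
proof -
  define B where "B = seminorm01 0 g"
  define S where "S = cmod (eP (\<alpha>\<^sup>2 * sig k))"
  note n = sig_norms[of k, folded S_def]
  have B: "0 \<le> B" unfolding B_def by (rule seminorm01_nonneg[OF g])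
  have h: "cmod (hat (sig k) g) \<le> B * 4" "cmod (hat (\<alpha> * sig k) g) \<le> B * S" "cmod (hat (\<alpha>\<^sup>2 * sig k) g) \<le> B * 1"
    using n B by (auto intro!: order_trans[OF hat_smooth_bound[OF g]] mult_left_mono simp: B_def)
  have a2: "cmod (2 * \<alpha>) = 2" "cmod (2 * \<alpha>\<^sup>2) = 2" "cmod (\<alpha>\<^sup>2) = 1" by (simp_all add: norm_mult norm_power)
  have c0: "cmod (eP (\<alpha> * sig k) + 2 * \<alpha> * tk k + 2 * \<alpha>\<^sup>2 * inverse (eP (sig k))) \<le> 1 + 2 * 1 + 2 * 4"
    using n by (intro norm_triangle_mono; (simp only: norm_mult[of "2 * _"] a2)?; (intro mult_left_mono)?)
  have c1: "cmod (\<alpha> * eP (\<alpha>\<^sup>2 * sig k) - 2 * \<alpha> * inverse (eP (\<alpha> * sig k))) \<le> S + 2 * S"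
    using n by (intro order_trans[OF norm_triangle_ineq4] add_mono; simp only: norm_mult[of "2 * _"] a2; (intro mult_left_mono)?)
      (auto simp: S_def norm_mult)
  have c2: "cmod (\<alpha>\<^sup>2 * eP (sig k) - 2 * \<alpha>\<^sup>2 * inverse (eP (\<alpha> * sig k))) \<le> S + 2 * S"
    using n by (intro order_trans[OF norm_triangle_ineq4] add_mono; simp only: norm_mult[of "2 * _"] norm_mult[of "\<alpha>\<^sup>2"] a2; (intro mult_left_mono)?)
  have "cmod (Nplus (\<alpha> * sig k) g) \<le> (B * S) * (1 + 2 * 1 + 2 * 4) + (B * 1) * (S + 2 * S) + (B * 4) * (S + 2 * S)"
    unfolding Nplus_def alpha_mult
    by (intro norm_triangle_mono; simp only: norm_mult[of "hat _ _"]; intro mult_mono h c0 c1 c2) (use B n in auto)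
  also have "\<dots> = 26 * B * S" by (simp add: algebra_simps)
  also have "\<dots> \<le> 27 * B * S" using B n by (intro mult_right_mono) auto
  finally show ?thesis by (simp add: B_def S_def)
qed

text \<open>The bracket again has size S, but the prefactor is now \<open>tk k\<close>, of modulus
  1/S. A termwise estimate of \<open>Nplus\<close> would lack this gain, which has to make up for
  the growth of e^(izx) in the lower half-plane.\<close>

lemma norm_Nminus_alpha_sq:
  assumes g: "g \<in> smooth01"
  shows "cmod (Nminus (\<alpha>\<^sup>2 * sig k) g) \<le> 27 * seminorm01 0 g"
proof -
  define B where "B = seminorm01 0 g"
  define S where "S = cmod (eP (\<alpha>\<^sup>2 * sig k))"
  note n = sig_norms[of k, folded S_def]
  have B: "0 \<le> B" unfolding B_def by (rule seminorm01_nonneg[OF g])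
  have h: "cmod (hat (sig k) g) \<le> B * 4" "cmod (hat (\<alpha> * sig k) g) \<le> B * S" "cmod (hat (\<alpha>\<^sup>2 * sig k) g) \<le> B * 1"
    using n B by (auto intro!: order_trans[OF hat_smooth_bound[OF g]] mult_left_mono simp: B_def)
  have a2: "cmod (\<alpha>\<^sup>2) = 1" by (simp_all add: norm_power)
  have c0: "cmod (2 + \<alpha>\<^sup>2 * inverse (eP (sig k)) + \<alpha> * inverse (eP (\<alpha> * sig k))) \<le> 2 + 4 + S"
    using n by (intro norm_triangle_mono) (auto simp: norm_mult norm_power)
  have c1: "cmod (\<alpha> * (2 - inverse (eP (\<alpha> * sig k)))) \<le> 2 + S"
    using n order_trans[OF norm_triangle_ineq4[of 2 "inverse (eP (\<alpha> * sig k))"]] by (simp add: norm_mult)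
  have c2: "cmod (\<alpha>\<^sup>2 * (2 - inverse (eP (sig k)))) \<le> 2 + 4"
    using n order_trans[OF norm_triangle_ineq4[of 2 "inverse (eP (sig k))"]] by (simp add: norm_mult norm_power)
  have "cmod (hat (\<alpha>\<^sup>2 * sig k) g * (2 + \<alpha>\<^sup>2 * inverse (eP (sig k)) + \<alpha> * inverse (eP (\<alpha> * sig k)))
     + hat (sig k) g * (\<alpha> * (2 - inverse (eP (\<alpha> * sig k)))) + hat (\<alpha> * sig k) g * (\<alpha>\<^sup>2 * (2 - inverse (eP (sig k)))))
     \<le> (B * 1) * (2 + 4 + S) + (B * 4) * (2 + S) + (B * S) * (2 + 4)" (is "?c \<le> _")
    by (intro norm_triangle_mono; simp only: norm_mult[of "hat _ _"]; intro mult_mono h c0 c1 c2) (use B n in auto)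
  also have "\<dots> = B * (14 + 11 * S)" by (simp add: algebra_simps)
  also have "\<dots> \<le> B * (27 * S)" using B n by (intro mult_left_mono) auto
  finally have "cmod (tk k) * ?c \<le> cmod (tk k) * (B * (27 * S))" by (rule mult_left_mono) simp
  also have "\<dots> = 27 * B * (S * cmod (tk k))" by (simp add: algebra_simps)
  finally have "cmod (tk k) * ?c \<le> 27 * B" unfolding n by simp
  then show ?thesis unfolding Nminus_def alpha_mult norm_mult[of "- _"] norm_minus_cancel B_def .
qed

lemma summable_exp_bound:
  fixes f :: "nat \<Rightarrow> complex"
  assumes "0 < c" "\<And>k. cmod (f k) \<le> M * exp (- (c * real k))"
  shows "summable f"
proof (rule summable_comparison_test')
  have "summable (\<lambda>k. exp (- c) ^ k)" using assms(1) by (intro summable_geometric) simp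
  then show "summable (\<lambda>k. M * exp (- (c * real k)))"
    by (intro summable_mult) (simp add: exp_of_nat_mult[symmetric] mult.commute)
qed (rule assms(2))

text \<open>Above the real axis the exponential itself decays, at a rate proportional to x. Below it
  grows, but \<open>tk k\<close> outweighs it and leaves a rate proportional to 1 - x.\<close>

lemma sig_exp_bounds:
  assumes "0 < x" "x < 1"
  shows "cmod (exp (\<i> * (\<alpha> * sig k) * of_real x)) \<le> exp (- (x * real k))"
    "cmod (exp (\<i> * (\<alpha>\<^sup>2 * sig k) * of_real x)) * cmod (tk k) \<le> exp (- ((1 - x) * real k))"
proof -
  have ne: "cmod (exp (\<i> * w * of_real x)) = exp (- Im w * x)" for w
    by simp
  have i: "0 \<le> Im (sig k)" "Im (sig k) \<le> 2"
    using sig_strip[of k] ln2_le_25_over_36 by (auto simp: strip_def)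
  have "Im (\<alpha> * sig k) \<ge> real k" unfolding Im_alpha_mult using i sig_decay(1)[of k] by simp
  then have "x * real k \<le> x * Im (\<alpha> * sig k)" using assms by (intro mult_left_mono) auto
  then show "cmod (exp (\<i> * (\<alpha> * sig k) * of_real x)) \<le> exp (- (x * real k))"
    unfolding ne by (simp only: exp_le_cancel_iff) (simp add: mult.commute del: times_complex.sel)
  have "cmod (exp (\<i> * (\<alpha>\<^sup>2 * sig k) * of_real x)) = exp (- Im (\<alpha>\<^sup>2 * sig k) * x)"
    by (rule ne)
  moreover have "cmod (tk k) = exp (Im (\<alpha>\<^sup>2 * sig k))" by (rule norm_inv_eP)
  ultimately have "cmod (exp (\<i> * (\<alpha>\<^sup>2 * sig k) * of_real x)) * cmod (tk k) = exp ((1 - x) * Im (\<alpha>\<^sup>2 * sig k))"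
    by (simp add: algebra_simps flip: exp_add)
  moreover have "Im (\<alpha>\<^sup>2 * sig k) \<le> - real k" unfolding Im_alpha_sq_mult using i sig_decay(1)[of k] by simp
  then have "(1 - x) * Im (\<alpha>\<^sup>2 * sig k) \<le> (1 - x) * - real k" using assms by (intro mult_left_mono) auto
  ultimately show "cmod (exp (\<i> * (\<alpha>\<^sup>2 * sig k) * of_real x)) * cmod (tk k) \<le> exp (- ((1 - x) * real k))" by simp
qed

lemma norm_dDelta_zr: "i < 6 \<Longrightarrow> cmod (eP (\<alpha>\<^sup>2 * sig k)) / 4 \<le> cmod (dDelta (zr i k))"
  using norm_dDelta_sig[of k] by (simp add: dDelta_zr)

lemma dDelta_zr_neq_0: "i < 6 \<Longrightarrow> dDelta (zr i k) \<noteq> 0"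
  using dDelta_zr[of i k] dDelta_sig_neq_0[of k] by auto

lemma summable_res_alpha:
  assumes g: "g \<in> smooth01" and x: "0 < x" "x < 1"
  shows "summable (\<lambda>k. res_term x g (zr 1 k))"
proof (rule summable_exp_bound[OF x(1)])
  fix k
  let ?B = "seminorm01 0 g"
  define S where "S = cmod (eP (\<alpha>\<^sup>2 * sig k))"
  note n = sig_norms[of k, folded S_def]
  have B: "0 \<le> ?B" by (rule seminorm01_nonneg[OF g])
  have "0 \<le> Im (zr 1 k)" using Im_zr[of 1 k] by simp
  then have "cmod (res_term x g (zr 1 k)) = cmod (exp (\<i> * (\<alpha> * sig k) * of_real x)) * cmod (Nplus (\<alpha> * sig k) g) / cmod (dDelta (zr 1 k))"
    by (simp add: res_term_def Nsel_def zr_simps norm_mult norm_divide del: norm_exp_eq_Re)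
  also have "\<dots> \<le> exp (- (x * real k)) * (27 * ?B * S) / (S / 4)"
    using norm_dDelta_zr[of 1 k] norm_Nplus_alpha[OF g, of k] sig_exp_bounds(1)[OF x, of k] n B
    by (intro frac_le mult_mono) (auto simp: S_def)
  also have "\<dots> = (108 * ?B) * exp (- (x * real k))" using n(6) by simp
  finally show "cmod (res_term x g (zr 1 k)) \<le> (108 * ?B) * exp (- (x * real k))" .
qed

lemma summable_res_alpha_sq:
  assumes g: "g \<in> smooth01" and x: "0 < x" "x < 1"
  shows "summable (\<lambda>k. res_term x g (zr 2 k))"
proof (rule summable_exp_bound)
  show "0 < 1 - x" using x by simp
  fix k
  let ?B = "seminorm01 0 g"
  define S where "S = cmod (eP (\<alpha>\<^sup>2 * sig k))"
  note n = sig_norms[of k, folded S_def]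
  have B: "0 \<le> ?B" by (rule seminorm01_nonneg[OF g])
  let ?e = "cmod (exp (\<i> * (\<alpha>\<^sup>2 * sig k) * of_real x))"
  have "\<not> 0 \<le> Im (zr 2 k)" using Im_zr[of 2 k] by simp
  then have "cmod (res_term x g (zr 2 k)) = ?e * cmod (Nminus (\<alpha>\<^sup>2 * sig k) g) / cmod (dDelta (zr 2 k))"
    by (simp add: res_term_def Nsel_def zr_simps norm_mult norm_divide del: norm_exp_eq_Re)
  also have "\<dots> \<le> ?e * (27 * ?B) / (S / 4)"
    using norm_dDelta_zr[of 2 k] norm_Nminus_alpha_sq[OF g, of k] n B
    by (intro frac_le mult_mono) (auto simp: S_def)
  also have "\<dots> = (108 * ?B) * (?e * cmod (tk k))" using n(6,7) by (simp add: field_simps)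
  also have "\<dots> \<le> (108 * ?B) * exp (- ((1 - x) * real k))"
    using B sig_exp_bounds(2)[OF x, of k] by (intro mult_left_mono) auto
  finally show "cmod (res_term x g (zr 2 k)) \<le> (108 * ?B) * exp (- ((1 - x) * real k))" .
qed

section \<open>Reflection: the families 3, 4, 5 reduce to 0, 1, 2\<close>

lemma smooth01_cnj: "g \<in> smooth01 \<Longrightarrow> (\<lambda>x. cnj (g x)) \<in> smooth01"
proof -
  assume g: "g \<in> smooth01"
  have d: "((\<lambda>x. cnj ((deriv01 ^^ k) g x)) has_vector_derivative cnj ((deriv01 ^^ Suc k) g x)) (at x within {0..1})"
    if "x \<in> {0..1}" for x k
    by (intro has_vector_derivative_cnj smooth01_has_deriv g that)
  have eq: "(deriv01 ^^ k) (\<lambda>x. cnj (g x)) = (\<lambda>x. cnj ((deriv01 ^^ k) g x))" for k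
  proof (induction k)
    case (Suc k)
    have "deriv01 (\<lambda>x. cnj ((deriv01 ^^ k) g x)) x = cnj ((deriv01 ^^ Suc k) g x)" for x
      using deriv01_eqI[OF _ d] by (cases "x \<in> {0..1}") (auto simp: deriv01_def)
    then show ?case by (simp only: funpow.simps o_def Suc.IH)
  qed simp
  have "(deriv01 ^^ k) (\<lambda>x. cnj (g x)) differentiable (at x within {0..1})" if "x \<in> {0..1}" for k x
    unfolding eq by (rule differentiableI_vector[OF d[OF that]])
  then show ?thesis using g by (auto simp: smooth01_def)
qed

lemma hat_mcnj: "hat (- cnj m) g = cnj (hat m (\<lambda>x. cnj (g x)))"
  unfolding hat_def integral_cnj by (simp add: exp_cnj)

lemma hat_alpha_mcnj:
  "hat (\<alpha> * - cnj z) g = cnj (hat (\<alpha>\<^sup>2 * z) (\<lambda>x. cnj (g x)))"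
  "hat (\<alpha>\<^sup>2 * - cnj z) g = cnj (hat (\<alpha> * z) (\<lambda>x. cnj (g x)))"
  unfolding hat_mcnj[symmetric] cnj_alpha_mult by simp_all

text \<open>Reflection preserves Im, hence the branch, and interchanges the rotations by \<alpha>
  and \<alpha>^2 together with their coefficients, so two summands trade places.\<close>

lemma Nsel_mcnj: "Nsel (- cnj \<sigma>) (- cnj z) g = cnj (Nsel \<sigma> z (\<lambda>x. cnj (g x)))"
proof -
  have c: "cnj \<alpha> = \<alpha>\<^sup>2" "cnj (\<alpha>\<^sup>2) = \<alpha>" using cnj_alpha cnj_alpha_mult(2)[of 1] by simp_all
  show ?thesis
    unfolding Nsel_def Nplus_def Nminus_def eP_mcnj eP_alpha_mcnj hat_mcnj hat_alpha_mcnj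
    by (simp add: c algebra_simps del: complex_cnj_power)
qed

lemma res_term_mcnj: "res_term x g (- cnj \<sigma>) = cnj (res_term x (\<lambda>x. cnj (g x)) \<sigma>)"
proof -
  have "exp (\<i> * (- cnj \<sigma>) * of_real x) = cnj (exp (\<i> * \<sigma> * of_real x))"
    by (simp add: exp_cnj)
  then show ?thesis unfolding res_term_def Nsel_mcnj dDelta_mcnj by simp
qed

lemma summable_cnj: "summable f \<Longrightarrow> summable (\<lambda>k. cnj (f k))"
  unfolding summable_def by (metis sums_cnj)

lemma summable_res_zr:
  assumes g: "g \<in> smooth01" and x: "0 < x" "x < 1" and i: "i < 6"
  shows "summable (\<lambda>k. res_term x g (zr i k))"
proof -
  have s: "summable (\<lambda>k. res_term x g (zr i k))" if "g \<in> smooth01" "i < 3" for i g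
  proof -
    from that(2) consider "i = 0" | "i = 1" | "i = 2" by (auto simp: less_Suc_eq numeral_eq_Suc)
    then show ?thesis
    proof cases
      case 1 then show ?thesis using summable_res_sig[OF that(1) x] by (simp only: zr_simps)
    next
      case 2 then show ?thesis using summable_res_alpha[OF that(1) x] by simp
    next
      case 3 then show ?thesis using summable_res_alpha_sq[OF that(1) x] by simp
    qed
  qed
  show ?thesis
  proof (cases "i < 3")
    case True then show ?thesis using s g by blast
  next
    case False
    then have "i - 3 < 3" using i by simp
    then have "zr i k = - cnj (zr (i - 3) k)" for k using False by (simp add: zr_def)
    moreover have "summable (\<lambda>k. cnj (res_term x (\<lambda>x. cnj (g x)) (zr (i - 3) k)))"
      using s[OF smooth01_cnj[OF g], of "i - 3"] i False by (simp add: summable_cnj)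
    ultimately show ?thesis by (simp add: res_term_mcnj)
  qed
qed

section \<open>Enumeration of the zeros\<close>

text \<open>Witness that an enumeration by modulus exists: first 0, then blocks of six zeros of
  equal modulus.\<close>

definition zenum :: "nat \<Rightarrow> complex" where
  "zenum n = (case n of 0 \<Rightarrow> 0 | Suc m \<Rightarrow> zr (m mod 6) (m div 6))"

text \<open>0 and the first n blocks: the set that every enumeration by modulus exhausts with its
  first 6 n + 1 terms.\<close>

definition zinit :: "nat \<Rightarrow> complex set" where
  "zinit n = insert 0 ((\<lambda>(i, k). zr i k) ` ({..<6} \<times> {..<n}))"

lemma zr_neq_0: "zr i k \<noteq> 0"
  using norm_zr[of i k] sig_decay(2)[of k] by auto

lemma zenum_inj: "inj zenum"
proof (rule injI)
  fix m n assume e: "zenum m = zenum n"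
  show "m = n"
  proof (cases m; cases n)
    fix m' n' assume mn: "m = Suc m'" "n = Suc n'"
    then have "m' mod 6 = n' mod 6 \<and> m' div 6 = n' div 6" using e zr_inj[of "m' mod 6" "n' mod 6" "m' div 6" "n' div 6"] by (simp add: zenum_def)
    then show ?thesis using mn by (metis div_mult_mod_eq)
  qed (use e zr_neq_0 zr_neq_0[symmetric] in \<open>auto simp: zenum_def\<close>)
qed

lemma zenum_image: "zenum ` {..<6 * n + 1} = zinit n"
proof (intro equalityI subsetI)
  fix z assume "z \<in> zenum ` {..<6 * n + 1}"
  then obtain m where m: "z = zenum m" "m < 6 * n + 1" by auto
  show "z \<in> zinit n"
  proof (cases m)
    case 0 then show ?thesis using m by (simp add: zenum_def zinit_def)
  next
    case (Suc m')
    then have "m' div 6 < n" "m' mod 6 < 6" using m by auto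
    then show ?thesis using m Suc by (auto simp: zenum_def zinit_def intro!: image_eqI[of _ _ "(m' mod 6, m' div 6)"])
  qed
next
  fix z assume "z \<in> zinit n"
  then consider "z = 0" | i k where "z = zr i k" "i < 6" "k < n" by (auto simp: zinit_def)
  then show "z \<in> zenum ` {..<6 * n + 1}"
  proof cases
    case 1 then show ?thesis by (intro image_eqI[of _ _ 0]) (auto simp: zenum_def)
  next
    case 2
    then show ?thesis by (intro image_eqI[of _ _ "Suc (6 * k + i)"]) (auto simp: zenum_def)
  qed
qed

lemma card_zinit: "finite (zinit n)" "card (zinit n) = 6 * n + 1"
proof -
  show "finite (zinit n)" by (simp add: zinit_def)
  show "card (zinit n) = 6 * n + 1"
    unfolding zenum_image[symmetric] by (subst card_image[OF inj_on_subset[OF zenum_inj]]) simp_all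
qed

lemma modulus_enumeration_zenum: "modulus_enumeration zenum"
  unfolding modulus_enumeration_def
proof
  have "range zenum = Delta_zeros"
  proof (intro equalityI subsetI)
    fix z assume "z \<in> range zenum"
    then obtain n where n: "z = zenum n" by blast
    show "z \<in> Delta_zeros"
    proof (cases n)
      case 0 then show ?thesis using n by (simp add: zenum_def Delta_zeros_zr)
    next
      case (Suc m)
      have "m mod 6 < 6" by simp
      then show ?thesis unfolding n Delta_zeros_zr Suc zenum_def by (simp only: nat.case) blast
    qed
  next
    fix z assume "z \<in> Delta_zeros"
    then have "\<exists>n. z \<in> zinit n" unfolding Delta_zeros_zr zinit_def by fastforce
    then show "z \<in> range zenum" using zenum_image by blast
  qed
  then show "bij_betw zenum UNIV Delta_zeros" using zenum_inj by (simp add: bij_betw_def)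
  show "mono (\<lambda>k. cmod (zenum k))"
  proof (rule monoI)
    fix m n :: nat assume mn: "m \<le> n"
    show "cmod (zenum m) \<le> cmod (zenum n)"
    proof (cases m)
      case 0 then show ?thesis by (simp add: zenum_def)
    next
      case (Suc m')
      then obtain n' where n: "n = Suc n'" using mn by (cases n) auto
      then have "m' div 6 \<le> n' div 6" using mn Suc by (simp add: div_le_mono)
      then have "cmod (sig (m' div 6)) \<le> cmod (sig (n' div 6))"
        using norm_sig_mono[of "m' div 6" "n' div 6"] by (cases "m' div 6 = n' div 6") auto
      then show ?thesis using Suc n by (simp add: zenum_def norm_zr)
    qed
  qed
qed

lemma zinit_less:
  assumes "z \<in> zinit n" "w \<in> Delta_zeros" "w \<notin> zinit n"
  shows "cmod z < cmod w"
proof -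
  obtain j l where w: "w = zr j l" "j < 6" using assms(2,3) unfolding Delta_zeros_zr zinit_def by auto
  then have l: "n \<le> l" using assms(3) by (force simp: zinit_def)
  consider "z = 0" | i k where "z = zr i k" "k < n" using assms(1) by (auto simp: zinit_def)
  then show ?thesis
  proof cases
    case 1 then show ?thesis using zr_neq_0 w by simp
  next
    case 2 then show ?thesis using l w norm_sig_mono[of k l] by (simp add: norm_zr)
  qed
qed

text \<open>If an element of \<open>zinit n\<close> had an index j >= 6 n + 1, all j + 1 values up
  to it would have no larger modulus and so lie in \<open>zinit n\<close>, which has only 6 n + 1
  elements.\<close>

lemma modulus_enumeration_image:
  assumes "modulus_enumeration s"
  shows "s ` {..<6 * n + 1} = zinit n"
proof -
  have s: "bij_betw s UNIV Delta_zeros" "mono (\<lambda>k. cmod (s k))"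
    using assms by (auto simp: modulus_enumeration_def)
  have inj: "inj s" using s by (simp add: bij_betw_def)
  have rng: "s k \<in> Delta_zeros" for k using s(1) by (auto simp: bij_betw_def)
  have sub: "zinit n \<subseteq> s ` {..<6 * n + 1}"
  proof
    fix z assume z: "z \<in> zinit n"
    then have "z \<in> Delta_zeros" unfolding Delta_zeros_zr zinit_def by auto
    then obtain j where j: "z = s j" using s(1) by (auto simp: bij_betw_def)
    have "j < 6 * n + 1"
    proof (rule ccontr)
      assume nj: "\<not> j < 6 * n + 1"
      have "s ` {..j} \<subseteq> zinit n"
      proof safe
        fix i assume "i \<le> j"
        then have "cmod (s i) \<le> cmod z" using monoD[OF s(2)] j by simp
        then show "s i \<in> zinit n" using zinit_less[OF z rng, of i] by fastforce
      qed
      then have "card (s ` {..j}) \<le> 6 * n + 1" using card_mono card_zinit by metis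
      moreover have "card (s ` {..j}) = j + 1" using inj by (simp add: card_image inj_on_subset)
      ultimately show False using nj by simp
    qed
    then show "z \<in> s ` {..<6 * n + 1}" using j by auto
  qed
  moreover have "card (s ` {..<6 * n + 1}) = 6 * n + 1"
    using card_image[OF inj_on_subset[OF inj], of "{..<6 * n + 1}"] by simp
  ultimately show ?thesis using card_subset_eq[OF _ sub] card_zinit by simp
qed

lemma sum_zinit:
  "(\<Sum>z\<in>zinit n. a z) = a 0 + (\<Sum>k<n. \<Sum>i<6. a (zr i k))"
proof -
  have inj: "inj_on (\<lambda>(i, k). zr i k) ({..<6} \<times> {..<n})"
    by (rule inj_onI) (auto dest: zr_inj)
  have "(\<Sum>z\<in>zinit n. a z) = a 0 + (\<Sum>z\<in>(\<lambda>(i, k). zr i k) ` ({..<6} \<times> {..<n}). a z)"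
    unfolding zinit_def
  proof (rule sum.insert)
    show "0 \<notin> (\<lambda>(i, k). zr i k) ` ({..<6} \<times> {..<n})"
    proof
      assume "0 \<in> (\<lambda>(i, k). zr i k) ` ({..<6} \<times> {..<n})"
      then obtain i k where "0 = zr i k" by auto
      then show False using zr_neq_0[of i k] by simp
    qed
  qed simp
  also have "(\<Sum>z\<in>(\<lambda>(i, k). zr i k) ` ({..<6} \<times> {..<n}). a z) = (\<Sum>(i, k)\<in>{..<6} \<times> {..<n}. a (zr i k))"
    by (subst sum.reindex[OF inj]) (simp add: o_def case_prod_unfold)
  also have "\<dots> = (\<Sum>i<6. \<Sum>k<n. a (zr i k))" by (simp add: sum.cartesian_product)
  also have "\<dots> = (\<Sum>k<n. \<Sum>i<6. a (zr i k))" by (rule sum.swap)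
  finally show ?thesis .
qed

text \<open>Partial sums at the block ends are the same for all enumerations; inside a block they
  deviate by at most the sum of its six moduli, which tends to 0. This gives one value for every
  admissible order.\<close>

lemma modulus_enumeration_sums:
  fixes a :: "complex \<Rightarrow> complex"
  assumes a: "\<And>i. i < 6 \<Longrightarrow> summable (\<lambda>k. a (zr i k))" and s: "modulus_enumeration s"
  shows "(\<lambda>k. a (s k)) sums (a 0 + (\<Sum>i<6. \<Sum>k. a (zr i k)))"
proof -
  let ?v = "a 0 + (\<Sum>i<6. \<Sum>k. a (zr i k))"
  define A where "A n = a 0 + (\<Sum>k<n. \<Sum>i<6. a (zr i k))" for n
  define e where "e n = (\<Sum>i<6. cmod (a (zr i n)))" for n
  have inj: "inj s" using s by (simp add: modulus_enumeration_def bij_betw_def)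
  have "(\<lambda>k. \<Sum>i<6. a (zr i k)) sums (\<Sum>i<6. \<Sum>k. a (zr i k))"
    by (rule sums_sum) (use a in \<open>auto intro: summable_sums\<close>)
  then have A: "A \<longlonglongrightarrow> ?v" unfolding A_def sums_def by (intro tendsto_add tendsto_const)
  have "(\<lambda>n. \<Sum>i<6. cmod (a (zr i n))) \<longlonglongrightarrow> (\<Sum>i<(6::nat). 0)"
    by (intro tendsto_sum tendsto_norm_zero summable_LIMSEQ_zero a) simp
  then have e: "e \<longlonglongrightarrow> 0" by (simp add: e_def[abs_def])
  \<comment> \<open>The subtracted 1 accounts for the zero 0, which precedes the blocks.\<close>
  have m: "filterlim (\<lambda>N. (N - 1) div 6 :: nat) at_top at_top"
    unfolding filterlim_at_top
  proof
    fix Z :: nat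
    show "\<forall>\<^sub>F N in sequentially. Z \<le> (N - 1) div 6"
      using eventually_ge_at_top[of "6 * Z + 1"] by eventually_elim auto
  qed
  have init: "(\<Sum>k<6 * n + 1. a (s k)) = A n" for n
  proof -
    have "(\<Sum>k<6 * n + 1. a (s k)) = (\<Sum>z\<in>s ` {..<6 * n + 1}. a z)"
      by (subst sum.reindex) (auto intro: inj_on_subset[OF inj])
    then show ?thesis unfolding modulus_enumeration_image[OF s] sum_zinit A_def .
  qed
  have block: "(\<Sum>k\<in>{6 * n + 1..<6 * Suc n + 1}. cmod (a (s k))) = e n" for n
  proof -
    have "s ` {6 * n + 1..<6 * Suc n + 1} = s ` ({..<6 * Suc n + 1} - {..<6 * n + 1})"
      by (intro arg_cong[of _ _ "\<lambda>A. s ` A"]) auto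
    also have "\<dots> = zinit (Suc n) - zinit n"
      unfolding image_set_diff[OF inj] modulus_enumeration_image[OF s] ..
    also have "\<dots> = (\<lambda>i. zr i n) ` {..<6}"
    proof -
      have "zr i n \<notin> zinit n" if "i < 6" for i
      proof
        assume "zr i n \<in> zinit n"
        then obtain j k where jk: "zr i n = zr j k" "j < 6" "k < n"
          using zr_neq_0[of i n] by (auto simp: zinit_def)
        then show False using zr_inj[OF that jk(2,1)] by simp
      qed
      then have "(\<lambda>i. zr i n) ` {..<6} \<inter> zinit n = {}" by auto
      moreover have "zinit (Suc n) = zinit n \<union> (\<lambda>i. zr i n) ` {..<6}"
        by (auto simp: zinit_def less_Suc_eq)
      ultimately show ?thesis by auto
    qed
    finally have im: "s ` {6 * n + 1..<6 * Suc n + 1} = (\<lambda>i. zr i n) ` {..<6}" .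
    have "(\<Sum>k\<in>{6 * n + 1..<6 * Suc n + 1}. cmod (a (s k))) = (\<Sum>z\<in>s ` {6 * n + 1..<6 * Suc n + 1}. cmod (a z))"
      by (subst sum.reindex) (auto intro: inj_on_subset[OF inj])
    also have "\<dots> = e n" unfolding im e_def
      by (subst sum.reindex) (auto intro!: inj_onI dest: zr_inj)
    finally show ?thesis .
  qed
  have "(\<lambda>N. (\<Sum>k<N. a (s k)) - A ((N - 1) div 6)) \<longlonglongrightarrow> 0"
  proof (rule Lim_null_comparison)
    show "(\<lambda>N. e ((N - 1) div 6)) \<longlonglongrightarrow> 0" by (rule filterlim_compose[OF e m])
    show "\<forall>\<^sub>F N in sequentially. cmod ((\<Sum>k<N. a (s k)) - A ((N - 1) div 6)) \<le> e ((N - 1) div 6)"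
      using eventually_ge_at_top[of 1]
    proof eventually_elim
      case (elim N)
      define n where "n = (N - 1) div 6"
      have N: "6 * n + 1 \<le> N" "N \<le> 6 * Suc n + 1" using elim by (auto simp: n_def)
      have "(\<Sum>k<N. a (s k)) = A n + (\<Sum>k\<in>{6 * n + 1..<N}. a (s k))"
        using N(1) sum.atLeastLessThan_concat[of 0 "6 * n + 1" N "\<lambda>k. a (s k)"] init[of n]
        by (simp add: atLeast0LessThan)
      then have "cmod ((\<Sum>k<N. a (s k)) - A n) \<le> (\<Sum>k\<in>{6 * n + 1..<N}. cmod (a (s k)))"
        by (simp add: norm_sum)
      also have "\<dots> \<le> e n" unfolding block[symmetric] using N by (intro sum_mono2) auto
      finally show ?case by (simp add: n_def)
    qed
  qed
  from tendsto_add[OF this filterlim_compose[OF A m]] show ?thesis by (simp add: sums_def)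
qed

lemma has_integral_gamma_F:
  assumes g: "g \<in> smooth01" and x: "0 < x" "x < 1"
  shows "\<exists>v. has_integral_gamma (\<lambda>z. exp (\<i> * z * of_real x) * F z g) v"
proof -
  \<comment> \<open>At 0 the contour integral is kept as it stands; only at the simple zeros
    \<open>zr i k\<close> is it replaced by a residue.\<close>
  let ?a = "\<lambda>\<sigma>. contour_integral (Gam \<sigma>) (\<lambda>z. exp (\<i> * z * of_real x) * F z g)"
  have "?a (zr i k) = res_term x g (zr i k)" if "i < 6" for i k
    using that by (intro contour_integral_F smooth01_cont0[OF g] dDelta_zr_neq_0) (auto simp: Delta_zeros_zr)
  then have "summable (\<lambda>k. ?a (zr i k))" if "i < 6" for i
    using summable_res_zr[OF g x that] that by simp
  from modulus_enumeration_sums[of ?a, OF this] show ?thesis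
    unfolding has_integral_gamma_def
    using contour_integral_F(1)[OF _ smooth01_cont0[OF g]] modulus_enumeration_zenum by blast
qed

lemma has_integral_gamma_cong:
  assumes "has_integral_gamma f v"
    and "\<And>\<sigma>. \<sigma> \<in> Delta_zeros \<Longrightarrow> (g has_contour_integral contour_integral (Gam \<sigma>) f) (Gam \<sigma>)"
  shows "has_integral_gamma g v"
proof -
  have "contour_integral (Gam (s k)) g = contour_integral (Gam (s k)) f" if "modulus_enumeration s" for s k
    using assms(2)[of "s k"] that by (intro contour_integral_unique) (auto simp: modulus_enumeration_def bij_betw_def)
  then show ?thesis using assms unfolding has_integral_gamma_def contour_integrable_on_def by (auto cong: sums_cong)
qed

lemma has_integral_gamma_Rem:
  assumes "f \<in> Phi_space"
  shows "has_integral_gamma (\<lambda>z. exp (\<i> * z * of_real x) * Rem z f) 0"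
proof (rule has_integral_gamma_cong[of "\<lambda>z. 0"])
  show "has_integral_gamma (\<lambda>z. 0) 0"
    using modulus_enumeration_zenum has_contour_integral_0
    unfolding has_integral_gamma_def contour_integrable_on_def by auto
qed (use contour_integral_Rem[OF _ assms] in simp)

lemma Phi_space_smooth: "f \<in> Phi_space \<Longrightarrow> f \<in> smooth01"
  by (simp add: Phi_space_def)

text \<open>The integrands differ by the remainder, whose integral over each single circle is 0. The
  two series agree term by term, so convergence and value carry over.\<close>

lemma has_integral_gamma_eigen:
  assumes "f \<in> Phi_space" "has_integral_gamma (\<lambda>z. exp (\<i> * z * of_real x) * F z (S_op f)) v"
  shows "has_integral_gamma (\<lambda>z. exp (\<i> * z * of_real x) * (z ^ 3 * F z f)) v"
proof (rule has_integral_gamma_cong[OF assms(2)])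
  fix \<sigma> assume s: "\<sigma> \<in> Delta_zeros"
  let ?I = "contour_integral (Gam \<sigma>) (\<lambda>z. exp (\<i> * z * of_real x) * F z (S_op f))"
  have "((\<lambda>z. exp (\<i> * z * of_real x) * F z (S_op f)) has_contour_integral ?I) (Gam \<sigma>)"
    by (intro has_contour_integral_integral contour_integral_F s smooth01_cont0 S_op_smooth Phi_space_smooth assms)
  from has_contour_integral_diff[OF this contour_integral_Rem[OF s assms(1), of x]]
  show "((\<lambda>z. exp (\<i> * z * of_real x) * (z ^ 3 * F z f)) has_contour_integral ?I) (Gam \<sigma>)"
    by (simp add: Rem_def algebra_simps)
qed

lemma lin_subspace_Phi: "lin_subspace Phi_space"
proof -
  have d: "deriv01 (\<lambda>x. f x + g x) = (\<lambda>x. deriv01 f x + deriv01 g x)" "deriv01 (\<lambda>x. c * f x) = (\<lambda>x. c * deriv01 f x)"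
    if "f \<in> smooth01" "g \<in> smooth01" for f g c
    using smooth01_add(1)[OF that, of 1] smooth01_cmult(1)[OF that, of 1] by simp_all
  have "deriv01 (\<lambda>x. 0) = (\<lambda>x. 0)" using deriv01_funpow_zero[of 1] by simp
  then show ?thesis
    unfolding lin_subspace_def Phi_space_def
    by (auto simp: smooth01_zero smooth01_add(2) smooth01_cmult(2) d algebra_simps)
qed

section \<open>The spectral representation\<close>

theorem theorem1p6:
  shows "spectral_representation_typeI {0<..<1} smooth01_topology Phi_space S_op 3
           gamma_contour has_integral_gamma F"
proof -
  have "typeI_augmented_eigenfunctions {0<..<1} smooth01_topology Phi_space S_op 3 gamma_contour has_integral_gamma F"
    unfolding typeI_augmented_eigenfunctions_def
  proof (intro conjI)
    show "linear_topological_space_on (closure {0<..<1}) smooth01_topology"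
      using linear_topological_space_smooth01 by simp
    show "Phi_space \<subseteq> topspace smooth01_topology" by (auto simp: Phi_space_def)
    show "linear_operator Phi_space (topspace smooth01_topology) S_op"
      unfolding linear_operator_def
    proof (intro conjI ballI allI)
      fix f g assume "f \<in> Phi_space" "g \<in> Phi_space"
      then have fg: "f \<in> smooth01" "g \<in> smooth01" by (auto intro: Phi_space_smooth)
      show "S_op f \<in> topspace smooth01_topology" using S_op_smooth[OF fg(1)] by simp
      show "S_op (\<lambda>x. f x + g x) = (\<lambda>x. S_op f x + S_op g x)" using S_op_lincomb[OF fg, of 1 1] by simp
      show "S_op (\<lambda>x. c * f x) = (\<lambda>x. c * S_op f x)" for c using S_op_lincomb[OF fg, of c 0] by simp
    qed
    show "\<exists>R. (\<forall>z\<in>gamma_contour. R z \<in> topological_dual (subtopology smooth01_topology Phi_space)) \<and>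
        (\<forall>\<phi>\<in>Phi_space. \<forall>z\<in>gamma_contour. F z (S_op \<phi>) = z ^ 3 * F z \<phi> + R z \<phi>) \<and>
        (\<forall>\<phi>\<in>Phi_space. \<forall>x\<in>{0<..<1}. has_integral_gamma (\<lambda>z. exp (\<i> * z * of_real x) * R z \<phi>) 0)"
      using has_integral_gamma_Rem
      by (intro exI[of _ Rem] conjI ballI topological_dual_subtopology Rem_dual) (auto simp: Rem_def)
  qed (auto simp: lin_subspace_Phi F_dual is_interval_oo)
  moreover have "\<exists>v. has_integral_gamma (\<lambda>z. exp (\<i> * z * of_real x) * F z (S_op \<phi>)) v \<and>
      has_integral_gamma (\<lambda>z. exp (\<i> * z * of_real x) * (z ^ 3 * F z \<phi>)) v"
    if "\<phi> \<in> Phi_space" "x \<in> {0<..<1}" for \<phi> x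
    using has_integral_gamma_F[OF S_op_smooth[OF Phi_space_smooth[OF that(1)]], of x]
      has_integral_gamma_eigen[OF that(1)] that(2) by auto
  ultimately show ?thesis
    unfolding spectral_representation_typeI_def using complete_family_F by blast
qed

end
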